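(* Let $f:M\to M$, $M=\mathbb{T}^2\times\mathbb{S}\times\mathbb{T}^2$, be the $C^\infty$ diffeomorphism constructed in the context, with points $p_1,p_2,q_1,q_2\in\mathbb{T}^2$ and splitting $TM=\widetilde{E^{uu}}\oplus_\succ E^{cu}\oplus_\succ E^{cs}$ described there. Then the set $$S=\{(q_1,0,q_1),\,(q_2,1,q_2)\}$$ is a skeleton for $f$. Moreover, the closure of $W^u((q_1,0,q_1),f)$ contains the points $(p_1,0,p_1)$ and $(q_2,0,q_2)$, and the closure of $W^u((q_2,1,q_2),f)$ contains the points $(p_2,1,p_2)$ and $(q_1,1,q_1)$.
   Context: Domination. $E\oplus_\succ F$ means: $E,F$ are $Df$-invariant of constant dimension, with trivial intersection and angles uniformly bounded away from $0$, and there are $c>0$, $\sigma<1$ with $\|Df^n v_F\|/\|Df^n v_E\|\le c\sigma^n\|v_F\|/\|v_E\|$ for all nonzero $v_E\in E,v_F\in F$, $n\ge1$. Construction of $f$. Let $\mathbb{S}=\mathbb{R}/2\mathbb{Z}$, $M=\mathbb{T}^2\times\mathbb{S}\times\mathbb{T}^2$, and let $A$ be the automorphism of $\mathbb{T}^2$ induced by $\begin{pmatrix}2&1\\1&1\end{pmatrix}$, with orthonormal eigenvectors $e^u$ (expanded) and $e^s$ (contracted). Put $\delta=1/10000$. Fix an even $C^\infty$ function $\psi:\mathbb{R}\to\mathbb{R}$ with $\psi=1$ on $[0,\delta/2]$, $\psi=0$ on $[\delta,\infty)$, strictly monotone on $(\delta/2,\delta)$. Fix a $C^\infty$ diffeomorphism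 $\phi:\mathbb{R}\to\mathbb{R}$ with $\phi(x+2)=\phi(x)+2$, whose only fixed points in $[0,2]$ are $0,1,2$, with $\phi'(0)=\frac12$, $\phi'(1)=\frac32$, and $1+\min_{x,y}(\phi'(x)-1)\psi(y)>0$. Let $Q(a,b,c)=\psi(\sqrt{a^2+b^2})\phi(c)+(1-\psi(\sqrt{a^2+b^2}))c$. Fix a sufficiently large integer $n_0$ and a sufficiently small $\beta>0$ such that: $A^{n_0}$ has four fixed points $p_1,p_2,q_1,q_2$ at pairwise distances $>10\delta$; the largest eigenvalue $\sigma_0$ of $A^{n_0}$ satisfies $\sigma_0\ge10000\max\{\max\partial_cQ,(\min\partial_cQ)^{-1}\}$; $\beta\le\frac{\delta}{2}\cdot\frac1{10000}$; $2\beta^2\log\frac34+(1-2\beta^2)\log\sigma_0>0$; and $|\phi'(x)-\frac12|<\frac1{10000}$ on $[-\beta,\beta]$. Fix $k$ large with $\frac{3\delta/2}{k}\le\frac{\beta}{10000}$ and let $$P(a,b,c,d,e)=d+\psi(kd)\,\psi\big(k\sqrt{a^2+b^2+c^2+e^2}\big)\Big(\tfrac{3d}{4\sigma_0}-d\Big).$$ Fix a sufficiently large integer $n_1$, such that the largest eigenvalue $\sigma_1$ of $A^{n_1}$ is much greater than all first partial derivatives of $\sigma_0P$ and of $Q$; the points $p_1,p_2,q_1,q_2$ are fixed by $A^{n_1}$ as well. Let $\pi_2(y)\in[-1,1)$ denote the representative of $y$ modulo $2$. Let $I:M\to M$ be the diffeomorphism whose first two coordinates at $(x,y,z)$ depend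 only on $(x,y)$ and which is given as follows. If $x=p_1+ae^u+be^s$ and $z=p_1+de^u+e\,e^s$ with $|a|,|b|,|d|,|e|<5\delta$, then $I(x,y,z)=(x,\,Q(a,b,y),\,p_1+P(a,b,\pi_2(y),d,e)e^u+e\,e^s)$. If $x=p_2+ae^u+be^s$ and $z=p_2+de^u+e\,e^s$ with $|a|,|b|,|d|,|e|<5\delta$, then $I(x,y,z)=(x,\,1+Q(a,b,y-1),\,p_2+P(a,b,\pi_2(y-1),d,e)e^u+e\,e^s)$. If $x=q_1+ae^u+be^s$ and $z=q_1+de^u+e\,e^s$ with $|a|,|b|,|d|,|e|<5\delta$, then $I(x,y,z)=(x,Q(a,b,y),z)$. If $x=q_2+ae^u+be^s$ and $z=q_2+de^u+e\,e^s$ with $|a|,|b|,|d|,|e|<5\delta$, then $I(x,y,z)=(x,1+Q(a,b,y-1),z)$. Otherwise $I$ leaves the third coordinate unchanged, and it leaves the second coordinate unchanged when $x$ is in none of the four boxes above. Put $$f=(A^{n_1}\times\mathrm{id}\times A^{n_0})\circ I.$$ Thus $f$ has the form $f(x,y,z)=(f_1(x),f_2(x,y),f_3(x,y,z))$, and it preserves $\mathbb{T}^2\times\{0\}\times\mathbb{T}^2$ and $\mathbb{T}^2\times\{1\}\times\mathbb{T}^2$. Splitting. Let $E^u$ be the line field on $M$ in the direction $e^u$ of the last torus factor. As a consequence of the choices above, $f$ has a dominated splitting into line bundles $TM=\widetilde{E^{uu}}\oplus_\succ E^u\oplus_\succ\widetilde{T\mathbb{S}}\oplus_\succ\widetilde{E^s}\oplus_\succ\widetilde{E^{ss}}$,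 with $\widetilde{E^{uu}}$ uniformly expanding. Put $E^{cu}=E^u$ and $E^{cs}=\widetilde{T\mathbb{S}}\oplus\widetilde{E^s}\oplus\widetilde{E^{ss}}$. Skeleton. $W^s(x,f)=\{y:d(f^n(y),f^n(x))\to0\}$ and $W^u(x,f)=W^s(x,f^{-1})$; $W^s(\mathrm{Orb}(p))$ is the set of points whose forward orbit converges to the orbit of $p$, and $W^u(\mathrm{Orb}(p))$ is the same set for $f^{-1}$. A finite set $S$ is a skeleton if each element is a hyperbolic periodic point with stable index $\dim E^{cs}$ and: (a) for every $C^1$ disk $D$ transverse to $E^{cs}$ there is $p\in S$ such that $D$ intersects $W^s(\mathrm{Orb}(p))$ transversely; (b) for distinct $p,q\in S$, $W^s(\mathrm{Orb}(p))$ does not intersect $W^u(\mathrm{Orb}(q))$. *)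

theory Defs
  imports "HOL-Analysis.Analysis"
begin

section \<open>Flat circles and the manifold\<close>

text \<open>
  The type \<open>'n circle\<close> is the quotient of the reals by the multiples of \<open>CARD('n)\<close>, so
  \<open>1 circle\<close> is R/Z and \<open>2 circle\<close> is R/2Z.
\<close>

definition periods :: "'n itself \<Rightarrow> real set" where
  "periods _ = range (\<lambda>k::int. of_int k * real CARD('n))"

lemma periods_0 [simp]: "0 \<in> periods T"
  unfolding periods_def by (rule image_eqI[of _ _ 0]) auto

lemma periods_add: "a \<in> periods T \<Longrightarrow> b \<in> periods T \<Longrightarrow> a + b \<in> periods T"
  unfolding periods_def by (auto simp: image_iff) (metis distrib_right of_int_add)

lemma periods_minus: "a \<in> periods T \<Longrightarrow> - a \<in> periods T"
  unfolding periods_def by (auto simp: image_iff) (metis mult_minus_left of_int_minus)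

lemma periods_diff: "a \<in> periods T \<Longrightarrow> b \<in> periods T \<Longrightarrow> a - b \<in> periods T"
  using periods_add[of a T "- b"] periods_minus[of b T] by simp

lemma periods_nonempty [simp]: "periods T \<noteq> {}"
  unfolding periods_def by simp

lemma periods_closed: "closed (periods TYPE('n))"
proof (cases "CARD('n) = 0")
  case True
  then have "periods TYPE('n) = {0}" unfolding periods_def by auto
  then show ?thesis by simp
next
  case False
  show ?thesis
  proof (rule discrete_imp_closed[of 1])
    show "0 < (1::real)" by simp
    show "\<forall>x\<in>periods TYPE('n). \<forall>y\<in>periods TYPE('n). dist y x < 1 \<longrightarrow> y = x"
    proof (intro ballI impI)
      fix x y assume "x \<in> periods TYPE('n)" "y \<in> periods TYPE('n)" and d: "dist y x < 1"
      then obtain j k :: int where x: "x = of_int j * real CARD('n)" and y: "y = of_int k * real CARD('n)"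
        unfolding periods_def by auto
      have "dist y x = \<bar>real_of_int (k - j)\<bar> * real CARD('n)"
        unfolding x y dist_real_def by (simp add: abs_mult left_diff_distrib[symmetric])
      moreover have "real CARD('n) \<ge> 1" using False by simp
      ultimately have "\<bar>real_of_int (k - j)\<bar> < 1"
        using d by (metis abs_ge_zero le_less_trans mult.right_neutral mult_left_mono)
      then have "k = j" by linarith
      then show "y = x" using x y by simp
    qed
  qed
qed

definition circle_rel :: "'n itself \<Rightarrow> real \<Rightarrow> real \<Rightarrow> bool" where
  "circle_rel T x y \<longleftrightarrow> x - y \<in> periods T"

quotient_type 'n circle = real / "circle_rel TYPE('n)"
proof (rule equivpI)
  show "reflp (circle_rel TYPE('n))"
    by (simp add: reflp_def circle_rel_def)
  show "symp (circle_rel TYPE('n))"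
    unfolding symp_def circle_rel_def using periods_minus by (metis minus_diff_eq)
  show "transp (circle_rel TYPE('n))"
    unfolding transp_def circle_rel_def using periods_add by (metis add_diff_eq diff_add_cancel)
qed

lift_definition circ :: "real \<Rightarrow> 'n circle" is "\<lambda>x. x" .

instantiation circle :: (type) ab_group_add
begin

lift_definition zero_circle :: "'a circle" is 0 .

lift_definition plus_circle :: "'a circle \<Rightarrow> 'a circle \<Rightarrow> 'a circle" is "(+)"
  unfolding circle_rel_def using periods_add by (metis add_diff_add)

lift_definition uminus_circle :: "'a circle \<Rightarrow> 'a circle" is uminus
  unfolding circle_rel_def using periods_minus by (metis minus_diff_minus)

lift_definition minus_circle :: "'a circle \<Rightarrow> 'a circle \<Rightarrow> 'a circle" is "(-)"
  unfolding circle_rel_def using periods_diff by (metis diff_diff_eq diff_diff_eq2 add_diff_eq diff_add_eq add.commute)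

instance
  by standard (transfer; simp add: circle_rel_def)+

end

lemma infdist_periods_cong:
  assumes "t - t' \<in> periods T"
  shows "infdist t (periods T) = infdist t' (periods T)"
proof -
  have le: "infdist a (periods T) \<le> infdist b (periods T)" if "a - b \<in> periods T" for a b
  proof -
    have "infdist a (periods T) \<le> dist b s" if s: "s \<in> periods T" for s
    proof -
      have "s + (a - b) \<in> periods T" using s \<open>a - b \<in> periods T\<close> by (rule periods_add)
      then have "infdist a (periods T) \<le> dist a (s + (a - b))" by (rule infdist_le)
      also have "\<dots> = dist b s" by (simp add: dist_real_def)
      finally show ?thesis .
    qed
    then show ?thesis unfolding infdist_notempty[OF periods_nonempty, of b]
      by (intro cINF_greatest) auto
  qed
  have "t' - t \<in> periods T" using periods_minus[OF assms] by simp
  then show ?thesis using le[OF assms] le by (meson antisym)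
qed

lemma infdist_periods_minus: "infdist (- t) (periods T) = infdist t (periods T)"
proof -
  have le: "infdist (- a) (periods T) \<le> infdist a (periods T)" for a
  proof -
    have "infdist (- a) (periods T) \<le> dist a s" if s: "s \<in> periods T" for s
    proof -
      have "infdist (- a) (periods T) \<le> dist (- a) (- s)"
        using periods_minus[OF s] by (rule infdist_le)
      then show ?thesis by (simp add: dist_minus)
    qed
    then show ?thesis unfolding infdist_notempty[OF periods_nonempty, of a]
      by (intro cINF_greatest) auto
  qed
  from le[of t] le[of "- t"] show ?thesis by simp
qed

lemma infdist_periods_attained:
  obtains s where "s \<in> periods TYPE('n)" "infdist t (periods TYPE('n)) = dist t s"
  using infdist_attains_inf[OF periods_closed periods_nonempty] by blast

instantiation circle :: (type) metric_space
begin

text \<open>The quotient metric: the distance of the lifts modulo the periods.\<close>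

lift_definition dist_circle :: "'a circle \<Rightarrow> 'a circle \<Rightarrow> real"
  is "\<lambda>x y. infdist (x - y) (periods TYPE('a))"
  unfolding circle_rel_def
proof -
  fix x x' y y' :: real
  assume "x - x' \<in> periods TYPE('a)" "y - y' \<in> periods TYPE('a)"
  then have "(x - y) - (x' - y') \<in> periods TYPE('a)"
    using periods_diff by (metis diff_diff_eq diff_diff_eq2 add_diff_eq diff_add_eq add.commute)
  then show "infdist (x - y) (periods TYPE('a)) = infdist (x' - y') (periods TYPE('a))"
    by (rule infdist_periods_cong)
qed

definition uniformity_circle :: "('a circle \<times> 'a circle) filter" where
  "uniformity_circle = (INF e\<in>{0<..}. principal {(x, y). dist x y < e})"

definition open_circle :: "'a circle set \<Rightarrow> bool" where
  "open_circle U \<longleftrightarrow> (\<forall>x\<in>U. eventually (\<lambda>(x', y). x' = x \<longrightarrow> y \<in> U) uniformity)"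

instance
proof
  fix x y :: "'a circle"
  show "dist x y = 0 \<longleftrightarrow> x = y"
    by transfer
      (metis circle_rel_def in_closed_iff_infdist_zero[OF periods_closed periods_nonempty])
next
  fix x y z :: "'a circle"
  show "dist x y \<le> dist x z + dist y z"
  proof transfer
    fix x y z :: real
    obtain s where s: "s \<in> periods TYPE('a)" "infdist (x - z) (periods TYPE('a)) = dist (x - z) s"
      by (rule infdist_periods_attained)
    obtain t where t: "t \<in> periods TYPE('a)" "infdist (y - z) (periods TYPE('a)) = dist (y - z) t"
      by (rule infdist_periods_attained)
    have "infdist (x - y) (periods TYPE('a)) \<le> dist (x - y) (s - t)"
      using periods_diff[OF s(1) t(1)] by (rule infdist_le)
    also have "\<dots> \<le> dist (x - z) s + dist (y - z) t"
      by (simp add: dist_real_def)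
    finally show "infdist (x - y) (periods TYPE('a))
        \<le> infdist (x - z) (periods TYPE('a)) + infdist (y - z) (periods TYPE('a))"
      using s t by simp
  qed
qed (simp_all add: uniformity_circle_def open_circle_def)

end

type_synonym torus = "1 circle \<times> 1 circle"
type_synonym mfd = "torus \<times> 2 circle \<times> torus"

text \<open>
  The universal cover of \<open>mfd\<close>; translations identify every tangent space of \<open>mfd\<close> with it.
\<close>

type_synonym R5 = "(real \<times> real) \<times> real \<times> (real \<times> real)"

definition tproj :: "real \<times> real \<Rightarrow> torus" where
  "tproj = (\<lambda>(a, b). (circ a, circ b))"

definition proj :: "R5 \<Rightarrow> mfd" where
  "proj = (\<lambda>(v, t, w). (tproj v, circ t, tproj w))"

text \<open>The representative modulo 2 in [-1, 1).\<close>

definition rep2 :: "2 circle \<Rightarrow> real" where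
  "rep2 y = (THE r. -1 \<le> r \<and> r < 1 \<and> circ r = y)"


section \<open>Derivatives and disks\<close>

text \<open>
  The map \<open>g\<close> into \<open>mfd\<close> has derivative \<open>L\<close> at \<open>u\<close> within \<open>S\<close> if, in the chart
  \<open>v \<mapsto> g u + proj v\<close> around \<open>g u\<close>, it is represented by a map with derivative \<open>L\<close>.
\<close>

definition has_mderiv :: "('a::real_normed_vector \<Rightarrow> mfd) \<Rightarrow> ('a \<Rightarrow> R5) \<Rightarrow> 'a \<Rightarrow> 'a set \<Rightarrow> bool" where
  "has_mderiv g L u S \<longleftrightarrow>
     (\<exists>F. F u = 0 \<and> (F has_derivative L) (at u within S) \<and>
          (\<forall>\<^sub>F v in at u within S. g v = g u + proj (F v)))"

definition tderiv :: "(mfd \<Rightarrow> mfd) \<Rightarrow> mfd \<Rightarrow> R5 \<Rightarrow> R5" where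
  "tderiv f x = (SOME L. has_mderiv (\<lambda>v. f (x + proj v)) L 0 UNIV)"

text \<open>
  A C1 disk of dimension \<open>dim V\<close> is the image of the closed unit ball of a linear space \<open>V\<close>
  (any dimension up to 5 is realised by a subspace of \<open>R5\<close>) under an injective C1 immersion \<open>g\<close>;
  by compactness such a \<open>g\<close> is an embedding.  The tangent space of the disk at \<open>g u\<close> is
  \<open>L u ` V\<close>; the values of \<open>L u\<close> outside \<open>V\<close> are irrelevant.
\<close>

definition c1_disk :: "R5 set \<Rightarrow> (R5 \<Rightarrow> mfd) \<Rightarrow> (R5 \<Rightarrow> R5 \<Rightarrow> R5) \<Rightarrow> bool" where
  "c1_disk V g L \<longleftrightarrow>
     subspace V \<and> inj_on g (cball 0 1 \<inter> V) \<and>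
     (\<forall>u\<in>cball 0 1 \<inter> V. has_mderiv g (L u) u (cball 0 1 \<inter> V) \<and> inj_on (L u) V) \<and>
     (\<forall>v\<in>V. continuous_on (cball 0 1 \<inter> V) (\<lambda>u. L u v))"


section \<open>Dominated splittings\<close>

type_synonym subbundle = "mfd \<Rightarrow> R5 set"

definition invariant_subbundle :: "(mfd \<Rightarrow> mfd) \<Rightarrow> subbundle \<Rightarrow> bool" where
  "invariant_subbundle f E \<longleftrightarrow>
     (\<exists>m. \<forall>x. subspace (E x) \<and> dim (E x) = m) \<and> (\<forall>x. tderiv f x ` E x = E (f x))"

definition dominates :: "(mfd \<Rightarrow> mfd) \<Rightarrow> subbundle \<Rightarrow> subbundle \<Rightarrow> bool" where
  "dominates f E F \<longleftrightarrow>
     invariant_subbundle f E \<and> invariant_subbundle f F \<and>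
     (\<forall>x. E x \<inter> F x = {0}) \<and>
     (\<exists>\<theta>>0. \<forall>x. \<forall>v\<in>E x - {0}. \<forall>w\<in>F x - {0}. \<theta> \<le> arccos (\<bar>v \<bullet> w\<bar> / (norm v * norm w))) \<and>
     (\<exists>c>0. \<exists>\<sigma><1. \<forall>x. \<forall>v\<in>E x - {0}. \<forall>w\<in>F x - {0}. \<forall>n\<ge>1.
        norm (tderiv (f ^^ n) x w) / norm (tderiv (f ^^ n) x v) \<le> c * \<sigma> ^ n * (norm w / norm v))"

text \<open>
  For a splitting into several subbundles, domination is required at every cut of the list.  The sum
  of sets is the pointwise one, so for subspaces it is the sum of subspaces.
\<close>

definition dominated_splitting :: "(mfd \<Rightarrow> mfd) \<Rightarrow> subbundle list \<Rightarrow> bool" where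
  "dominated_splitting f Es \<longleftrightarrow>
     (\<forall>E\<in>set Es. invariant_subbundle f E) \<and>
     (\<forall>x. (\<Sum>E\<leftarrow>Es. E x) = UNIV) \<and>
     (\<forall>i\<in>{1..<length Es}.
        dominates f (\<lambda>x. \<Sum>E\<leftarrow>take i Es. E x) (\<lambda>x. \<Sum>E\<leftarrow>drop i Es. E x))"

definition uniformly_expanding :: "(mfd \<Rightarrow> mfd) \<Rightarrow> subbundle \<Rightarrow> bool" where
  "uniformly_expanding f E \<longleftrightarrow>
     (\<exists>c>0. \<exists>\<mu>>1. \<forall>x. \<forall>v\<in>E x. \<forall>n. norm (tderiv (f ^^ n) x v) \<ge> c * \<mu> ^ n * norm v)"


section \<open>Stable sets, hyperbolic periodic points and skeletons\<close>

definition Ws :: "mfd \<Rightarrow> (mfd \<Rightarrow> mfd) \<Rightarrow> mfd set" where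
  "Ws x f = {y. (\<lambda>n. dist ((f ^^ n) y) ((f ^^ n) x)) \<longlonglongrightarrow> 0}"

definition Wu :: "mfd \<Rightarrow> (mfd \<Rightarrow> mfd) \<Rightarrow> mfd set" where
  "Wu x f = Ws x (inv f)"

definition orb :: "(mfd \<Rightarrow> mfd) \<Rightarrow> mfd \<Rightarrow> mfd set" where
  "orb f p = range (\<lambda>n. (f ^^ n) p) \<union> range (\<lambda>n. (inv f ^^ n) p)"

definition Ws_orb :: "mfd \<Rightarrow> (mfd \<Rightarrow> mfd) \<Rightarrow> mfd set" where
  "Ws_orb p f = {y. (\<lambda>n. infdist ((f ^^ n) y) (orb f p)) \<longlonglongrightarrow> 0}"

definition Wu_orb :: "mfd \<Rightarrow> (mfd \<Rightarrow> mfd) \<Rightarrow> mfd set" where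
  "Wu_orb p f = {y. (\<lambda>n. infdist ((inv f ^^ n) y) (orb f p)) \<longlonglongrightarrow> 0}"

definition periodic :: "(mfd \<Rightarrow> mfd) \<Rightarrow> mfd \<Rightarrow> bool" where
  "periodic f p \<longleftrightarrow> (\<exists>n>0. (f ^^ n) p = p)"

definition return_deriv :: "(mfd \<Rightarrow> mfd) \<Rightarrow> mfd \<Rightarrow> R5 \<Rightarrow> R5" where
  "return_deriv f p = tderiv (f ^^ (LEAST n. 0 < n \<and> (f ^^ n) p = p)) p"

text \<open>Eigenvalues of the complexification, with complex vectors written as \<open>v + \<i> w\<close>.\<close>

definition complex_eigenvalue :: "('a::real_vector \<Rightarrow> 'a) \<Rightarrow> complex \<Rightarrow> bool" where
  "complex_eigenvalue L z \<longleftrightarrow>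
     (\<exists>v w. (v, w) \<noteq> (0, 0) \<and>
        L v = Re z *\<^sub>R v - Im z *\<^sub>R w \<and> L w = Im z *\<^sub>R v + Re z *\<^sub>R w)"

definition hyperbolic_periodic :: "(mfd \<Rightarrow> mfd) \<Rightarrow> mfd \<Rightarrow> bool" where
  "hyperbolic_periodic f p \<longleftrightarrow>
     periodic f p \<and> (\<forall>z. complex_eigenvalue (return_deriv f p) z \<longrightarrow> cmod z \<noteq> 1)"

text \<open>The dimension of the stable subspace at \<open>p\<close>.\<close>

definition stable_index :: "(mfd \<Rightarrow> mfd) \<Rightarrow> mfd \<Rightarrow> nat" where
  "stable_index f p = dim {v. (\<lambda>n. (return_deriv f p ^^ n) v) \<longlonglongrightarrow> 0}"

definition disk_transverse :: "R5 set \<Rightarrow> (R5 \<Rightarrow> mfd) \<Rightarrow> (R5 \<Rightarrow> R5 \<Rightarrow> R5) \<Rightarrow> subbundle \<Rightarrow> bool" where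
  "disk_transverse V g L E \<longleftrightarrow> (\<forall>u\<in>cball 0 1 \<inter> V. L u ` V + E (g u) = UNIV)"

text \<open>
  The set \<open>W\<close> is meant to be an injectively immersed submanifold, such as the stable set of a
  hyperbolic periodic orbit.  The disk meets it transversely if, at some common point, the tangent
  spaces of the disk and of a C1 disk inside \<open>W\<close> centred at that point span.
\<close>

definition disk_meets_transversely ::
    "R5 set \<Rightarrow> (R5 \<Rightarrow> mfd) \<Rightarrow> (R5 \<Rightarrow> R5 \<Rightarrow> R5) \<Rightarrow> mfd set \<Rightarrow> bool" where
  "disk_meets_transversely V g L W \<longleftrightarrow>
     (\<exists>u\<in>cball 0 1 \<inter> V. \<exists>V' g' L'.
        c1_disk V' g' L' \<and> g' 0 = g u \<and> g' ` (cball 0 1 \<inter> V') \<subseteq> W \<and>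
        L u ` V + L' 0 ` V' = UNIV)"

definition skeleton :: "(mfd \<Rightarrow> mfd) \<Rightarrow> subbundle \<Rightarrow> mfd set \<Rightarrow> bool" where
  "skeleton f Ecs S \<longleftrightarrow>
     finite S \<and>
     (\<forall>p\<in>S. hyperbolic_periodic f p \<and> stable_index f p = dim (Ecs p)) \<and>
     (\<forall>V g L. c1_disk V g L \<and> disk_transverse V g L Ecs \<longrightarrow>
        (\<exists>p\<in>S. disk_meets_transversely V g L (Ws_orb p f))) \<and>
     (\<forall>p\<in>S. \<forall>q\<in>S. p \<noteq> q \<longrightarrow> Ws_orb p f \<inter> Wu_orb q f = {})"


section \<open>The construction\<close>

definition smooth :: "(real \<Rightarrow> real) \<Rightarrow> bool" where
  "smooth g \<longleftrightarrow> (\<forall>n. (deriv ^^ n) g differentiable_on UNIV)"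

definition partial :: "('a::euclidean_space \<Rightarrow> real) \<Rightarrow> 'a \<Rightarrow> 'a \<Rightarrow> real" where
  "partial F i v = deriv (\<lambda>t. F (v + t *\<^sub>R i)) 0"

definition \<delta> :: real where "\<delta> = 1 / 10000"

definition Alin :: "real \<times> real \<Rightarrow> real \<times> real" where
  "Alin = (\<lambda>(a, b). (2 * a + b, a + b))"

definition A :: "torus \<Rightarrow> torus" where
  "A = (\<lambda>(x, y). (x + x + y, x + y))"

definition max_eigenvalue :: "('a::real_vector \<Rightarrow> 'a) \<Rightarrow> real" where
  "max_eigenvalue L = Max {\<mu>. \<exists>v. v \<noteq> 0 \<and> L v = \<mu> *\<^sub>R v}"

definition Q :: "(real \<Rightarrow> real) \<Rightarrow> (real \<Rightarrow> real) \<Rightarrow> real \<times> real \<times> real \<Rightarrow> real" where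
  "Q \<psi> \<phi> = (\<lambda>(a, b, c). \<psi> (sqrt (a\<^sup>2 + b\<^sup>2)) * \<phi> c + (1 - \<psi> (sqrt (a\<^sup>2 + b\<^sup>2))) * c)"

definition P :: "(real \<Rightarrow> real) \<Rightarrow> real \<Rightarrow> real \<Rightarrow> real \<times> real \<times> real \<times> real \<times> real \<Rightarrow> real" where
  "P \<psi> \<sigma>\<^sub>0 k = (\<lambda>(a, b, c, d, e).
     d + \<psi> (k * d) * \<psi> (k * sqrt (a\<^sup>2 + b\<^sup>2 + c\<^sup>2 + e\<^sup>2)) * (3 * d / (4 * \<sigma>\<^sub>0) - d))"

definition eu_es_point :: "real \<times> real \<Rightarrow> real \<times> real \<Rightarrow> torus \<Rightarrow> real \<times> real \<Rightarrow> torus" where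
  "eu_es_point eu es p = (\<lambda>(a, b). p + tproj (a *\<^sub>R eu + b *\<^sub>R es))"

definition square :: "(real \<times> real) set" where
  "square = {(a, b). \<bar>a\<bar> < 5 * \<delta> \<and> \<bar>b\<bar> < 5 * \<delta>}"

definition box :: "real \<times> real \<Rightarrow> real \<times> real \<Rightarrow> torus \<Rightarrow> torus set" where
  "box eu es p = eu_es_point eu es p ` square"

definition coords :: "real \<times> real \<Rightarrow> real \<times> real \<Rightarrow> torus \<Rightarrow> torus \<Rightarrow> real \<times> real" where
  "coords eu es p = the_inv_into square (eu_es_point eu es p)"

text \<open>
  Since \<open>Q\<close> commutes with the translation of its last argument by 2, its value modulo 2 does not
  depend on the representative used for the last argument.
\<close>

definition Qc :: "(real \<Rightarrow> real) \<Rightarrow> (real \<Rightarrow> real) \<Rightarrow> real \<times> real \<Rightarrow> 2 circle \<Rightarrow> 2 circle" where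
  "Qc \<psi> \<phi> = (\<lambda>(a, b) y. circ (Q \<psi> \<phi> (a, b, rep2 y)))"

text \<open>
  The centres of the four boxes have distance greater than \<open>10 * \<delta>\<close>, so on an overlap of two
  boxes all the formulas involved give the identity, and the order of the cases is immaterial.
\<close>

definition I2 where
  "I2 \<psi> \<phi> eu es p1 p2 q1 q2 x y =
     (if x \<in> box eu es p1 then Qc \<psi> \<phi> (coords eu es p1 x) y
      else if x \<in> box eu es p2 then circ 1 + Qc \<psi> \<phi> (coords eu es p2 x) (y - circ 1)
      else if x \<in> box eu es q1 then Qc \<psi> \<phi> (coords eu es q1 x) y
      else if x \<in> box eu es q2 then circ 1 + Qc \<psi> \<phi> (coords eu es q2 x) (y - circ 1)
      else y)"

definition Pc where
  "Pc \<psi> \<sigma>\<^sub>0 k eu es p x y z =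
     (let (a, b) = coords eu es p x; (d, e) = coords eu es p z
      in eu_es_point eu es p (P \<psi> \<sigma>\<^sub>0 k (a, b, rep2 y, d, e), e))"

definition I3 where
  "I3 \<psi> \<sigma>\<^sub>0 k eu es p1 p2 x y z =
     (if x \<in> box eu es p1 \<and> z \<in> box eu es p1 then Pc \<psi> \<sigma>\<^sub>0 k eu es p1 x y z
      else if x \<in> box eu es p2 \<and> z \<in> box eu es p2 then Pc \<psi> \<sigma>\<^sub>0 k eu es p2 x (y - circ 1) z
      else z)"

definition I_map :: "(real \<Rightarrow> real) \<Rightarrow> (real \<Rightarrow> real) \<Rightarrow> real \<Rightarrow> real \<Rightarrow> real \<times> real \<Rightarrow> real \<times> real
    \<Rightarrow> torus \<Rightarrow> torus \<Rightarrow> torus \<Rightarrow> torus \<Rightarrow> mfd \<Rightarrow> mfd" where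
  "I_map \<psi> \<phi> \<sigma>\<^sub>0 k eu es p1 p2 q1 q2 =
     (\<lambda>(x, y, z). (x, I2 \<psi> \<phi> eu es p1 p2 q1 q2 x y, I3 \<psi> \<sigma>\<^sub>0 k eu es p1 p2 x y z))"

definition f_map :: "(real \<Rightarrow> real) \<Rightarrow> (real \<Rightarrow> real) \<Rightarrow> nat \<Rightarrow> nat \<Rightarrow> real \<Rightarrow> real \<times> real \<Rightarrow> real \<times> real
    \<Rightarrow> torus \<Rightarrow> torus \<Rightarrow> torus \<Rightarrow> torus \<Rightarrow> mfd \<Rightarrow> mfd" where
  "f_map \<psi> \<phi> n\<^sub>0 n\<^sub>1 k eu es p1 p2 q1 q2 =
     (\<lambda>(x, y, z). ((A ^^ n\<^sub>1) x, y, (A ^^ n\<^sub>0) z))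
       \<circ> I_map \<psi> \<phi> (max_eigenvalue (Alin ^^ n\<^sub>0)) k eu es p1 p2 q1 q2"

definition Eu :: "real \<times> real \<Rightarrow> subbundle" where
  "Eu eu = (\<lambda>x. span {((0, 0), 0, eu)})"

end

theory Submission
  imports Defs
begin

text \<open>
  On the universal cover \<open>f\<close> lifts to a C1 skew product \<open>F\<close>, whose third component moves points only
  along \<open>eu\<close> before the linear map is applied.  Domination forces \<open>Ecs\<close> into the kernel of the
  unstable coordinate of the first torus, and over the local stable leaf of \<open>q1\<close> (or \<open>q2\<close>) also into
  the kernel of that of the last torus, because every such coordinate of a vector grows at least as
  fast as the image of \<open>eu\<close>.

  A disk transverse to \<open>Ecs\<close> is therefore mapped submersively onto these two unstable coordinates.
  Since the stable leaves through \<open>q1\<close> are dense, the disk contains a point some iterate of which lies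
  on the local stable leaf of \<open>q1\<close> in the first torus and on the stable leaf of \<open>q1\<close> in the last one;
  this point is stable for \<open>(q1, 0, q1)\<close> unless its circle coordinate is the invariant repeller 1, in
  which case \<open>(q2, 1, q2)\<close> takes over.  A backward orbit converging to \<open>(q2, 1, q2)\<close> lies in the
  invariant level 1, so it misses the stable set of \<open>(q1, 0, q1)\<close>, and conversely.  Finally \<open>W\<^sup>u\<close>
  contains the product of the unstable leaves of the two tori at an invariant level, which is dense in
  that level.
\<close>

section \<open>Flat coverings\<close>

text \<open>No stable manifold theorem enters. Over a small ball around \<open>q1\<close> or
  \<open>q2\<close> in the first torus the push along \<open>eu\<close> vanishes and
  \<open>f\<close> is a product of two linear maps and the circle map, so the stable set is explicit
  there; elsewhere it is obtained by pulling back under iterates of the lift.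

  Global facts about \<open>f\<close> come from the assumed splitting: bundles that span and are
  mapped onto each other make every derivative invertible, and Rolle's theorem along the lines in
  direction \<open>eu\<close> then makes \<open>f\<close> injective.

  The obstacle is the last torus. The push depends on all coordinates, so the derivative shears
  other directions into \<open>eu\<close>, and \<open>Ecs\<close> need not lie in the kernel of the
  last unstable coordinate. It does where the whole forward orbit stays near \<open>q\<close> in the
  first torus. Hence a disk has to be moved onto a stable leaf of the first torus before the last
  one can be treated.

  The definition of \<open>f\<close> by cases over boxes hides its smoothness; it is rewritten with
  cutoffs of distances and with transplanted bumps, which are defined on the whole manifold.\<close>

locale flat_cover =
  fixes pr :: "'a::euclidean_space \<Rightarrow> 'b::{ab_group_add, metric_space}"
  assumes pr_add: "pr (u + v) = pr u + pr v"
    and ex_lift: "\<exists>v. m = p + pr v \<and> norm v = dist m p"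
    and dist_pr_le: "dist (p + pr u) (p + pr v) \<le> norm (u - v)"
    and pr_eq_0: "pr v = 0 \<Longrightarrow> norm v < 1 \<Longrightarrow> v = 0"
begin

lemma pr_0 [simp]: "pr 0 = 0"
  using pr_add[of 0 0] by simp

lemma pr_minus: "pr (- v) = - pr v"
  using pr_add[of v "- v"] by (simp add: minus_unique)

lemma pr_diff: "pr (u - v) = pr u - pr v"
  using pr_add[of u "- v"] by (simp add: pr_minus)

lemma pr_surj: "\<exists>v. m = pr v"
  using ex_lift[of m 0] by auto

text \<open>A shortest lift of the same point has norm below 1/2 as well, so it differs from
  \<open>v\<close> by a period of norm below 1, hence by zero.\<close>

lemma dist_pr: "norm v < 1/2 \<Longrightarrow> dist (p + pr v) p = norm v"
proof -
  assume v: "norm v < 1/2"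
  have le: "dist (p + pr v) p \<le> norm v" using dist_pr_le[of p v 0] by simp
  obtain w where w: "p + pr v = p + pr w" "norm w = dist (p + pr v) p"
    using ex_lift by blast
  have "norm (v - w) \<le> norm v + norm w" by (rule norm_triangle_ineq4)
  then have "norm (v - w) < 1" using w le v by linarith
  moreover have "pr (v - w) = 0" using w by (simp add: pr_diff)
  ultimately have "v - w = 0" by (intro pr_eq_0)
  then show ?thesis using w by simp
qed

lemma pr_inj: "pr u = pr v \<Longrightarrow> norm (u - v) < 1 \<Longrightarrow> u = v"
  using pr_eq_0[of "u - v"] by (simp add: pr_diff)

lemma continuous_pr: "continuous_on S (\<lambda>v. p + pr v)"
proof (rule continuous_onI)
  fix x e :: real and v :: 'a
  assume "e > 0"
  then show "\<exists>d>0. \<forall>x'\<in>S. dist x' v < d \<longrightarrow> dist (p + pr x') (p + pr v) \<le> e"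
    by (intro exI[of _ e]) (auto simp: dist_norm intro: order_trans[OF dist_pr_le])
qed

lemma tendsto_pr: "(F \<longlongrightarrow> v) X \<Longrightarrow> ((\<lambda>x. p + pr (F x)) \<longlongrightarrow> p + pr v) X"
  by (rule continuous_on_tendsto_compose[OF continuous_pr[of UNIV p]]) auto

text \<open>For \<open>K\<close> supported near the origin this transplants \<open>K\<close> to \<open>p\<close>; the choice of the shortest lift
  is irrelevant, as two different shortest lifts lie outside the support.\<close>

definition bump :: "'b \<Rightarrow> ('a \<Rightarrow> real) \<Rightarrow> 'b \<Rightarrow> real" where
  "bump p K m = K (SOME v. m = p + pr v \<and> norm v = dist m p)"

lemma bump_eq:
  assumes "norm v < 1/2"
  shows "bump p K (p + pr v) = K v"
proof -
  let ?P = "\<lambda>w. p + pr v = p + pr w \<and> norm w = dist (p + pr v) p"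
  have P: "?P (SOME w. ?P w)" by (rule someI_ex) (rule ex_lift)
  have "norm (v - (SOME w. ?P w)) \<le> norm v + norm (SOME w. ?P w)" by (rule norm_triangle_ineq4)
  then have "norm (v - (SOME w. ?P w)) < 1" using P dist_pr[OF assms, of p] assms by linarith
  then have "v = (SOME w. ?P w)" using P by (intro pr_inj) auto
  then show ?thesis unfolding bump_def by simp
qed

lemma bump_eq_0:
  assumes "\<And>v. norm v \<ge> r \<Longrightarrow> K v = 0" "dist m p \<ge> r"
  shows "bump p K m = 0"
proof -
  let ?P = "\<lambda>w. m = p + pr w \<and> norm w = dist m p"
  have P: "?P (SOME w. ?P w)" by (rule someI_ex) (rule ex_lift)
  then show ?thesis unfolding bump_def using assms(2) by (intro assms(1)) simp
qed

end

text \<open>Norm and distance on products are both Euclidean, so shortest lifts may be chosen in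
  each factor. Iterating this covers the torus and the whole manifold.\<close>

lemma flat_cover_Pair:
  fixes pr1 :: "'a::euclidean_space \<Rightarrow> 'b::{ab_group_add, metric_space}"
    and pr2 :: "'c::euclidean_space \<Rightarrow> 'd::{ab_group_add, metric_space}"
  assumes "flat_cover pr1" "flat_cover pr2"
  shows "flat_cover (\<lambda>(a, b). (pr1 a, pr2 b))"
proof -
  interpret A: flat_cover pr1 by fact
  interpret B: flat_cover pr2 by fact
  show ?thesis
  proof
    fix u v show "(case u + v of (a, b) \<Rightarrow> (pr1 a, pr2 b)) =
       (case u of (a, b) \<Rightarrow> (pr1 a, pr2 b)) + (case v of (a, b) \<Rightarrow> (pr1 a, pr2 b))"
      by (simp add: A.pr_add B.pr_add split: prod.split)
  next
    fix m p :: "'b \<times> 'd"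
    obtain v where v: "fst m = fst p + pr1 v" "norm v = dist (fst m) (fst p)" using A.ex_lift by blast
    obtain w where w: "snd m = snd p + pr2 w" "norm w = dist (snd m) (snd p)" using B.ex_lift by blast
    show "\<exists>v. m = p + (case v of (a, b) \<Rightarrow> (pr1 a, pr2 b)) \<and> norm v = dist m p"
      by (rule exI[of _ "(v, w)"]) (auto simp: norm_prod_def dist_prod_def v w prod_eq_iff)
  next
    fix p :: "'b \<times> 'd" and u v :: "'a \<times> 'c"
    have "dist (fst p + pr1 (fst u)) (fst p + pr1 (fst v)) \<le> norm (fst u - fst v)" by (rule A.dist_pr_le)
    moreover have "dist (snd p + pr2 (snd u)) (snd p + pr2 (snd v)) \<le> norm (snd u - snd v)"
      by (rule B.dist_pr_le)
    ultimately show "dist (p + (case u of (a, b) \<Rightarrow> (pr1 a, pr2 b)))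
        (p + (case v of (a, b) \<Rightarrow> (pr1 a, pr2 b))) \<le> norm (u - v)"
      by (auto simp: dist_prod_def norm_prod_def split: prod.split intro!: real_sqrt_le_mono add_mono power_mono)
  next
    fix v :: "'a \<times> 'c" assume *: "(case v of (a, b) \<Rightarrow> (pr1 a, pr2 b)) = 0" "norm v < 1"
    have "norm (fst v) \<le> norm v" "norm (snd v) \<le> norm v" by (simp_all add: norm_prod_def)
    then show "v = 0" using * by (auto simp: prod_eq_iff split: prod.splits intro!: A.pr_eq_0 B.pr_eq_0)
  qed
qed

lemma circ_eq_iff: "(circ a :: 'n circle) = circ b \<longleftrightarrow> a - b \<in> periods TYPE('n)"
  by transfer (simp add: circle_rel_def)

lemma circ_add: "circ (a + b) = circ a + circ b"
  by transfer (simp add: circle_rel_def)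

lemma circ_surj: "\<exists>a. m = circ a"
  by transfer (metis circle_rel_def periods_0 diff_self)

lemma circ_0 [simp]: "circ 0 = 0"
  by transfer (simp add: circle_rel_def)

lemma dist_circ: "dist (circ a :: 'n circle) (circ b) = infdist (a - b) (periods TYPE('n))"
  by transfer simp

interpretation circ: flat_cover "circ :: real \<Rightarrow> 'n::finite circle"
proof
  fix u v show "(circ (u + v) :: 'n circle) = circ u + circ v" by (rule circ_add)
next
  fix m p :: "'n circle"
  obtain t where t: "m - p = circ t" using circ_surj by blast
  obtain a where a: "p = circ a" using circ_surj by blast
  have m: "m = circ (a + t)" using t a by (simp add: circ_add algebra_simps)
  obtain s where s: "s \<in> periods TYPE('n)" "infdist t (periods TYPE('n)) = dist t s"
    by (rule infdist_periods_attained)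
  have "m = p + circ (t - s)" unfolding a m circ_add[symmetric] circ_eq_iff using s by simp
  moreover have "norm (t - s) = dist m p" unfolding m a dist_circ using s by (simp add: dist_norm)
  ultimately show "\<exists>v. m = p + circ v \<and> norm v = dist m p" by blast
next
  fix p :: "'n circle" and u v
  obtain a where a: "p = circ a" using circ_surj by blast
  show "dist (p + circ u) (p + circ v) \<le> norm (u - v)"
    unfolding a circ_add[symmetric] dist_circ using infdist_le[OF periods_0, of "u - v" "TYPE('n)"]
    by (simp add: dist_norm)
next
  fix v :: real assume *: "(circ v :: 'n circle) = 0" "norm v < 1"
  then have "v \<in> periods TYPE('n)" using circ_eq_iff[of v 0, where 'n = 'n] by simp
  then obtain k where k: "v = of_int k * real CARD('n)" unfolding periods_def by auto
  \<comment> \<open>Nonzero periods are multiples of a circumference that is at least 1; this is the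
    source of the constant in \<open>pr_eq_0\<close>.\<close>
  have "real CARD('n) \<ge> 1" by (simp add: Suc_leI)
  then have "\<bar>real_of_int k\<bar> * 1 \<le> \<bar>real_of_int k\<bar> * real CARD('n)" by (intro mult_left_mono) auto
  then have "\<bar>real_of_int k\<bar> < 1" using * k by (simp add: abs_mult)
  then have "k = 0" by linarith
  then show "v = 0" using k by simp
qed

interpretation tproj: flat_cover tproj
  unfolding tproj_def by (intro flat_cover_Pair circ.flat_cover_axioms)

interpretation proj: flat_cover proj
proof -
  have eq: "proj = (\<lambda>(v, t). (tproj v, case t of (t, w) \<Rightarrow> (circ t, tproj w)))"
    unfolding proj_def by auto
  show "flat_cover proj"
    unfolding eq by (intro flat_cover_Pair circ.flat_cover_axioms tproj.flat_cover_axioms)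
qed

lemma proj_Pair [simp]: "proj (x, y, z) = (tproj x, circ y, tproj z)"
  by (simp add: proj_def)

section \<open>Continuously differentiable maps\<close>

text \<open>Joint continuity in base point and vector replaces continuity in the operator norm. In
  this form it composes and iterates without the type of bounded operators.\<close>

definition C1_with :: "('a::real_normed_vector \<Rightarrow> 'b::real_normed_vector) \<Rightarrow> ('a \<Rightarrow> 'a \<Rightarrow> 'b) \<Rightarrow> bool" where
  "C1_with F F' \<longleftrightarrow> (\<forall>v. (F has_derivative F' v) (at v)) \<and> continuous_on UNIV (\<lambda>p. F' (fst p) (snd p))"

definition C1 :: "('a::real_normed_vector \<Rightarrow> 'b::real_normed_vector) \<Rightarrow> bool" where
  "C1 F \<longleftrightarrow> (\<exists>F'. C1_with F F')"

lemma C1_withI: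
  "(\<And>v. (F has_derivative F' v) (at v)) \<Longrightarrow> continuous_on UNIV (\<lambda>p. F' (fst p) (snd p)) \<Longrightarrow> C1_with F F'"
  by (simp add: C1_with_def)

lemma C1_with_deriv: "C1_with F F' \<Longrightarrow> (F has_derivative F' v) (at v)"
  by (simp add: C1_with_def)

lemma C1_with_linear: "C1_with F F' \<Longrightarrow> bounded_linear (F' v)"
  using C1_with_deriv has_derivative_bounded_linear by blast

lemma C1_with_continuous: "C1_with F F' \<Longrightarrow> continuous_on S F"
  by (meson C1_with_deriv continuous_at_imp_continuous_on has_derivative_continuous)

lemma C1_continuous: "C1 F \<Longrightarrow> continuous_on S F"
  using C1_with_continuous by (auto simp: C1_def)

lemma C1_with_continuous_deriv:
  assumes "C1_with F F'" "continuous_on S g" "continuous_on S h"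
  shows "continuous_on S (\<lambda>u. F' (g u) (h u))"
proof -
  have "continuous_on UNIV (\<lambda>p. F' (fst p) (snd p))" using assms by (simp add: C1_with_def)
  from continuous_on_compose2[OF this, of S "\<lambda>u. (g u, h u)"] assms show ?thesis
    by (auto intro!: continuous_intros)
qed

lemma C1_with_compose:
  assumes "C1_with F F'" "C1_with G G'"
  shows "C1_with (\<lambda>v. G (F v)) (\<lambda>v w. G' (F v) (F' v w))"
proof (rule C1_withI)
  fix v show "((\<lambda>v. G (F v)) has_derivative (\<lambda>w. G' (F v) (F' v w))) (at v)"
    by (rule has_derivative_compose[OF C1_with_deriv[OF assms(1)] C1_with_deriv[OF assms(2)]])
next
  show "continuous_on UNIV (\<lambda>p. G' (F (fst p)) (F' (fst p) (snd p)))"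
    by (intro C1_with_continuous_deriv[OF assms(2)] C1_with_continuous_deriv[OF assms(1)]
        continuous_on_compose2[OF C1_with_continuous[OF assms(1)], of UNIV] continuous_intros) auto
qed

lemma C1_compose: "C1 G \<Longrightarrow> C1 F \<Longrightarrow> C1 (\<lambda>v. G (F v))"
  unfolding C1_def using C1_with_compose by blast

lemma C1_bounded_linear: "bounded_linear F \<Longrightarrow> C1 F"
  unfolding C1_def
proof (intro exI C1_withI)
  assume F: "bounded_linear F"
  show "(F has_derivative F) (at v)" for v using F by (rule bounded_linear_imp_has_derivative)
  show "continuous_on UNIV (\<lambda>p. F (snd p))"
    by (rule bounded_linear.continuous_on[OF F]) (rule continuous_on_snd[OF continuous_on_id])
qed

lemma C1_with_const: "C1_with (\<lambda>v. c) (\<lambda>v w. 0)"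
  by (rule C1_withI) (auto intro!: continuous_intros)

lemma C1_const: "C1 (\<lambda>v. c)"
  using C1_with_const by (auto simp: C1_def)

lemma C1_with_add: "C1_with F F' \<Longrightarrow> C1_with G G' \<Longrightarrow> C1_with (\<lambda>v. F v + G v) (\<lambda>v w. F' v w + G' v w)"
  unfolding C1_with_def by (auto intro!: has_derivative_add continuous_on_add)

lemma C1_add: "C1 F \<Longrightarrow> C1 G \<Longrightarrow> C1 (\<lambda>v. F v + G v)"
  unfolding C1_def by (elim exE, rule exI, erule (1) C1_with_add)

lemma C1_with_scaleR:
  assumes "C1_with F F'" "C1_with G G'"
  shows "C1_with (\<lambda>v. F v *\<^sub>R G v) (\<lambda>v w. F v *\<^sub>R G' v w + F' v w *\<^sub>R G v)"
proof (rule C1_withI)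
  fix v show "((\<lambda>v. F v *\<^sub>R G v) has_derivative (\<lambda>w. F v *\<^sub>R G' v w + F' v w *\<^sub>R G v)) (at v)"
    by (rule has_derivative_scaleR[OF C1_with_deriv[OF assms(1)] C1_with_deriv[OF assms(2)]])
next
  show "continuous_on UNIV (\<lambda>p. F (fst p) *\<^sub>R G' (fst p) (snd p) + F' (fst p) (snd p) *\<^sub>R G (fst p))"
    by (intro continuous_intros C1_with_continuous_deriv[OF assms(2)] C1_with_continuous_deriv[OF assms(1)]
        continuous_on_compose2[OF C1_with_continuous[OF assms(1)], of UNIV]
        continuous_on_compose2[OF C1_with_continuous[OF assms(2)], of UNIV]) auto
qed

lemma C1_scaleR: "C1 F \<Longrightarrow> C1 G \<Longrightarrow> C1 (\<lambda>v. F v *\<^sub>R G v)"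
unfolding C1_def by (elim exE, rule exI, erule (1) C1_with_scaleR)

lemma C1_mult: "C1 F \<Longrightarrow> C1 G \<Longrightarrow> C1 (\<lambda>v. F v * (G v :: real))"
  using C1_scaleR[of F G] by simp

lemma C1_with_Pair: "C1_with F F' \<Longrightarrow> C1_with G G' \<Longrightarrow> C1_with (\<lambda>v. (F v, G v)) (\<lambda>v w. (F' v w, G' v w))"
  unfolding C1_with_def by (auto intro!: has_derivative_Pair continuous_intros)

lemma C1_Pair: "C1 F \<Longrightarrow> C1 G \<Longrightarrow> C1 (\<lambda>v. (F v, G v))"
unfolding C1_def by (elim exE, rule exI, erule (1) C1_with_Pair)

lemma C1_linear: "linear F \<Longrightarrow> C1 (F :: 'a::euclidean_space \<Rightarrow> 'b::real_normed_vector)"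
  by (simp add: C1_bounded_linear linear_conv_bounded_linear)

lemma C1_real:
  assumes "\<And>x::real. (f has_real_derivative f' x) (at x)" "continuous_on UNIV f'"
  shows "C1 f"
  unfolding C1_def
proof (intro exI C1_withI)
  show "(f has_derivative (\<lambda>w. f' v * w)) (at v)" for v
    using assms(1)[of v] by (simp add: has_field_derivative_def)
  show "continuous_on UNIV (\<lambda>p. f' (fst p) * snd p)"
    by (intro continuous_intros continuous_on_compose2[OF assms(2)]) auto
qed

text \<open>Derivatives are unique, so the local families agree on overlaps and the diagonal choice
  \<open>G' v v\<close> coincides near each point with a single continuous family.\<close>

lemma C1_with_locally:
  assumes "\<And>v. \<exists>U G G'. open U \<and> v \<in> U \<and> C1_with G G' \<and> (\<forall>u\<in>U. F u = G u)"
  shows "C1 F"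
proof -
  obtain U G G' where *: "\<And>v. open (U v)" "\<And>v. v \<in> U v" "\<And>v. C1_with (G v) (G' v)"
      "\<And>v u. u \<in> U v \<Longrightarrow> F u = G v u"
    using assms by metis
  have D: "(F has_derivative G' v u) (at u)" if "u \<in> U v" for u v
    by (rule has_derivative_transform_within_open[OF C1_with_deriv[OF *(3)[of v]] *(1)[of v] that])
       (simp add: *(4))
  define F' where "F' = (\<lambda>v. G' v v)"
  have eq: "F' u = G' v u" if "u \<in> U v" for u v
    unfolding F'_def using D[OF that] D[OF *(2)] has_derivative_unique by blast
  have "C1_with F F'"
  proof (rule C1_withI)
    fix v show "(F has_derivative F' v) (at v)" unfolding F'_def by (rule D) (rule *)
  next
    have "continuous (at p) (\<lambda>p. F' (fst p) (snd p))" for p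
    proof -
      have "continuous_on UNIV (\<lambda>q. G' (fst p) (fst q) (snd q))"
        using *(3)[of "fst p"] by (simp add: C1_with_def)
      then have c: "continuous (at p) (\<lambda>q. G' (fst p) (fst q) (snd q))"
        using continuous_on_eq_continuous_at[OF open_UNIV] by blast
      have "open (U (fst p) \<times> (UNIV :: 'a set))" by (simp add: open_Times *)
      then have "\<forall>\<^sub>F q in nhds p. q \<in> U (fst p) \<times> (UNIV :: 'a set)"
        by (rule eventually_nhds_in_open) (simp add: mem_Times_iff *)
      then have "\<forall>\<^sub>F q in nhds p. F' (fst q) (snd q) = G' (fst p) (fst q) (snd q)"
        by (rule eventually_mono) (auto simp: eq)
      then show ?thesis using c by (simp add: isCont_cong)
    qed
    then show "continuous_on UNIV (\<lambda>p. F' (fst p) (snd p))" by (simp add: continuous_at_imp_continuous_on)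
  qed
  then show ?thesis by (auto simp: C1_def)
qed

text \<open>A point closer than 1/2 to \<open>p\<close> has a neighbourhood on which the bump is
  \<open>K\<close> in a lifted coordinate. Any other point has the ball of radius
  \<open>1/2 - r\<close> around it, which misses the support.\<close>

lemma (in flat_cover) C1_bump:
  assumes "C1 K" "\<And>v. norm v \<ge> r \<Longrightarrow> K v = 0" "r < 1/2"
  shows "C1 (\<lambda>v. bump p K (pr v))"
proof (rule C1_with_locally)
  fix v
  obtain w where w: "pr v = p + pr w" "norm w = dist (pr v) p" using ex_lift by blast
  show "\<exists>U G G'. open U \<and> v \<in> U \<and> C1_with G G' \<and> (\<forall>u\<in>U. bump p K (pr u) = G u)"
  proof (cases "norm w < 1/2")
    case True
    have "C1 (\<lambda>u. K (u - v + w))"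
      by (rule C1_compose[OF assms(1)])
         (use C1_add[OF C1_bounded_linear[OF bounded_linear_ident] C1_const[of "w - v"]] in \<open>simp add: algebra_simps\<close>)
    then obtain G' where G': "C1_with (\<lambda>u. K (u - v + w)) G'" by (auto simp: C1_def)
    have "bump p K (pr u) = K (u - v + w)" if "u \<in> ball v (1/2 - norm w)" for u
    proof -
      have "norm (u - v + w) \<le> norm (u - v) + norm w" by (rule norm_triangle_ineq)
      then have "norm (u - v + w) < 1/2" using that by (simp add: dist_norm norm_minus_commute)
      moreover have "pr u = p + pr (u - v + w)" using w(1) by (simp add: pr_add pr_diff)
      ultimately show ?thesis by (metis bump_eq)
    qed
    then show ?thesis using G' True
      by (intro exI[of _ "ball v (1/2 - norm w)"] exI[of _ "\<lambda>u. K (u - v + w)"] exI[of _ G']) auto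
  next
    case False
    have "bump p K (pr u) = 0" if "u \<in> ball v (1/2 - r)" for u
    proof (rule bump_eq_0[OF assms(2)])
      have "dist (pr v) p \<le> dist (pr u) p + dist (pr v) (pr u)" by (metis add.commute dist_commute dist_triangle)
      moreover have "dist (pr v) (pr u) \<le> norm (v - u)" using dist_pr_le[of 0 v u] by simp
      ultimately show "r \<le> dist (pr u) p" using that False w(2) by (simp add: dist_norm)
    qed
    then show ?thesis using C1_with_const[of "0::real"] assms(3)
      by (intro exI[of _ "ball v (1/2 - r)"] exI[of _ "\<lambda>u. 0"] exI[of _ "\<lambda>u w. 0"]) auto
  qed
qed

section \<open>Derivatives and disks on the manifold\<close>

text \<open>Two chart representations of the same map both tend to 0, so near 0 they are less than 1
  apart while having equal projections, and therefore coincide. This makes the choice in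
  \<open>tderiv\<close> unambiguous.\<close>

lemma tderiv_eq:
  assumes "has_mderiv (\<lambda>v. f (x + proj v)) L 0 UNIV"
  shows "tderiv f x = L"
proof -
  have unique: "L1 = L2" if 1: "has_mderiv (\<lambda>v. f (x + proj v)) L1 0 UNIV"
    and 2: "has_mderiv (\<lambda>v. f (x + proj v)) L2 0 UNIV" for L1 L2
  proof -
    obtain F1 where F1: "F1 0 = 0" "(F1 has_derivative L1) (at 0)"
        "\<forall>\<^sub>F v in at 0. f (x + proj v) = f (x + proj 0) + proj (F1 v)"
      using 1 unfolding has_mderiv_def by auto
    obtain F2 where F2: "F2 0 = 0" "(F2 has_derivative L2) (at 0)"
        "\<forall>\<^sub>F v in at 0. f (x + proj v) = f (x + proj 0) + proj (F2 v)"
      using 2 unfolding has_mderiv_def by auto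
    have "((\<lambda>v. F1 v - F2 v) \<longlongrightarrow> F1 0 - F2 0) (at 0)"
      using F1(2) F2(2) by (intro tendsto_diff) (auto dest: has_derivative_continuous simp: continuous_within)
    then have "\<forall>\<^sub>F v in at 0. norm (F1 v - F2 v) < 1"
      using F1(1) F2(1) by (auto dest!: tendstoD[of _ _ _ 1])
    with F1(3) F2(3) have "\<forall>\<^sub>F v in at 0. F1 v = F2 v"
      by eventually_elim (auto intro: proj.pr_inj)
    then have "(F2 has_derivative L1) (at 0)"
      using has_derivative_transform_eventually[OF F1(2)] F1(1) F2(1) by auto
    then show ?thesis using F2(2) has_derivative_unique by blast
  qed
  show ?thesis unfolding tderiv_def
    using assms unique by (intro some_equality) blast+
qed

lemma tderiv_lift:
  assumes lift: "\<And>v. f (proj v) = proj (F v)" and der: "(F has_derivative L) (at w)"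
  shows "tderiv f (proj w) = L"
proof (rule tderiv_eq)
  have "((\<lambda>v. F (w + v) - F w) has_derivative L) (at 0)"
  proof -
    have "((\<lambda>v. w + v) has_derivative (\<lambda>v. v)) (at 0)" by (auto intro!: derivative_eq_intros)
    from has_derivative_compose[OF this, of F L] der show ?thesis
      by (auto intro!: derivative_eq_intros)
  qed
  then show "has_mderiv (\<lambda>v. f (proj w + proj v)) L 0 UNIV"
    unfolding has_mderiv_def
    by (intro exI[of _ "\<lambda>v. F (w + v) - F w"])
       (simp add: proj.pr_add[symmetric] lift)
qed

text \<open>\<open>has_mderiv\<close> supplies a separate chart at every point. Here the chart at
  \<open>u\<close> becomes one lift that serves all nearby points, with the prescribed derivative at
  each of them.\<close>

lemma has_mderiv_lift:
  assumes der: "\<And>v. v \<in> S \<Longrightarrow> has_mderiv g (L v) v S" and u: "u \<in> S" "g u = proj w"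
  obtains r G where "r > 0" "G u = w" "\<And>v. v \<in> S \<Longrightarrow> dist v u < r \<Longrightarrow> g v = proj (G v)"
    "\<And>v. v \<in> S \<Longrightarrow> dist v u < r \<Longrightarrow> (G has_derivative L v) (at v within S)"
proof -
  obtain F where F: "F u = 0" "(F has_derivative L u) (at u within S)"
      "\<forall>\<^sub>F v in at u within S. g v = g u + proj (F v)"
    using der[OF u(1)] unfolding has_mderiv_def by auto
  define G where "G = (\<lambda>v. w + F v)"
  have "(F \<longlongrightarrow> 0) (at u within S)"
    using has_derivative_continuous[OF F(2)] F(1) by (simp add: continuous_within)
  \<comment> \<open>With 1/4 for each of \<open>F v\<close>, \<open>F v'\<close> and
    \<open>H v'\<close>, the two candidate lifts compared below are less than 1 apart, so
    \<open>pr_inj\<close> identifies them.\<close>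
  then have "\<forall>\<^sub>F v in at u within S. norm (F v) < 1/4"
    using tendstoD[of F 0 _ "1/4"] by simp
  with F(3) have "\<forall>\<^sub>F v in at u within S. g v = g u + proj (F v) \<and> norm (F v) < 1/4"
    by eventually_elim auto
  then obtain r where r: "r > 0" "\<And>v. v \<in> S \<Longrightarrow> v \<noteq> u \<Longrightarrow> dist v u < r \<Longrightarrow> g v = g u + proj (F v) \<and> norm (F v) < 1/4"
    unfolding eventually_at by auto
  have r2: "g v = proj (G v) \<and> norm (F v) < 1/4" if "v \<in> S" "dist v u < r" for v
    using r(2)[of v] that F(1) u by (cases "v = u") (auto simp: G_def proj.pr_add)
  have "(G has_derivative L v) (at v within S)" if v: "v \<in> S" "dist v u < r" for v
  proof -
    obtain H where H: "H v = 0" "(H has_derivative L v) (at v within S)"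
        "\<forall>\<^sub>F v' in at v within S. g v' = g v + proj (H v')"
      using der[OF v(1)] unfolding has_mderiv_def by auto
    have "(H \<longlongrightarrow> 0) (at v within S)"
      using has_derivative_continuous[OF H(2)] H(1) by (simp add: continuous_within)
    then have "\<forall>\<^sub>F v' in at v within S. norm (H v') < 1/4"
      using tendstoD[of H 0 _ "1/4"] by simp
    moreover have "\<forall>\<^sub>F v' in at v within S. v' \<in> S \<and> dist v' u < r"
      unfolding eventually_at
    proof (intro exI[of _ "r - dist v u"] conjI ballI impI)
      show "0 < r - dist v u" using v by simp
      fix v' assume "v' \<in> S" "v' \<noteq> v \<and> dist v' v < r - dist v u"
      then show "dist v' u < r" using dist_triangle[of v' u v] by linarith
    qed
    ultimately have ev: "\<forall>\<^sub>F v' in at v within S. G v + H v' = G v'"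
      using H(3)
    proof eventually_elim
      case (elim v')
      have "norm (F v) < 1/4" "norm (F v') < 1/4" using r2 v elim by blast+
      then have "norm (G v + H v' - G v') < 1"
        using elim norm_triangle_ineq4[of "F v + H v'" "F v'"] norm_triangle_ineq[of "F v" "H v'"]
        unfolding G_def by (simp add: algebra_simps)
      moreover have "proj (G v + H v') = proj (G v')"
        using elim r2 v by (simp add: proj.pr_add)
      ultimately show ?case by (intro proj.pr_inj)
    qed
    have "((\<lambda>v'. G v + H v') has_derivative L v) (at v within S)"
      using has_derivative_add[OF has_derivative_const[of "G v"] H(2)] by simp
    then show ?thesis
      by (rule has_derivative_transform_eventually[OF _ ev]) (use H(1) v in auto)
  qed
  then show ?thesis using r2 r(1) F(1) by (intro that[of r G]) (auto simp: G_def)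
qed

text \<open>A linear right inverse of \<open>h' u\<close> with values in \<open>V\<close> turns
  \<open>h\<close> into a map between spaces of equal dimension whose derivative at 0 is the
  identity. \<open>sussmann_open_mapping\<close> asks for differentiability at that one point and
  continuity nearby, so the derivative need not vary continuously.\<close>

lemma disk_open_map:
  fixes h :: "'a::euclidean_space \<Rightarrow> 'b::euclidean_space"
  assumes V: "subspace V" "u \<in> V" and r: "r > 0" "\<And>v. v \<in> V \<Longrightarrow> dist v u < r \<Longrightarrow> v \<in> S"
    and der: "\<And>v. v \<in> V \<Longrightarrow> dist v u < r \<Longrightarrow> (h has_derivative h' v) (at v within S)"
    and surj: "h' u ` V = UNIV"
  obtains e where "e > 0" "\<And>y. dist y (h u) < e \<Longrightarrow> \<exists>v\<in>V. dist v u < r \<and> h v = y"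
proof -
  have lin: "linear (h' u)"
    using der[OF V(2)] r(1) has_derivative_linear by (metis dist_self)
  obtain g where g: "range g \<subseteq> V" "linear g" "\<And>y. h' u (g y) = y"
    using linear_exists_right_inverse_on[OF lin V(1)] surj by auto
  have bl: "bounded_linear g" using g(2) by (simp add: linear_conv_bounded_linear)
  then obtain C where C: "C > 0" "\<And>y. norm (g y) \<le> norm y * C"
    using bounded_linear.pos_bounded by blast
  define \<rho> where "\<rho> = r / C"
  have "\<rho> > 0" using r C by (simp add: \<rho>_def)
  have small: "dist (u + g y) u < r" if "y \<in> ball 0 \<rho>" for y
  proof -
    have "norm (g y) \<le> norm y * C" by (rule C)
    also have "\<dots> < \<rho> * C" using that C(1) by (intro mult_strict_right_mono) auto
    finally show ?thesis using C(1) by (simp add: \<rho>_def dist_norm)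
  qed
  have inV: "u + g y \<in> V" for y using g(1) V by (auto intro: subspace_add)
  define k where "k = (\<lambda>y. h (u + g y))"
  have dk: "(k has_derivative (\<lambda>z. h' (u + g y) (g z))) (at y)" if y: "y \<in> ball 0 \<rho>" for y
  proof -
    have 1: "((\<lambda>y. u + g y) has_derivative g) (at y within ball 0 \<rho>)"
      using bounded_linear_imp_has_derivative[OF bl, THEN has_derivative_at_withinI] by (auto intro!: derivative_eq_intros)
    have "(h has_derivative h' (u + g y)) (at (u + g y) within (\<lambda>y. u + g y) ` ball 0 \<rho>)"
      by (rule has_derivative_subset[OF der]) (use small y inV r in auto)
    from has_derivative_in_compose[OF 1 this] show ?thesis
      unfolding k_def using y by (simp add: at_within_open[OF y open_ball])
  qed
  have "k 0 \<in> interior (k ` ball 0 \<rho>)"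
  proof (rule sussmann_open_mapping[of "ball 0 \<rho>" k 0 "\<lambda>z. z" "\<lambda>z. z"])
    show "continuous_on (ball 0 \<rho>) k"
      using dk has_derivative_continuous continuous_at_imp_continuous_on by blast
    have "linear g" by fact
    then show "(k has_derivative (\<lambda>z. z)) (at 0)"
      using dk[of 0] \<open>\<rho> > 0\<close> g(3) by (simp add: linear_0)
    show "0 \<in> interior (ball 0 \<rho> :: 'b set)" using \<open>\<rho> > 0\<close> by (simp add: interior_open)
  qed (use \<open>\<rho> > 0\<close> in \<open>auto simp: o_def\<close>)
  then obtain e where e: "e > 0" "ball (k 0) e \<subseteq> k ` ball 0 \<rho>"
    using mem_interior by blast
  show ?thesis
  proof (rule that[OF e(1)])
    fix y assume "dist y (h u) < e"
    moreover have "k 0 = h u" using linear_0[OF g(2)] by (simp add: k_def)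
    ultimately have "y \<in> k ` ball 0 \<rho>" using e(2) by (auto simp: dist_commute)
    then obtain z where "z \<in> ball 0 \<rho>" "y = k z" by blast
    then show "\<exists>v\<in>V. dist v u < r \<and> h v = y"
      using small inV by (intro bexI[of _ "u + g z"]) (auto simp: k_def)
  qed
qed

text \<open>\<open>T y0\<close> is bounded below by some \<open>c\<close>, hence nearby
  \<open>T y\<close> by \<open>c / 2\<close>. The difference \<open>d\<close> of the two preimages
  of \<open>w\<close> solves \<open>T y d = w - T y x0\<close>, whose right side tends to 0.\<close>

lemma continuous_on_inv_blinfun:
  fixes T :: "'b::topological_space \<Rightarrow> ('a::euclidean_space \<Rightarrow>\<^sub>L 'a)"
  assumes cont: "continuous_on S T" and bij: "\<And>y. y \<in> S \<Longrightarrow> bij (blinfun_apply (T y))"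
  shows "continuous_on S (\<lambda>y. inv (blinfun_apply (T y)) w)"
  unfolding continuous_on_def
proof
  fix y0 assume y0: "y0 \<in> S"
  define x0 where "x0 = inv (blinfun_apply (T y0)) w"
  obtain c where c: "c > 0" "\<And>v. norm (T y0 v) \<ge> c * norm v"
  proof -
    have "inj (blinfun_apply (T y0))" using bij[OF y0] bij_is_inj by blast
    then obtain B where B: "B > 0" "\<And>x. B * norm x \<le> norm (T y0 x)"
      using linear_inj_bounded_below_pos[of "blinfun_apply (T y0)"] blinfun.bounded_linear_right
      by (metis bounded_linear.linear)
    then show ?thesis using that[of B] by blast
  qed
  have T: "((T \<longlongrightarrow> T y0) (at y0 within S))" using cont y0 by (simp add: continuous_on_def)
  have "((\<lambda>y. 2 / c * norm (w - T y x0)) \<longlongrightarrow> 2 / c * norm (w - T y0 x0)) (at y0 within S)"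
    by (intro tendsto_intros T)
  moreover have "T y0 x0 = w" unfolding x0_def using bij[OF y0] by (simp add: bij_is_surj surj_f_inv_f)
  ultimately have lim: "((\<lambda>y. 2 / c * norm (w - T y x0)) \<longlongrightarrow> 0) (at y0 within S)" by simp
  have "\<forall>\<^sub>F y in at y0 within S. norm (T y - T y0) < c / 2"
    using tendstoD[OF T, of "c/2"] c(1) by (simp add: dist_norm)
  moreover have "\<forall>\<^sub>F y in at y0 within S. y \<in> S" by (simp add: eventually_at_filter)
  ultimately have "\<forall>\<^sub>F y in at y0 within S. norm (inv (blinfun_apply (T y)) w - x0) \<le> 2 / c * norm (w - T y x0)"
  proof eventually_elim
    case (elim y)
    define d where "d = inv (blinfun_apply (T y)) w - x0"
    have "T y (inv (blinfun_apply (T y)) w) = w" using bij[OF elim(2)] by (simp add: bij_is_surj surj_f_inv_f)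
    then have Td: "T y d = w - T y x0" by (simp add: d_def blinfun.diff_right)
    have "norm ((T y - T y0) d) \<le> norm (T y - T y0) * norm d" by (rule norm_blinfun)
    also have "\<dots> \<le> c / 2 * norm d" using elim by (intro mult_right_mono) auto
    finally have "c * norm d - c / 2 * norm d \<le> norm (T y0 d) - norm ((T y - T y0) d)"
      using c(2)[of d] by linarith
    also have "\<dots> \<le> norm (T y d)"
      using norm_triangle_ineq4[of "T y d" "(T y - T y0) d"] by (simp add: blinfun.diff_left)
    finally show ?case using c(1) unfolding Td d_def[symmetric] by (simp add: field_simps)
  qed
  then have "((\<lambda>y. inv (blinfun_apply (T y)) w - x0) \<longlongrightarrow> 0) (at y0 within S)"
    by (rule Lim_null_comparison[OF _ lim])
  then show "((\<lambda>y. inv (blinfun_apply (T y)) w) \<longlongrightarrow> inv (blinfun_apply (T y0)) w) (at y0 within S)"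
    unfolding x0_def[symmetric] by (simp add: LIM_zero_iff)
qed

text \<open>The disk is the local preimage of the affine space \<open>F v0 + T\<close> under \<open>F\<close>.\<close>

lemma inverse_disk:
  fixes F :: "R5 \<Rightarrow> R5"
  assumes F: "C1_with F F'" and bij: "bij (F' v0)" and T: "subspace T" and e: "e > 0"
    and W: "\<And>v t. t \<in> T \<Longrightarrow> norm t < e \<Longrightarrow> F v = F v0 + t \<Longrightarrow> proj v \<in> W"
  obtains g L where "c1_disk T g L" "g 0 = proj v0" "g ` (cball 0 1 \<inter> T) \<subseteq> W"
    "\<And>w. F' v0 w \<in> T \<Longrightarrow> w \<in> L 0 ` T"
proof -
  define B where "B = (\<lambda>v. Blinfun (F' v))"
  have B [simp]: "blinfun_apply (B v) = F' v" for v
    unfolding B_def by (rule bounded_linear_Blinfun_apply) (rule C1_with_linear[OF F])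
  have contB: "continuous_on S B" for S
    by (rule continuous_on_blinfun_componentwise)
       (simp add: C1_with_continuous_deriv[OF F] continuous_on_id)
  have invF: "bounded_linear (inv (F' v0))"
    using bij C1_with_linear[OF F] linear_conv_bounded_linear
    by (metis bij_is_inj inj_linear_imp_inv_linear bounded_linear.linear)
  have "Blinfun (inv (F' v0)) o\<^sub>L B v0 = id_blinfun"
    by (rule blinfun_eqI) (simp add: bounded_linear_Blinfun_apply[OF invF] bij_is_inj[OF bij])
  \<comment> \<open>The radius 1/4 keeps the image of the local inverse in a set of diameter below
    1, where \<open>proj\<close> is injective.\<close>
  then obtain U' Y g g' where g: "open U'" "U' \<subseteq> ball v0 (1/4)" "v0 \<in> U'" "open Y" "F v0 \<in> Y"
      "homeomorphism U' Y F g" "\<And>y. y \<in> Y \<Longrightarrow> (g has_derivative (g' y)) (at y)"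
      "\<And>y. y \<in> Y \<Longrightarrow> g' y = inv (blinfun_apply (B (g y)))"
      "\<And>y. y \<in> Y \<Longrightarrow> bij (blinfun_apply (B (g y)))"
    using inverse_function_theorem[of "ball v0 (1/4)" F B v0] C1_with_deriv[OF F] contB
    by (metis B centre_in_ball open_ball zero_less_divide_1_iff zero_less_numeral)
  obtain \<epsilon> where \<epsilon>: "\<epsilon> > 0" "ball (F v0) \<epsilon> \<subseteq> Y" using g(4,5) open_contains_ball by blast
  \<comment> \<open>The bound \<open>e\<close> serves the hypothesis on \<open>W\<close>, \<epsilon>
    the domain of the local inverse. Halving makes room for the closed unit ball.\<close>
  define \<rho> where "\<rho> = min e \<epsilon> / 2"
  have \<rho>: "\<rho> > 0" "\<rho> < e" "\<rho> < \<epsilon>" using e \<epsilon> by (auto simp: \<rho>_def min_def)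
  define a where "a = (\<lambda>u. F v0 + \<rho> *\<^sub>R u)"
  define S where "S = cball 0 1 \<inter> T"
  have nu: "norm (\<rho> *\<^sub>R u) < e \<and> norm (\<rho> *\<^sub>R u) < \<epsilon>" if "u \<in> S" for u
  proof -
    have "norm (\<rho> *\<^sub>R u) \<le> \<rho>" using that \<rho>(1) by (simp add: S_def mult_left_le)
    then show ?thesis using \<rho> by linarith
  qed
  have aY: "a u \<in> Y" if "u \<in> S" for u
    using nu[OF that] \<epsilon>(2) unfolding a_def by (auto simp: subset_eq dist_norm)
  have Fg: "F (g y) = y" "g y \<in> U'" if "y \<in> Y" for y
    using g(6) that unfolding homeomorphism_def by auto
  define D where "D = (\<lambda>u. proj (g (a u)))"
  define L where "L = (\<lambda>u w. g' (a u) (\<rho> *\<^sub>R w))"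
  have g0: "g (F v0) = v0" using g(3,6) unfolding homeomorphism_def by auto
  have "c1_disk T D L"
    unfolding c1_disk_def S_def[symmetric]
  proof (intro conjI ballI T)
    show "inj_on D S"
    proof (rule inj_onI)
      fix u w assume uw: "u \<in> S" "w \<in> S" "D u = D w"
      have "g (a u) \<in> ball v0 (1/4)" "g (a w) \<in> ball v0 (1/4)" using Fg aY uw g(2) by blast+
      then have "norm (g (a u) - g (a w)) < 1"
        using dist_triangle2[of "g (a u)" "g (a w)" v0] by (simp add: dist_norm norm_minus_commute)
      then have "g (a u) = g (a w)" using uw unfolding D_def by (intro proj.pr_inj)
      then have "a u = a w" using Fg(1) aY uw by metis
      then show "u = w" using \<rho>(1) by (simp add: a_def)
    qed
  next
    fix u assume u: "u \<in> S"
    have da: "(a has_derivative (\<lambda>w. \<rho> *\<^sub>R w)) (at u within S)"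
      unfolding a_def by (auto intro!: derivative_eq_intros)
    have "((\<lambda>w. g (a w)) has_derivative (\<lambda>w. g' (a u) (\<rho> *\<^sub>R w))) (at u within S)"
      by (rule has_derivative_compose[OF da g(7)[OF aY[OF u]]])
    then have "((\<lambda>w. g (a w) - g (a u)) has_derivative L u) (at u within S)"
      unfolding L_def by (auto intro!: derivative_eq_intros)
    then show "has_mderiv D (L u) u S"
      unfolding has_mderiv_def D_def
      by (intro exI[of _ "\<lambda>w. g (a w) - g (a u)"]) (simp add: proj.pr_diff)
    have "bij (F' (g (a u)))" using g(9)[OF aY[OF u]] by simp
    then have "inj (g' (a u))" using g(8)[OF aY[OF u]] by (simp add: bij_imp_bij_inv bij_is_inj)
    show "inj_on (L u) T"
    proof (rule inj_onI)
      fix v w assume "L u v = L u w"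
      then have "\<rho> *\<^sub>R v = \<rho> *\<^sub>R w" unfolding L_def using \<open>inj (g' (a u))\<close> by (rule injD[rotated])
      then show "v = w" using \<rho>(1) by simp
    qed
  next
    fix w
    have "continuous_on Y (\<lambda>y. inv (blinfun_apply (B (g y))) (\<rho> *\<^sub>R w))"
      using g(6) by (intro continuous_on_inv_blinfun continuous_on_compose2[OF contB[of UNIV]] g(9))
        (auto simp: homeomorphism_def)
    then have "continuous_on S (\<lambda>u. inv (blinfun_apply (B (g (a u)))) (\<rho> *\<^sub>R w))"
    proof (rule continuous_on_compose2)
      show "continuous_on S a" unfolding a_def by (intro continuous_intros)
      show "a ` S \<subseteq> Y" using aY by blast
    qed
    then show "continuous_on S (\<lambda>u. L u w)"
      by (rule continuous_on_eq) (simp add: L_def g(8) aY)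
  qed
  moreover have "D 0 = proj v0" unfolding D_def a_def using g0 by simp
  moreover have "D ` (cball 0 1 \<inter> T) \<subseteq> W"
  proof (rule image_subsetI)
    fix u assume "u \<in> cball 0 1 \<inter> T"
    then have u: "u \<in> S" by (simp add: S_def)
    show "D u \<in> W" unfolding D_def
      by (rule W[of "\<rho> *\<^sub>R u"])
         (use u nu[OF u] Fg(1)[OF aY[OF u]] T in \<open>auto simp: S_def a_def subspace_scale\<close>)
  qed
  moreover have "w \<in> L 0 ` T" if "F' v0 w \<in> T" for w
  proof (rule image_eqI)
    show "(1 / \<rho>) *\<^sub>R F' v0 w \<in> T" using that T by (rule subspace_scale[rotated])
    have "L 0 ((1 / \<rho>) *\<^sub>R F' v0 w) = inv (F' v0) (F' v0 w)"
      using \<rho>(1) g(5) g0 by (simp add: L_def a_def g(8))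
    then show "w = L 0 ((1 / \<rho>) *\<^sub>R F' v0 w)" using bij by (simp add: bij_is_inj inv_f_f)
  qed
  ultimately show ?thesis using that by blast
qed

section \<open>Skew products on the five-dimensional manifold\<close>

text \<open>Applied with \<open>c = 2\<close> to lifts of circle maps of degree one and with
  \<open>c = 0\<close> to periodic functions.\<close>

lemma shift_by_periods:
  fixes g :: "real \<Rightarrow> real"
  assumes "\<And>t. g (t + 2) = g t + c"
  shows "g (t + of_int n * 2) = g t + of_int n * c"
proof -
  have pos: "g (t + of_nat n * 2) = g t + of_nat n * c" for t n
  proof (induction n)
    case (Suc n)
    have "g (t + of_nat (Suc n) * 2) = g ((t + of_nat n * 2) + 2)" by (simp add: algebra_simps)
    also have "\<dots> = g t + of_nat n * c + c" by (simp only: assms Suc)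
    finally show ?case by (simp add: algebra_simps)
  qed simp
  show ?thesis
    using pos[of t "nat n"] pos[of "t + of_int n * 2" "nat (- n)"] by (cases "n \<ge> 0") auto
qed

locale orthonormal_plane =
  fixes eu es :: "real \<times> real"
  assumes norm_eu: "norm eu = 1" and norm_es: "norm es = 1" and eu_es: "eu \<bullet> es = 0"
begin

lemma eu_eu [simp]: "eu \<bullet> eu = 1" "es \<bullet> es = 1" "eu \<bullet> es = 0" "es \<bullet> eu = 0"
  using norm_eu norm_es eu_es by (auto simp: norm_eq_1 inner_commute)

text \<open>In the plane orthonormality forces \<open>es\<close> to be \<open>eu\<close> turned by a
  right angle, up to the sign \<open>D\<close> of the determinant; what remains is a polynomial
  identity.\<close>

lemma expand: "v = (v \<bullet> eu) *\<^sub>R eu + (v \<bullet> es) *\<^sub>R es"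
proof -
  obtain a b c d x y where e: "eu = (a, b)" "es = (c, d)" "v = (x, y)" by (metis surj_pair)
  have 1: "a * a + b * b = 1" "c * c + d * d = 1" "a * c + b * d = 0"
    using eu_eu by (simp_all add: e)
  define D where "D = a * d - b * c"
  have "D * D = (a*a+b*b) * (c*c+d*d) - (a*c+b*d)*(a*c+b*d)" unfolding D_def by algebra
  then have D: "D * D = 1" using 1 by simp
  have "c = c * (a*a + b*b) - a * (a*c+b*d)" using 1 by simp
  then have c: "c = - b * D" unfolding D_def by algebra
  have "d = d * (a*a + b*b) - b * (a*c+b*d)" using 1 by simp
  then have d: "d = a * D" unfolding D_def by algebra
  have "(x * a + y * b) * a + (x * (- b * D) + y * (a * D)) * (- b * D) = x"
    using D 1(1) by algebra
  moreover have "(x * a + y * b) * b + (x * (- b * D) + y * (a * D)) * (a * D) = y"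
    using D 1(1) by algebra
  ultimately show ?thesis unfolding e using c d by simp
qed

lemma eq_scale_es: "v \<bullet> eu = 0 \<Longrightarrow> v = (v \<bullet> es) *\<^sub>R es"
  using expand[of v] by simp

lemma plane_eqI: "v \<bullet> eu = w \<bullet> eu \<Longrightarrow> v \<bullet> es = w \<bullet> es \<Longrightarrow> v = w"
  using expand[of v] expand[of w] by simp

end

text \<open>The rate condition \<open>slope\<close> says that the line field of \<open>eu\<close> is
  never stretched by more than the expansion rate of the first torus. This is what turns domination
  by that line field into information about the first torus component of \<open>Ecs\<close>.\<close>

locale skew_map = orthonormal_plane eu es
  for eu es :: "real \<times> real" +
  fixes \<sigma>\<^sub>1 \<tau>\<^sub>1 \<sigma>\<^sub>0 \<tau>\<^sub>0 :: real and Lx Lz :: "real \<times> real \<Rightarrow> real \<times> real"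
    and fx fz :: "torus \<Rightarrow> torus" and G :: "real \<times> real \<Rightarrow> real \<Rightarrow> real"
    and g2 :: "torus \<Rightarrow> 2 circle \<Rightarrow> 2 circle" and h :: "mfd \<Rightarrow> real" and f :: "mfd \<Rightarrow> mfd"
  assumes rates: "1 < \<sigma>\<^sub>1" "0 < \<tau>\<^sub>1" "\<tau>\<^sub>1 < 1" "1 < \<sigma>\<^sub>0" "0 < \<tau>\<^sub>0" "\<tau>\<^sub>0 < 1"
    and Lx: "linear Lx" "Lx eu = \<sigma>\<^sub>1 *\<^sub>R eu" "Lx es = \<tau>\<^sub>1 *\<^sub>R es"
    and Lz: "linear Lz" "Lz eu = \<sigma>\<^sub>0 *\<^sub>R eu" "Lz es = \<tau>\<^sub>0 *\<^sub>R es"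
    and fx: "bij fx" "\<And>u v. fx (u + v) = fx u + fx v" "\<And>v. fx (tproj v) = tproj (Lx v)"
    and fz: "bij fz" "\<And>u v. fz (u + v) = fz u + fz v" "\<And>v. fz (tproj v) = tproj (Lz v)"
    and g2: "\<And>x t. g2 (tproj x) (circ t) = circ (G x t)"
    and C1_G: "C1 (\<lambda>p. G (fst p) (snd p))" and C1_h: "C1 (\<lambda>v. h (proj v))"
    and G_mono: "\<And>x. strict_mono (G x)" and G_periodic: "\<And>x t. G x (t + 2) = G x t + 2"
    and h_bound: "\<exists>M. \<forall>m. \<bar>h m\<bar> \<le> M"
    and f: "\<And>x y z. f (x, y, z) = (fx x, g2 x y, fz (z + tproj (h (x, y, z) *\<^sub>R eu)))"
    and slope: "\<And>v D. ((\<lambda>t. t + h (proj (v + (0, 0, t *\<^sub>R eu)))) has_real_derivative D) (at 0)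
        \<Longrightarrow> \<bar>\<sigma>\<^sub>0 * D\<bar> \<le> \<sigma>\<^sub>1"
begin

definition F :: "R5 \<Rightarrow> R5" where
  "F v = (Lx (fst v), G (fst v) (fst (snd v)), Lz (snd (snd v) + h (proj v) *\<^sub>R eu))"

definition F' :: "R5 \<Rightarrow> R5 \<Rightarrow> R5" where
  "F' = (SOME F'. C1_with F F')"

lemma C1_F: "C1_with F F'"
proof -
  have 1: "C1 (\<lambda>v::R5. fst v)" "C1 (\<lambda>v::R5. snd v)" "C1 (\<lambda>v::R5. snd (snd v))" "C1 (\<lambda>v::R5. fst (snd v))"
    by (intro C1_bounded_linear bounded_linear_fst bounded_linear_snd bounded_linear_compose[OF bounded_linear_fst]
        bounded_linear_compose[OF bounded_linear_snd])+
  have "C1 (\<lambda>v::R5. G (fst v) (fst (snd v)))"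
    using C1_compose[OF C1_G C1_Pair[OF 1(1) 1(4)]] by simp
  then have "C1 F"
    unfolding F_def
    by (intro C1_Pair C1_compose[OF C1_linear[OF Lx(1)]] C1_compose[OF C1_linear[OF Lz(1)]] C1_add
        C1_scaleR C1_h C1_const 1)
  then show ?thesis unfolding C1_def F'_def by (rule someI_ex)
qed

lemma f_proj: "f (proj v) = proj (F v)"
proof -
  obtain x y z where v: "v = (x, y, z)" by (metis surj_pair)
  show ?thesis unfolding v F_def by (simp add: f fx g2 fz tproj.pr_add[symmetric])
qed

primrec DF :: "nat \<Rightarrow> R5 \<Rightarrow> R5 \<Rightarrow> R5" where
  "DF 0 v w = w"
| "DF (Suc n) v w = F' ((F ^^ n) v) (DF n v w)"

lemma C1_iterate: "C1_with (F ^^ n) (DF n)"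
proof (induction n)
  case 0
  have "C1_with (F ^^ 0) (\<lambda>v w. w)" by (rule C1_withI) (auto intro!: continuous_intros simp: id_def)
  moreover have "DF 0 = (\<lambda>v w. w)" by (intro ext) simp
  ultimately show ?case by metis
next
  case (Suc n)
  from C1_with_compose[OF Suc C1_F] have "C1_with (\<lambda>v. F ((F ^^ n) v)) (\<lambda>v w. F' ((F ^^ n) v) (DF n v w))" .
  moreover have "DF (Suc n) = (\<lambda>v w. F' ((F ^^ n) v) (DF n v w))" by (intro ext) simp
  moreover have "F ^^ Suc n = (\<lambda>v. F ((F ^^ n) v))" by (intro ext) simp
  ultimately show ?case by simp
qed

lemma iterate_proj: "(f ^^ n) (proj v) = proj ((F ^^ n) v)"
  by (induction n) (auto simp: f_proj)

lemma tderiv_iterate: "tderiv (f ^^ n) (proj v) = DF n v"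
  by (rule tderiv_lift[OF iterate_proj C1_with_deriv[OF C1_iterate]])

lemma tderiv_f: "tderiv f (proj v) = F' v"
  by (rule tderiv_lift[OF f_proj C1_with_deriv[OF C1_F]])

lemma linear_F': "linear (F' v)"
  using C1_with_linear[OF C1_F] by (simp add: linear_conv_bounded_linear)

end

text \<open>These are the consequences of the splitting that the dynamics needs. The vector
  \<open>(0, 0, eu)\<close> has norm 1, so its norm does not appear on the right of the domination
  estimate.\<close>

locale skew_system = skew_map +
  fixes Ecs :: subbundle
  assumes surj_tderiv: "\<And>m. surj (tderiv f m)"
    and Ecs_subspace: "\<And>m. subspace (Ecs m)" and dim_Ecs: "\<And>m. dim (Ecs m) = 3"
    and Ecs_invariant: "\<And>m w. w \<in> Ecs m \<Longrightarrow> tderiv f m w \<in> Ecs (f m)"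
    and Ecs_dominated: "\<exists>c>0. \<exists>\<sigma>\<ge>0. \<sigma> < 1 \<and> (\<forall>m w n. w \<in> Ecs m \<longrightarrow> w \<noteq> 0 \<longrightarrow> n \<ge> 1 \<longrightarrow>
        norm (tderiv (f ^^ n) m w) / norm (tderiv (f ^^ n) m (0, 0, eu)) \<le> c * \<sigma> ^ n * norm w)"
begin

lemma bij_F': "bij (F' v)"
  using linear_surjective_imp_injective[OF linear_F'] surj_tderiv[of "proj v"] by (simp add: tderiv_f bij_def)

lemma linear_DF: "linear (DF n v)"
  using C1_with_linear[OF C1_iterate] by (simp add: linear_conv_bounded_linear)

lemma bij_DF: "bij (DF n v)"
proof (induction n)
  case 0
  have "DF 0 v = id" by (intro ext) simp
  then show ?case by (metis bij_id)
next
  case (Suc n)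
  have "DF (Suc n) v = F' ((F ^^ n) v) \<circ> DF n v" by (intro ext) simp
  then show ?case using bij_comp[OF Suc bij_F'] by metis
qed

lemma DF_Ecs: "w \<in> Ecs (proj v) \<Longrightarrow> DF n v w \<in> Ecs (proj ((F ^^ n) v))"
proof (induction n)
  case (Suc n)
  then have "tderiv f (proj ((F ^^ n) v)) (DF n v w) \<in> Ecs (f (proj ((F ^^ n) v)))"
    by (intro Ecs_invariant)
  then show ?case by (simp add: tderiv_f f_proj)
qed simp

lemma Lx_inner: "Lx x \<bullet> eu = \<sigma>\<^sub>1 * (x \<bullet> eu)" "Lx x \<bullet> es = \<tau>\<^sub>1 * (x \<bullet> es)"
proof -
  have "Lx x = Lx ((x \<bullet> eu) *\<^sub>R eu + (x \<bullet> es) *\<^sub>R es)" using expand[of x] by simp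
  also have "\<dots> = (x \<bullet> eu) *\<^sub>R \<sigma>\<^sub>1 *\<^sub>R eu + (x \<bullet> es) *\<^sub>R \<tau>\<^sub>1 *\<^sub>R es"
    by (simp only: linear_add[OF Lx(1)] linear_scale[OF Lx(1)] Lx)
  finally have "Lx x = (x \<bullet> eu) *\<^sub>R \<sigma>\<^sub>1 *\<^sub>R eu + (x \<bullet> es) *\<^sub>R \<tau>\<^sub>1 *\<^sub>R es" .
  then show "Lx x \<bullet> eu = \<sigma>\<^sub>1 * (x \<bullet> eu)" "Lx x \<bullet> es = \<tau>\<^sub>1 * (x \<bullet> es)"
    by (simp_all add: inner_add_left)
qed

lemma Lz_inner: "Lz x \<bullet> eu = \<sigma>\<^sub>0 * (x \<bullet> eu)" "Lz x \<bullet> es = \<tau>\<^sub>0 * (x \<bullet> es)"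
proof -
  have "Lz x = Lz ((x \<bullet> eu) *\<^sub>R eu + (x \<bullet> es) *\<^sub>R es)" using expand[of x] by simp
  also have "\<dots> = (x \<bullet> eu) *\<^sub>R \<sigma>\<^sub>0 *\<^sub>R eu + (x \<bullet> es) *\<^sub>R \<tau>\<^sub>0 *\<^sub>R es"
    by (simp only: linear_add[OF Lz(1)] linear_scale[OF Lz(1)] Lz)
  finally have "Lz x = (x \<bullet> eu) *\<^sub>R \<sigma>\<^sub>0 *\<^sub>R eu + (x \<bullet> es) *\<^sub>R \<tau>\<^sub>0 *\<^sub>R es" .
  then show "Lz x \<bullet> eu = \<sigma>\<^sub>0 * (x \<bullet> eu)" "Lz x \<bullet> es = \<tau>\<^sub>0 * (x \<bullet> es)"
    by (simp_all add: inner_add_left)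
qed

lemma F'_unique: "(F has_derivative D) (at v) \<Longrightarrow> F' v = D"
  using C1_with_deriv[OF C1_F] has_derivative_unique by blast

lemma fst_F': "fst (F' v w) = Lx (fst w)"
proof -
  have "((\<lambda>v. fst (F v)) has_derivative (\<lambda>w. fst (F' v w))) (at v)"
    by (rule has_derivative_fst[OF C1_with_deriv[OF C1_F]])
  moreover have "((\<lambda>v. fst (F v)) has_derivative (\<lambda>w. Lx (fst w))) (at v)"
    unfolding F_def fst_conv
    using Lx(1) by (intro bounded_linear_imp_has_derivative bounded_linear_compose[OF _ bounded_linear_fst])
      (simp add: linear_conv_bounded_linear)
  ultimately have "(\<lambda>w. fst (F' v w)) = (\<lambda>w. Lx (fst w))" by (rule has_derivative_unique)
  then show ?thesis by metis
qed

lemma DF_fst: "fst (DF n v w) \<bullet> eu = \<sigma>\<^sub>1 ^ n * (fst w \<bullet> eu)"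
  by (induction n) (auto simp: fst_F' Lx_inner)

lemma F_eu_line: "F (v + (0, 0, t *\<^sub>R eu)) = (fst (F v), fst (snd (F v)),
     Lz (snd (snd v)) + (\<sigma>\<^sub>0 * (t + h (proj (v + (0, 0, t *\<^sub>R eu))))) *\<^sub>R eu)"
proof -
  obtain x y z where v: "v = (x, y, z)" by (metis surj_pair)
  show ?thesis unfolding v F_def
    by (simp add: linear_add[OF Lz(1)] linear_scale[OF Lz(1)] Lz algebra_simps)
qed

text \<open>The factor on the line field of \<open>eu\<close> is \<open>\<sigma>\<^sub>0\<close>
  times the derivative of the displaced parameter. It is recorded along a whole line, since Rolle's
  theorem will look for a zero of \<open>D\<close> at an unknown parameter.\<close>

lemma F'_eu:
  obtains D where "\<And>t. ((\<lambda>t. t + h (proj (v + (0, 0, t *\<^sub>R eu)))) has_real_derivative D t) (at t)"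
    "\<And>t. F' (v + (0, 0, t *\<^sub>R eu)) (0, 0, eu) = (0, 0, (\<sigma>\<^sub>0 * D t) *\<^sub>R eu)"
proof -
  define k where "k = (\<lambda>t. t + h (proj (v + (0, 0, t *\<^sub>R eu))))"
  obtain h' where h': "C1_with (\<lambda>v. h (proj v)) h'" using C1_h by (auto simp: C1_def)
  define D where "D = (\<lambda>t. 1 + h' (v + (0, 0, t *\<^sub>R eu)) (0, 0, eu))"
  have line: "((\<lambda>t::real. v + (0, 0, t *\<^sub>R eu)) has_derivative (\<lambda>s. (0, 0, s *\<^sub>R eu))) (at t)" for t
  proof -
    have "((\<lambda>t::real. v + ((0::real\<times>real), (0::real), t *\<^sub>R eu)) has_derivative (\<lambda>s. 0 + (0, 0, s *\<^sub>R eu))) (at t)"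
      by (intro has_derivative_add has_derivative_const has_derivative_Pair has_derivative_scaleR_left has_derivative_ident)
    then show ?thesis by simp
  qed
  have dk: "(k has_real_derivative D t) (at t)" for t
  proof -
    have "((\<lambda>t. h (proj (v + (0, 0, t *\<^sub>R eu)))) has_derivative
        (\<lambda>s. h' (v + (0, 0, t *\<^sub>R eu)) (0, 0, s *\<^sub>R eu))) (at t)"
      by (rule has_derivative_compose[OF line C1_with_deriv[OF h']])
    moreover have "h' (v + (0, 0, t *\<^sub>R eu)) (0, 0, s *\<^sub>R eu) = h' (v + (0, 0, t *\<^sub>R eu)) (0, 0, eu) * s" for s
      using linear_scale[OF bounded_linear.linear[OF C1_with_linear[OF h']], of _ s "(0, 0, eu)"] by simp
    ultimately have "((\<lambda>t. h (proj (v + (0, 0, t *\<^sub>R eu)))) has_real_derivative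
        h' (v + (0, 0, t *\<^sub>R eu)) (0, 0, eu)) (at t)"
      by (simp add: has_field_derivative_def)
    then show ?thesis unfolding k_def D_def by (intro DERIV_add DERIV_ident)
  qed
  have "F' (v + (0, 0, t *\<^sub>R eu)) (0, 0, eu) = (0, 0, (\<sigma>\<^sub>0 * D t) *\<^sub>R eu)" for t
  proof -
    have d1: "((\<lambda>t. F (v + (0, 0, t *\<^sub>R eu))) has_derivative
        (\<lambda>s. F' (v + (0, 0, t *\<^sub>R eu)) (0, 0, s *\<^sub>R eu))) (at t)"
      by (rule has_derivative_compose[OF line C1_with_deriv[OF C1_F]])
    have Feq: "(\<lambda>t. F (v + (0, 0, t *\<^sub>R eu))) = (\<lambda>t. (fst (F v), fst (snd (F v)),
        Lz (snd (snd v)) + (\<sigma>\<^sub>0 * k t) *\<^sub>R eu))"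
      unfolding k_def by (intro ext F_eu_line)
    have d2: "((\<lambda>t. F (v + (0, 0, t *\<^sub>R eu))) has_derivative (\<lambda>s. (0, 0, 0 + (\<sigma>\<^sub>0 * (D t * s)) *\<^sub>R eu))) (at t)"
      unfolding Feq using dk[of t] unfolding has_field_derivative_def
      by (intro has_derivative_Pair has_derivative_const has_derivative_add has_derivative_scaleR_left has_derivative_mult_right)
    from fun_cong[OF has_derivative_unique[OF d1 d2], of 1] show ?thesis by simp
  qed
  with dk show ?thesis unfolding k_def using that by blast
qed

lemma norm_DF_eu: "\<exists>l. DF n v (0, 0, eu) = (0, 0, l *\<^sub>R eu) \<and> \<bar>l\<bar> \<le> \<sigma>\<^sub>1 ^ n"
proof (induction n)
  case 0
  show ?case by (rule exI[of _ 1]) simp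
next
  case (Suc n)
  then obtain l where l: "DF n v (0, 0, eu) = (0, 0, l *\<^sub>R eu)" "\<bar>l\<bar> \<le> \<sigma>\<^sub>1 ^ n" by blast
  define u where "u = (F ^^ n) v"
  obtain D where D: "\<And>t. ((\<lambda>t. t + h (proj (u + (0, 0, t *\<^sub>R eu)))) has_real_derivative D t) (at t)"
    "\<And>t. F' (u + (0, 0, t *\<^sub>R eu)) (0, 0, eu) = (0, 0, (\<sigma>\<^sub>0 * D t) *\<^sub>R eu)"
    using F'_eu[of u] by blast
  have "DF (Suc n) v (0, 0, eu) = F' u (l *\<^sub>R (0, 0, eu))" by (simp add: l(1) u_def)
  also have "\<dots> = l *\<^sub>R F' u (0, 0, eu)" by (rule linear_scale[OF linear_F'])
  also have "\<dots> = (0, 0, (l * (\<sigma>\<^sub>0 * D 0)) *\<^sub>R eu)" using D(2)[of 0] by (simp flip: zero_prod_def)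
  finally have "DF (Suc n) v (0, 0, eu) = (0, 0, (l * (\<sigma>\<^sub>0 * D 0)) *\<^sub>R eu)" .
  moreover have "\<bar>l * (\<sigma>\<^sub>0 * D 0)\<bar> \<le> \<sigma>\<^sub>1 ^ n * \<sigma>\<^sub>1"
    unfolding abs_mult[of l] using l(2) slope[OF D(1)] rates by (intro mult_mono) auto
  ultimately show ?case by (intro exI[of _ "l * (\<sigma>\<^sub>0 * D 0)"]) (simp add: mult.commute)
qed

text \<open>A nonzero component of \<open>w\<close> that grows at least as fast as the image of \<open>eu\<close> would contradict
  the domination of \<open>Ecs\<close> by the line field of \<open>eu\<close>.\<close>

lemma Ecs_component_zero:
  assumes w: "w \<in> Ecs (proj v)"
    and grow: "\<And>n. norm (DF n v (0, 0, eu)) \<le> r ^ n" "\<And>n. r ^ n * a \<le> norm (DF n v w)"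
    and r: "r > 0"
  shows "a \<le> 0"
proof (cases "w = 0")
  case True
  then show ?thesis using grow(2)[of 0] by simp
next
  case False
  obtain c \<sigma> where c: "\<sigma> \<ge> 0" "\<sigma> < 1"
    "\<And>m w n. w \<in> Ecs m \<Longrightarrow> w \<noteq> 0 \<Longrightarrow> n \<ge> 1 \<Longrightarrow>
        norm (tderiv (f ^^ n) m w) / norm (tderiv (f ^^ n) m (0, 0, eu)) \<le> c * \<sigma> ^ n * norm w"
    using Ecs_dominated by blast
  \<comment> \<open>Dividing the two growth bounds cancels \<open>r ^ n\<close>; the right side then
    tends to 0.\<close>
  have "a \<le> c * \<sigma> ^ n * norm w" if n: "n \<ge> 1" for n
  proof (rule ccontr)
    assume *: "\<not> a \<le> c * \<sigma> ^ n * norm w"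
    have "(0, 0, eu) \<noteq> (0::R5)" using norm_eu by (auto simp: zero_prod_def)
    then have "DF n v (0, 0, eu) \<noteq> DF n v 0" using bij_DF[of n v] by (metis bij_is_inj injD)
    then have pos: "norm (DF n v (0, 0, eu)) > 0" by (simp add: linear_0[OF linear_DF])
    have le: "norm (DF n v w) \<le> c * \<sigma> ^ n * norm w * norm (DF n v (0, 0, eu))"
      using c(3)[OF w False n] pos by (simp add: tderiv_iterate divide_le_eq)
    show False
    proof (cases "a \<le> 0")
      case True
      then have "c * \<sigma> ^ n * norm w < 0" using * by linarith
      then have "c * \<sigma> ^ n * norm w * norm (DF n v (0, 0, eu)) < 0" using pos by (rule mult_neg_pos)
      then show False using le norm_ge_zero[of "DF n v w"] by linarith
    next
      case False
      have "r ^ n * a \<le> c * \<sigma> ^ n * norm w * norm (DF n v (0, 0, eu))" using grow(2)[of n] le by linarith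
      also have "\<dots> < a * norm (DF n v (0, 0, eu))" using * pos by (intro mult_strict_right_mono) auto
      also have "\<dots> \<le> a * r ^ n" using grow(1)[of n] False by (intro mult_left_mono) auto
      finally show False by simp
    qed
  qed
  moreover have "(\<lambda>n. c * \<sigma> ^ n * norm w) \<longlonglongrightarrow> c * 0 * norm w"
    using c by (intro tendsto_intros LIMSEQ_power_zero) auto
  ultimately show ?thesis by (intro LIMSEQ_le_const[of _ 0]) auto
qed

text \<open>The unstable coordinate in the first torus is multiplied by exactly
  \<open>\<sigma>\<^sub>1 ^ n\<close>, while the image of \<open>eu\<close> has norm at most
  that.\<close>

lemma Ecs_eu_x: "w \<in> Ecs m \<Longrightarrow> fst w \<bullet> eu = 0"
proof -
  assume w: "w \<in> Ecs m"
  obtain v where m: "m = proj v" using proj.pr_surj by blast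
  have "\<bar>fst w \<bullet> eu\<bar> \<le> 0"
  proof (rule Ecs_component_zero[OF w[unfolded m], of \<sigma>\<^sub>1])
    fix n
    show "norm (DF n v (0, 0, eu)) \<le> \<sigma>\<^sub>1 ^ n"
      using norm_DF_eu[of n v] norm_eu by (auto simp: norm_Pair)
    have "\<sigma>\<^sub>1 ^ n * \<bar>fst w \<bullet> eu\<bar> = \<bar>fst (DF n v w) \<bullet> eu\<bar>"
      using rates by (simp add: DF_fst abs_mult)
    also have "\<dots> \<le> norm (fst (DF n v w)) * norm eu" by (rule Cauchy_Schwarz_ineq2)
    also have "\<dots> \<le> norm (DF n v w)" using norm_eu norm_fst_le[of "fst (DF n v w)" "snd (DF n v w)"] by simp
    finally show "\<sigma>\<^sub>1 ^ n * \<bar>fst w \<bullet> eu\<bar> \<le> norm (DF n v w)" .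
  qed (use rates in auto)
  then show ?thesis by simp
qed

text \<open>Two equal values would enclose a critical point, at which \<open>F'\<close> kills
  \<open>(0, 0, eu)\<close>; but the derivative is invertible.\<close>

lemma inj_eu_line: "inj (\<lambda>t. t + h (proj (v + (0, 0, t *\<^sub>R eu))))"
proof (rule ccontr)
  define k where "k = (\<lambda>t. t + h (proj (v + (0, 0, t *\<^sub>R eu))))"
  obtain D where D: "\<And>t. (k has_real_derivative D t) (at t)"
    "\<And>t. F' (v + (0, 0, t *\<^sub>R eu)) (0, 0, eu) = (0, 0, (\<sigma>\<^sub>0 * D t) *\<^sub>R eu)"
    unfolding k_def using F'_eu[of v] by blast
  assume "\<not> inj (\<lambda>t. t + h (proj (v + (0, 0, t *\<^sub>R eu))))"
  then obtain a b where ab: "a < b" "k a = k b"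
    unfolding k_def[symmetric] inj_def by (metis linorder_neqE_linordered_idom)
  have "\<exists>t. a < t \<and> t < b \<and> D t = 0"
  proof -
    have "\<exists>t>a. t < b \<and> (\<lambda>x. D t * x) = (\<lambda>v. 0)"
      by (rule Rolle_deriv[OF ab(1), of k])
        (use D(1) ab(2) in \<open>auto intro!: DERIV_continuous_on simp: has_field_derivative_def[symmetric] intro: DERIV_subset\<close>)
    then show ?thesis by (metis mult.right_neutral)
  qed
  then obtain t where "D t = 0" by blast
  then have "F' (v + (0, 0, t *\<^sub>R eu)) (0, 0, eu) = F' (v + (0, 0, t *\<^sub>R eu)) 0"
    using D(2)[of t] by (simp add: linear_0[OF linear_F'] flip: zero_prod_def)
  then have "(0, 0, eu) = (0::R5)" using bij_F' by (metis bij_is_inj injD)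
  then show False using norm_eu by (auto simp: zero_prod_def)
qed

lemma surj_eu_line: "\<exists>t. t + h (proj (v + (0, 0, t *\<^sub>R eu))) = s"
proof -
  define k where "k = (\<lambda>t. t + h (proj (v + (0, 0, t *\<^sub>R eu))))"
  obtain M where M': "\<And>m. \<bar>h m\<bar> \<le> M" using h_bound by blast
  have M: "-M \<le> h m" "h m \<le> M" for m using M'[of m] by auto
  have cont: "continuous_on UNIV k"
    unfolding k_def by (intro continuous_intros continuous_on_compose2[OF C1_continuous[OF C1_h, of UNIV]]) auto
  have "\<exists>t. s - M \<le> t \<and> t \<le> s + M \<and> k t = s"
  proof (rule IVT')
    show "k (s - M) \<le> s" using M(2)[of "proj (v + (0, 0, (s - M) *\<^sub>R eu))"] unfolding k_def by linarith
    show "s \<le> k (s + M)" using M(1)[of "proj (v + (0, 0, (s + M) *\<^sub>R eu))"] unfolding k_def by linarith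
    show "s - M \<le> s + M" using M'[of 0] by linarith
    show "continuous_on {s - M..s + M} k" using cont continuous_on_subset by blast
  qed
  then show ?thesis unfolding k_def by blast
qed

lemma bij_g2: "bij (g2 x)"
  unfolding bij_def
proof
  obtain v where v: "x = tproj v" using tproj.pr_surj by blast
  have shift: "G v (t + of_int n * 2) = G v t + of_int n * 2" for t n
    by (rule shift_by_periods) (rule G_periodic)
  have per: "a - b \<in> periods TYPE(2) \<longleftrightarrow> (\<exists>n::int. a = b + of_int n * 2)" for a b :: real
    unfolding periods_def by (auto simp: image_iff algebra_simps)
  show "inj (g2 x)"
  proof (rule injI)
    fix y y' assume eq: "g2 x y = g2 x y'"
    obtain t t' where t: "y = circ t" "y' = circ t'" using circ_surj by metis
    obtain n :: int where "G v t = G v t' + of_int n * 2"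
      using eq unfolding t v g2 circ_eq_iff per by blast
    then have "G v t = G v (t' + of_int n * 2)" by (simp add: shift)
    then have "t = t' + of_int n * 2" using G_mono[of v] strict_mono_eq by blast
    then show "y = y'" unfolding t circ_eq_iff per by blast
  qed
  have cont: "continuous_on UNIV (G v)"
    using continuous_on_compose2[OF C1_continuous[OF C1_G, of UNIV], of UNIV "Pair v"]
      continuous_on_Pair[OF continuous_on_const[of UNIV v] continuous_on_id[of UNIV]] by auto
  show "surj (g2 x)"
  proof (rule surjI)
    fix y :: "2 circle"
    obtain s where s: "y = circ s" using circ_surj by blast
    \<comment> \<open>\<open>G v\<close> maps \<open>2 n\<close> to \<open>G v 0 + 2 n\<close>, so
      this floor selects a period interval whose image contains \<open>s\<close>.\<close>
    obtain n :: int where n: "of_int n * 2 \<le> s - G v 0" "s - G v 0 \<le> of_int (n + 1) * 2"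
      using floor_correct[of "(s - G v 0) / 2"] by (intro that[of "\<lfloor>(s - G v 0) / 2\<rfloor>"]) (auto simp: field_simps)
    have "\<exists>t. of_int n * 2 \<le> t \<and> t \<le> of_int (n + 1) * 2 \<and> G v t = s"
    proof (rule IVT')
      show "G v (of_int n * 2) \<le> s" "s \<le> G v (of_int (n + 1) * 2)"
        using shift[of 0 n] shift[of 0 "n + 1"] n by auto
      show "continuous_on {real_of_int n * 2..real_of_int (n + 1) * 2} (G v)"
        using cont continuous_on_subset by blast
    qed auto
    then obtain t where "G v t = s" by blast
    then have "g2 x (circ t) = y" by (simp add: v s g2)
    then show "g2 x (SOME u. g2 x u = y) = y" by (rule someI)
  qed
qed

text \<open>The first two coordinates are recovered one after the other. Equal images then place the
  last coordinates on one line in direction \<open>eu\<close>, where \<open>inj_eu_line\<close>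
  applies.\<close>

lemma inj_f: "inj f"
proof (rule injI)
  fix m m' assume eq: "f m = f m'"
  obtain x y z x' y' z' where m: "m = (x, y, z)" "m' = (x', y', z')" by (metis surj_pair)
  have x: "x' = x" using eq fx(1) by (simp add: m f bij_is_inj inj_eq)
  have y: "y' = y" using eq bij_g2[of x] by (simp add: m f x bij_is_inj inj_eq)
  have z: "z + tproj (h (x, y, z) *\<^sub>R eu) = z' + tproj (h (x, y, z') *\<^sub>R eu)"
    using eq fz(1) by (simp add: m f x y bij_is_inj inj_eq)
  obtain v where v: "(x, y, z) = proj v" using proj.pr_surj by blast
  obtain u t w where uw: "v = (u, t, w)" by (metis surj_pair)
  define s where "s = h (x, y, z) - h (x, y, z')"
  have z': "z' = z + tproj (s *\<^sub>R eu)"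
    using z by (simp add: s_def scaleR_diff_left tproj.pr_diff algebra_simps)
  have m': "proj (v + (0, 0, s *\<^sub>R eu)) = (x, y, z')"
    using v by (simp add: uw z' tproj.pr_add)
  have "(\<lambda>t. t + h (proj (v + (0, 0, t *\<^sub>R eu)))) s = (\<lambda>t. t + h (proj (v + (0, 0, t *\<^sub>R eu)))) 0"
    using m' v by (simp add: s_def flip: zero_prod_def)
  then have "s = 0" using inj_eu_line[of v] by (metis (no_types, lifting) injD)
  then show "m = m'" using z' by (simp add: m x y)
qed

lemma surj_f: "surj f"
proof -
  have "\<exists>m. f m = (x', y', z')" for x' y' z'
  proof -
    obtain x where x: "fx x = x'" using fx(1) by (metis bij_pointE)
    obtain y where y: "g2 x y = y'" using bij_g2[of x] by (metis bij_pointE)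
    obtain z0 where z0: "fz z0 = z'" using fz(1) by (metis bij_pointE)
    obtain v where v: "(x, y, z0) = proj v" using proj.pr_surj by blast
    obtain u t w where uw: "v = (u, t, w)" by (metis surj_pair)
    \<comment> \<open>The preimage is sought on the line through \<open>z0\<close>: \<open>s\<close>
      is the displacement that the push undoes.\<close>
    obtain s where s: "s + h (proj (v + (0, 0, s *\<^sub>R eu))) = 0" using surj_eu_line by blast
    have m: "proj (v + (0, 0, s *\<^sub>R eu)) = (x, y, z0 + tproj (s *\<^sub>R eu))"
      using v by (simp add: uw tproj.pr_add)
    have "f (x, y, z0 + tproj (s *\<^sub>R eu)) = (x', y', z')"
      using s by (simp add: f x y z0 m add.assoc flip: tproj.pr_add scaleR_add_left)
    then show ?thesis by blast
  qed
  then show ?thesis unfolding surj_def by (metis prod_cases3)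
qed

end

section \<open>Sinks of the base dynamics\<close>

lemma iterate_tendsto_0:
  fixes \<phi> :: "real \<Rightarrow> real"
  assumes cont: "continuous_on UNIV \<phi>" and 0: "\<phi> 0 = 0"
    and contr: "\<And>t. 0 < t \<Longrightarrow> t < 1 \<Longrightarrow> 0 < \<phi> t \<and> \<phi> t < t"
    and t: "0 \<le> t" "t < 1"
  shows "(\<lambda>n. (\<phi> ^^ n) t) \<longlonglongrightarrow> 0"
proof -
  have step: "0 \<le> \<phi> s \<and> \<phi> s \<le> s" if "0 \<le> s" "s < 1" for s
    using contr[of s] 0 that by (cases "s = 0") auto
  have bd: "0 \<le> (\<phi> ^^ n) t \<and> (\<phi> ^^ n) t \<le> t" for n
  proof (induction n)
    case (Suc n)
    then show ?case using step[of "(\<phi> ^^ n) t"] t by auto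
  qed (use t in simp)
  have dec: "decseq (\<lambda>n. (\<phi> ^^ n) t)"
  proof (rule decseq_SucI)
    fix n show "(\<phi> ^^ Suc n) t \<le> (\<phi> ^^ n) t" using step[of "(\<phi> ^^ n) t"] bd[of n] t by auto
  qed
  obtain L where L: "(\<lambda>n. (\<phi> ^^ n) t) \<longlonglongrightarrow> L"
    using decseq_convergent[OF dec, of 0] bd by blast
  have "0 \<le> L" "L \<le> t"
    using LIMSEQ_le_const[OF L, of 0] LIMSEQ_le_const2[OF L, of t] bd by auto
  have "(\<lambda>n. \<phi> ((\<phi> ^^ n) t)) \<longlonglongrightarrow> \<phi> L"
    by (rule continuous_on_tendsto_compose[OF cont L]) auto
  moreover have "(\<lambda>n. \<phi> ((\<phi> ^^ n) t)) \<longlonglongrightarrow> L"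
    using LIMSEQ_Suc[OF L] by simp
  ultimately have "\<phi> L = L" by (rule LIMSEQ_unique)
  then have "L = 0" using contr[of L] \<open>0 \<le> L\<close> \<open>L \<le> t\<close> t by fastforce
  then show ?thesis using L by simp
qed

lemma circ_rep: "\<exists>t. -1 \<le> t \<and> t < 1 \<and> y = (circ (y0 + t) :: 2 circle)"
proof -
  obtain s where s: "y = circ s" using circ_surj by blast
  define n where "n = \<lfloor>(s - y0 + 1) / 2\<rfloor>"
  have "of_int n \<le> (s - y0 + 1) / 2" "(s - y0 + 1) / 2 < of_int n + 1"
    unfolding n_def by linarith+
  then have "-1 \<le> s - y0 - of_int n * 2" "s - y0 - of_int n * 2 < 1" by auto
  moreover have "y = circ (y0 + (s - y0 - of_int n * 2))"
    unfolding s circ_eq_iff periods_def by (auto intro: image_eqI[of _ _ n])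
  ultimately show ?thesis by blast
qed

text \<open>Both points of the skeleton are instances, with the circle coordinate measured from the
  attracting level \<open>y0\<close>, so that the repeller is \<open>y0 + 1\<close>. In
  \<open>dense_s\<close> the density of the stable leaf of \<open>q\<close> is expressed on the
  cover: the lines that project into the leaf have a dense set of parameters \<open>c\<close>, and
  \<open>x0\<close> fixes the origin of the leaf coordinate.\<close>

locale sink = skew_system +
  fixes q :: torus and y0 \<rho> :: real and \<phi> \<phi>' :: "real \<Rightarrow> real"
  assumes q_fixed: "fx q = q" "fz q = q" and \<rho>_pos: "0 < \<rho>"
    and near_G: "\<And>x t. dist (tproj x) q < \<rho> \<Longrightarrow> G x (y0 + t) = y0 + \<phi> t"
    and near_h: "\<And>x y z. dist x q < \<rho> \<Longrightarrow> h (x, y, z) = 0"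
    and g2_y0: "\<And>x. g2 x (circ y0) = circ y0" and g2_y1: "\<And>x. g2 x (circ (y0 + 1)) = circ (y0 + 1)"
    and \<phi>_0: "\<phi> 0 = 0" and \<phi>_deriv: "\<And>t. (\<phi> has_real_derivative \<phi>' t) (at t)"
    and \<phi>'_0: "0 < \<phi>' 0" "\<phi>' 0 < 1"
    and \<phi>_pos: "\<And>t. 0 < t \<Longrightarrow> t < 1 \<Longrightarrow> 0 < \<phi> t \<and> \<phi> t < t"
    and \<phi>_neg: "\<And>t. - 1 < t \<Longrightarrow> t < 0 \<Longrightarrow> t < \<phi> t \<and> \<phi> t < 0"
    and dense_u: "\<And>w \<epsilon>. 0 < \<epsilon> \<Longrightarrow> \<exists>a. dist (q + tproj (a *\<^sub>R eu)) w < \<epsilon>"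
    and dense_s: "\<And>\<alpha> \<epsilon>. 0 < \<epsilon> \<Longrightarrow> \<exists>c x0. \<bar>c - \<alpha>\<bar> < \<epsilon> \<and>
        (\<forall>x. x \<bullet> eu = c \<longrightarrow> tproj x = q + tproj (((x - x0) \<bullet> es) *\<^sub>R es))"
begin

abbreviation "p \<equiv> (q, circ y0 :: 2 circle, q)"

lemma \<phi>_tendsto_0: "\<bar>t\<bar> < 1 \<Longrightarrow> (\<lambda>n. (\<phi> ^^ n) t) \<longlonglongrightarrow> 0"
proof -
  assume t: "\<bar>t\<bar> < 1"
  have cont: "continuous_on UNIV \<phi>"
    using \<phi>_deriv DERIV_continuous_on by blast
  show ?thesis
  proof (cases "t \<ge> 0")
    case True
    show ?thesis by (rule iterate_tendsto_0[OF cont \<phi>_0 \<phi>_pos]) (use t True in auto)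
  next
    case False
    define \<xi> where "\<xi> = (\<lambda>t. - \<phi> (- t))"
    have "(\<lambda>n. (\<xi> ^^ n) (- t)) \<longlonglongrightarrow> 0"
    proof (rule iterate_tendsto_0)
      show "continuous_on UNIV \<xi>" unfolding \<xi>_def
        by (intro continuous_intros continuous_on_compose2[OF cont]) auto
      fix s :: real assume "0 < s" "s < 1"
      then show "0 < \<xi> s \<and> \<xi> s < s" using \<phi>_neg[of "- s"] by (auto simp: \<xi>_def)
    qed (use t False \<phi>_0 in \<open>auto simp: \<xi>_def\<close>)
    moreover have "(\<xi> ^^ n) (- t) = - (\<phi> ^^ n) t" for n
      by (induction n) (auto simp: \<xi>_def)
    ultimately show ?thesis using tendsto_minus_cancel_left[of "\<lambda>n. (\<phi> ^^ n) t" 0] by simp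
  qed
qed

lemma \<phi>_le: "\<bar>t\<bar> < 1 \<Longrightarrow> \<bar>\<phi> t\<bar> \<le> \<bar>t\<bar>"
  using \<phi>_pos[of t] \<phi>_neg[of t] \<phi>_0 by (cases t "0::real" rule: linorder_cases) auto

lemma fx_q: "fx (q + tproj v) = q + tproj (Lx v)"
  by (simp add: fx q_fixed)

lemma fz_q: "fz (q + tproj v) = q + tproj (Lz v)"
  by (simp add: fz q_fixed)

lemma dist_leaf_s: "\<bar>b\<bar> < \<rho> \<Longrightarrow> dist (q + tproj (b *\<^sub>R es)) q < \<rho>"
  using tproj.dist_pr_le[of q "b *\<^sub>R es" 0] norm_es by simp

lemma near_g2: "dist x q < \<rho> \<Longrightarrow> g2 x (circ (y0 + t)) = circ (y0 + \<phi> t)"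
  using tproj.pr_surj[of x] g2 near_G by metis

section \<open>Dynamics over the local stable leaf of \<open>q\<close>\<close>

lemma f_step:
  assumes "\<bar>b\<bar> < \<rho>"
  shows "f (q + tproj (b *\<^sub>R es), circ (y0 + t), q + tproj w)
     = (q + tproj ((\<tau>\<^sub>1 * b) *\<^sub>R es), circ (y0 + \<phi> t), q + tproj (Lz w))"
  using dist_leaf_s[OF assms]
  by (simp add: f near_h near_g2 fx_q fz_q linear_scale[OF Lx(1)] Lx mult.commute)

lemma f_p: "f p = p"
  using f_step[of 0 0 0] \<rho>_pos by (simp add: \<phi>_0 linear_0[OF Lz(1)])

lemma inv_f_p: "inv f p = p"
  using f_p inv_f_f[OF inj_f, of p] by simp

lemma orb_p: "orb f p = {p}"
proof -
  have "(f ^^ n) p = p" "(inv f ^^ n) p = p" for n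
    by (induction n) (auto simp: f_p inv_f_p)
  then show ?thesis unfolding orb_def by auto
qed

lemma Ws_orb_p: "m \<in> Ws_orb p f \<longleftrightarrow> (\<lambda>n. dist ((f ^^ n) m) p) \<longlonglongrightarrow> 0"
  unfolding Ws_orb_def orb_p by (simp add: infdist_singleton)

lemma tau_power: "\<bar>b\<bar> < \<rho> \<Longrightarrow> \<bar>\<tau>\<^sub>1 ^ n * b\<bar> < \<rho>"
proof -
  assume b: "\<bar>b\<bar> < \<rho>"
  have "\<tau>\<^sub>1 ^ n \<le> 1" using rates by (simp add: power_le_one)
  then have "\<bar>\<tau>\<^sub>1 ^ n * b\<bar> \<le> \<bar>b\<bar>" using rates by (simp add: abs_mult mult_left_le_one_le)
  then show ?thesis using b by simp
qed

lemma f_iterate: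
  assumes "\<bar>b\<bar> < \<rho>"
  shows "(f ^^ n) (q + tproj (b *\<^sub>R es), circ (y0 + t), q + tproj (e *\<^sub>R es))
     = (q + tproj ((\<tau>\<^sub>1 ^ n * b) *\<^sub>R es), circ (y0 + (\<phi> ^^ n) t), q + tproj ((\<tau>\<^sub>0 ^ n * e) *\<^sub>R es))"
proof (induction n)
  case (Suc n)
  show ?case
    using f_step[OF tau_power[OF assms, of n], of "(\<phi> ^^ n) t" "(\<tau>\<^sub>0 ^ n * e) *\<^sub>R es"]
    by (simp add: Suc linear_scale[OF Lz(1)] Lz mult.commute mult.left_commute)
qed simp

lemma local_stable:
  assumes b: "\<bar>b\<bar> < \<rho>" and y: "y \<noteq> circ (y0 + 1)"
  shows "(q + tproj (b *\<^sub>R es), y, q + tproj (e *\<^sub>R es)) \<in> Ws_orb p f"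
proof -
  obtain t where t: "-1 \<le> t" "t < 1" "y = circ (y0 + t)" using circ_rep by blast
  \<comment> \<open>The end point -1 of the fundamental interval is the repeller modulo 2; without
    it the modulus of \<open>t\<close> is below 1.\<close>
  have "(circ (y0 + (-1)) :: 2 circle) = circ (y0 + 1)"
    unfolding circ_eq_iff periods_def by (auto intro: image_eqI[of _ _ "-1"])
  then have "t \<noteq> -1" using t(3) y by auto
  then have lim: "(\<lambda>n. (\<phi> ^^ n) t) \<longlonglongrightarrow> 0" using t by (intro \<phi>_tendsto_0) auto
  have "(\<lambda>n. q + tproj ((\<tau>\<^sub>1 ^ n * b) *\<^sub>R es)) \<longlonglongrightarrow> q + tproj ((0 * b) *\<^sub>R es)"
       "(\<lambda>n. q + tproj ((\<tau>\<^sub>0 ^ n * e) *\<^sub>R es)) \<longlonglongrightarrow> q + tproj ((0 * e) *\<^sub>R es)"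
    by (intro tproj.tendsto_pr tendsto_intros LIMSEQ_power_zero; use rates in simp)+
  moreover have "(\<lambda>n. circ y0 + circ ((\<phi> ^^ n) t) :: 2 circle) \<longlonglongrightarrow> circ y0 + circ 0"
    by (intro circ.tendsto_pr lim)
  ultimately have "(\<lambda>n. (f ^^ n) (q + tproj (b *\<^sub>R es), y, q + tproj (e *\<^sub>R es))) \<longlonglongrightarrow> p"
    unfolding t(3) f_iterate[OF b] by (auto simp: circ_add intro!: tendsto_Pair)
  then show ?thesis unfolding Ws_orb_p by (rule tendsto_dist_iff[THEN iffD1])
qed

lemma Ws_orb_iterate: "(f ^^ N) m \<in> Ws_orb p f \<Longrightarrow> m \<in> Ws_orb p f"
  unfolding Ws_orb_p by (rule LIMSEQ_offset[of _ N]) (simp add: funpow_add)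

lemma near_F':
  assumes "dist (tproj (fst v)) q < \<rho>"
  shows "F' v w = (Lx (fst w), \<phi>' (fst (snd v) - y0) * fst (snd w), Lz (snd (snd w)))"
proof -
  \<comment> \<open>On this open set \<open>F\<close> equals the product map \<open>K\<close> below,
    so their derivatives agree. The summand 0 matches the form of
    \<open>continuous_pr\<close>.\<close>
  define U :: "R5 set" where "U = {v. dist (0 + tproj (fst v)) q < \<rho>}"
  have "continuous_on UNIV (\<lambda>v::R5. 0 + tproj (fst v))"
    by (rule continuous_on_compose2[OF tproj.continuous_pr[of UNIV 0]]) (auto intro: continuous_intros)
  then have "open U" unfolding U_def by (intro open_Collect_less continuous_intros)
  have bl: "bounded_linear Lx" "bounded_linear Lz" using Lx(1) Lz(1) by (auto simp: linear_conv_bounded_linear)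
  define K where "K = (\<lambda>v::R5. (Lx (fst v), y0 + \<phi> (fst (snd v) - y0), Lz (snd (snd v))))"
  have d: "((\<lambda>v::R5. fst (snd v) - y0) has_derivative (\<lambda>w. fst (snd w))) (at v)"
    by (auto intro!: derivative_eq_intros)
  have "((\<lambda>v::R5. \<phi> (fst (snd v) - y0)) has_derivative (\<lambda>w. \<phi>' (fst (snd v) - y0) * fst (snd w))) (at v)"
    using has_derivative_compose[OF d, of \<phi> "\<lambda>s. \<phi>' (fst (snd v) - y0) * s"] \<phi>_deriv[of "fst (snd v) - y0"]
    by (simp add: has_field_derivative_def)
  then have "((\<lambda>v::R5. y0 + \<phi> (fst (snd v) - y0)) has_derivative (\<lambda>w. 0 + \<phi>' (fst (snd v) - y0) * fst (snd w))) (at v)"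
    by (intro has_derivative_add has_derivative_const)
  then have "(K has_derivative (\<lambda>w. (Lx (fst w), 0 + \<phi>' (fst (snd v) - y0) * fst (snd w), Lz (snd (snd w))))) (at v)"
    unfolding K_def
    by (intro has_derivative_Pair bounded_linear_imp_has_derivative bounded_linear_compose[OF bl(1)]
        bounded_linear_compose[OF bl(2)] bounded_linear_compose[OF bounded_linear_snd] bounded_linear_snd bounded_linear_fst)
  then have "(F has_derivative (\<lambda>w. (Lx (fst w), 0 + \<phi>' (fst (snd v) - y0) * fst (snd w), Lz (snd (snd w))))) (at v)"
  proof (rule has_derivative_transform_within_open[OF _ \<open>open U\<close>])
    show "v \<in> U" using assms by (simp add: U_def)
    fix u assume "u \<in> U"
    then have near: "dist (tproj (fst u)) q < \<rho>" by (simp add: U_def)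
    obtain x y z where u: "u = (x, y, z)" by (metis surj_pair)
    show "K u = F u" using near near_G[of x "y - y0"] by (simp add: u K_def F_def near_h)
  qed
  then show ?thesis using F'_unique by simp
qed

text \<open>The tangent space of the stable set of \<open>p\<close> along the local leaf: the stable
  line of each torus together with the circle direction.\<close>

definition T :: "R5 set" where
  "T = {t. fst t \<bullet> eu = 0 \<and> snd (snd t) \<bullet> eu = 0}"

lemma subspace_T: "subspace T"
  unfolding T_def subspace_def by (simp add: inner_add_left)

lemma near_iterate:
  assumes "tproj (fst v) = q + tproj (b *\<^sub>R es)" "\<bar>b\<bar> < \<rho>"
  shows "dist (tproj (fst ((F ^^ n) v))) q < \<rho>"
proof -
  have "tproj (fst ((F ^^ n) v)) = q + tproj ((\<tau>\<^sub>1 ^ n * b) *\<^sub>R es)"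
  proof (induction n)
    case (Suc n)
    have "tproj (fst ((F ^^ Suc n) v)) = fx (tproj (fst ((F ^^ n) v)))" by (simp add: F_def fx)
    then show ?case by (simp add: Suc fx_q linear_scale[OF Lx(1)] Lx mult.commute mult.left_commute)
  qed (use assms in simp)
  then show ?thesis using dist_leaf_s tau_power[OF assms(2)] by metis
qed

text \<open>The forward orbit stays where \<open>h\<close> vanishes. So the image of
  \<open>eu\<close> and the unstable coordinate of the last torus both grow by exactly
  \<open>\<sigma>\<^sub>0 ^ n\<close>, and a nonzero coordinate contradicts domination.\<close>

lemma Ecs_near:
  assumes "\<bar>b\<bar> < \<rho>" "w \<in> Ecs (q + tproj (b *\<^sub>R es), y, z)"
  shows "w \<in> T"
proof -
  obtain v where v: "(q + tproj (b *\<^sub>R es), y, z) = proj v" using proj.pr_surj by blast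
  then have "tproj (fst v) = q + tproj (b *\<^sub>R es)" by (cases v) auto
  note near = near_F'[OF near_iterate[OF this assms(1)]]
  have comp: "snd (snd (DF n v w)) \<bullet> eu = \<sigma>\<^sub>0 ^ n * (snd (snd w) \<bullet> eu)" for n w
    by (induction n) (auto simp: near Lz_inner)
  have eu: "DF n v (0, 0, eu) = (0, 0, \<sigma>\<^sub>0 ^ n *\<^sub>R eu)" for n
    by (induction n) (auto simp: near linear_0[OF Lx(1)] linear_scale[OF Lz(1)] Lz mult.commute)
  have "\<bar>snd (snd w) \<bullet> eu\<bar> \<le> 0"
  proof (rule Ecs_component_zero[OF assms(2)[unfolded v], of \<sigma>\<^sub>0])
    fix n
    show "norm (DF n v (0, 0, eu)) \<le> \<sigma>\<^sub>0 ^ n"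
      using rates norm_eu by (simp add: eu norm_Pair)
    have "\<sigma>\<^sub>0 ^ n * \<bar>snd (snd w) \<bullet> eu\<bar> = \<bar>snd (snd (DF n v w)) \<bullet> eu\<bar>"
      using rates by (simp add: comp abs_mult)
    also have "\<dots> \<le> norm (snd (snd (DF n v w))) * norm eu" by (rule Cauchy_Schwarz_ineq2)
    also have "\<dots> \<le> norm (snd (DF n v w))"
      using norm_eu norm_snd_le[of "snd (snd (DF n v w))" "fst (snd (DF n v w))"] by simp
    also have "\<dots> \<le> norm (DF n v w)"
      using norm_snd_le[of "snd (DF n v w)" "fst (DF n v w)"] by simp
    finally show "\<sigma>\<^sub>0 ^ n * \<bar>snd (snd w) \<bullet> eu\<bar> \<le> norm (DF n v w)" .
  qed (use rates in auto)
  then show ?thesis using Ecs_eu_x[OF assms(2)] by (simp add: T_def)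
qed

text \<open>A spanning set gives the upper bound; the lower bound comes from the three-dimensional
  \<open>Ecs\<close> at \<open>p\<close>, which lies in \<open>T\<close>, so no independence has to
  be checked.\<close>

lemma dim_T: "dim T = 3"
proof -
  let ?B = "{(es, 0, 0), (0, 1, 0), (0, 0, es)} :: R5 set"
  have "T \<subseteq> span ?B"
  proof
    fix t assume t: "t \<in> T"
    obtain x y z where xyz: "t = (x, y, z)" by (metis surj_pair)
    have "x = (x \<bullet> es) *\<^sub>R es" "z = (z \<bullet> es) *\<^sub>R es"
      using t by (auto simp: T_def xyz intro: eq_scale_es)
    then have "t = (x \<bullet> es) *\<^sub>R (es, 0, 0) + y *\<^sub>R (0, 1, 0) + (z \<bullet> es) *\<^sub>R (0, 0, es)"
      by (simp add: xyz)
    also have "\<dots> \<in> span ?B" by (intro span_add span_scale span_base) auto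
    finally show "t \<in> span ?B" .
  qed
  then have "dim T \<le> card ?B" by (intro dim_le_card) auto
  also have "\<dots> \<le> 3" by (simp add: card_insert_if)
  finally have "dim T \<le> 3" .
  moreover have "dim (Ecs (q, circ y0, q)) \<le> dim T"
    using Ecs_near[of 0 _ "circ y0" q] \<rho>_pos by (intro dim_subset) auto
  ultimately show ?thesis by (simp add: dim_Ecs)
qed

section \<open>Hyperbolicity and stable index of the fixed point\<close>

definition R :: "R5 \<Rightarrow> R5" where
  "R w = (Lx (fst w), \<phi>' 0 * fst (snd w), Lz (snd (snd w)))"

lemma return_deriv_p: "return_deriv f p = R"
proof -
  have "(LEAST n. 0 < n \<and> (f ^^ n) p = p) = 1"
    by (rule Least_equality) (auto simp: f_p)
  then have "return_deriv f p = tderiv f p" unfolding return_deriv_def by simp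
  also have "\<dots> = R"
  proof
    fix w
    obtain x where x: "q = tproj x" using tproj.pr_surj by blast
    have "tderiv f p = F' (x, y0, x)" using tderiv_f[of "(x, y0, x)"] by (simp add: x)
    then show "tderiv f p w = R w" using near_F'[of "(x, y0, x)" w] \<rho>_pos by (simp add: x R_def)
  qed
  finally show ?thesis .
qed

lemma R_components:
  "fst (R w) \<bullet> eu = \<sigma>\<^sub>1 * (fst w \<bullet> eu)" "fst (R w) \<bullet> es = \<tau>\<^sub>1 * (fst w \<bullet> es)"
  "fst (snd (R w)) = \<phi>' 0 * fst (snd w)"
  "snd (snd (R w)) \<bullet> eu = \<sigma>\<^sub>0 * (snd (snd w) \<bullet> eu)" "snd (snd (R w)) \<bullet> es = \<tau>\<^sub>0 * (snd (snd w) \<bullet> es)"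
  by (simp_all add: R_def Lx_inner Lz_inner)

lemma R_eq_0:
  "fst w \<bullet> eu = 0 \<Longrightarrow> fst w \<bullet> es = 0 \<Longrightarrow> fst (snd w) = 0 \<Longrightarrow> snd (snd w) \<bullet> eu = 0 \<Longrightarrow>
   snd (snd w) \<bullet> es = 0 \<Longrightarrow> w = 0"
  using plane_eqI[of "fst w" 0] plane_eqI[of "snd (snd w)" 0] by (simp add: prod_eq_iff)

text \<open>In coordinates along \<open>eu\<close>, \<open>es\<close> and the circle,
  \<open>R\<close> is diagonal with five real factors, none of modulus 1. An eigenvector
  \<open>v + i w\<close> for an eigenvalue on the unit circle therefore vanishes coordinate by
  coordinate.\<close>

lemma hyperbolic_p: "hyperbolic_periodic f p"
proof -
  have real_eigenvalue: "cmod z \<noteq> 1"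
    if "l * a = Re z * a - Im z * b" "l * b = Im z * a + Re z * b" "a \<noteq> 0 \<or> b \<noteq> 0" "\<bar>l\<bar> \<noteq> 1" for l a b z
  proof -
    \<comment> \<open>Multiply the first equation by \<open>b\<close>, the second by
      \<open>a\<close>, and subtract.\<close>
    have "Im z * (a * a + b * b) = 0" using that(1,2) by algebra
    moreover have "a * a + b * b \<noteq> 0" using that(3) by (simp add: sum_squares_eq_zero_iff)
    ultimately have im: "Im z = 0" by (metis mult_eq_0_iff)
    then have "Re z = l" using that(1-3) by auto
    then show ?thesis using that(4) im by (simp add: cmod_def)
  qed
  have "cmod z \<noteq> 1" if z: "complex_eigenvalue R z" for z
  proof -
    obtain v w where vw: "(v, w) \<noteq> (0, 0)" "R v = Re z *\<^sub>R v - Im z *\<^sub>R w" "R w = Im z *\<^sub>R v + Re z *\<^sub>R w"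
      using z unfolding complex_eigenvalue_def by blast
    show ?thesis
    proof (rule ccontr)
      assume c: "\<not> cmod z \<noteq> 1"
      have both: "a = 0 \<and> b = 0" if "l * a = Re z * a - Im z * b" "l * b = Im z * a + Re z * b" "\<bar>l\<bar> \<noteq> 1" for l a b
        using real_eigenvalue[of l a z b] that c by blast
      have "fst v \<bullet> eu = 0 \<and> fst w \<bullet> eu = 0"
        by (rule both[of \<sigma>\<^sub>1]) (use rates in \<open>auto simp: R_components(1)[symmetric] vw inner_diff_left inner_add_left\<close>)
      moreover have "fst v \<bullet> es = 0 \<and> fst w \<bullet> es = 0"
        by (rule both[of \<tau>\<^sub>1]) (use rates in \<open>auto simp: R_components(2)[symmetric] vw inner_diff_left inner_add_left\<close>)
      moreover have "fst (snd v) = 0 \<and> fst (snd w) = 0"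
        by (rule both[of "\<phi>' 0"]) (use \<phi>'_0 in \<open>auto simp: R_components(3)[symmetric] vw\<close>)
      moreover have "snd (snd v) \<bullet> eu = 0 \<and> snd (snd w) \<bullet> eu = 0"
        by (rule both[of \<sigma>\<^sub>0]) (use rates in \<open>auto simp: R_components(4)[symmetric] vw inner_diff_left inner_add_left\<close>)
      moreover have "snd (snd v) \<bullet> es = 0 \<and> snd (snd w) \<bullet> es = 0"
        by (rule both[of \<tau>\<^sub>0]) (use rates in \<open>auto simp: R_components(5)[symmetric] vw inner_diff_left inner_add_left\<close>)
      ultimately have "v = 0 \<and> w = 0" using R_eq_0 by blast
      then show False using vw(1) by simp
    qed
  qed
  moreover have "periodic f p" unfolding periodic_def by (rule exI[of _ 1]) (simp add: f_p)
  ultimately show ?thesis unfolding hyperbolic_periodic_def return_deriv_p by blast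
qed

lemma power_mult_tendsto_0:
  assumes "1 < (s::real)" "(\<lambda>n. s ^ n * a) \<longlonglongrightarrow> 0"
  shows "a = 0"
proof -
  have "\<bar>a\<bar> \<le> \<bar>s ^ n * a\<bar>" for n
    using assms(1) mult_right_mono[of 1 "s ^ n" "\<bar>a\<bar>"] by (simp add: abs_mult one_le_power)
  moreover have "(\<lambda>n. \<bar>s ^ n * a\<bar>) \<longlonglongrightarrow> 0" using assms(2) tendsto_rabs_zero by blast
  ultimately have "\<bar>a\<bar> \<le> 0" by (intro LIMSEQ_le_const[of _ 0]) auto
  then show ?thesis by simp
qed

lemma stable_index_p: "stable_index f p = dim (Ecs p)"
proof -
  have comp: "fst ((R ^^ n) w) \<bullet> eu = \<sigma>\<^sub>1 ^ n * (fst w \<bullet> eu)"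
    "fst ((R ^^ n) w) \<bullet> es = \<tau>\<^sub>1 ^ n * (fst w \<bullet> es)"
    "fst (snd ((R ^^ n) w)) = \<phi>' 0 ^ n * fst (snd w)"
    "snd (snd ((R ^^ n) w)) \<bullet> eu = \<sigma>\<^sub>0 ^ n * (snd (snd w) \<bullet> eu)"
    "snd (snd ((R ^^ n) w)) \<bullet> es = \<tau>\<^sub>0 ^ n * (snd (snd w) \<bullet> es)" for n w
    by (induction n) (auto simp: R_components)
  have "(\<lambda>n. (R ^^ n) w) \<longlonglongrightarrow> 0 \<longleftrightarrow> w \<in> T" for w
  proof
    assume lim: "(\<lambda>n. (R ^^ n) w) \<longlonglongrightarrow> 0"
    have "(\<lambda>n. fst ((R ^^ n) w) \<bullet> eu) \<longlonglongrightarrow> fst (0::R5) \<bullet> eu"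
      by (intro tendsto_intros tendsto_fst lim)
    then have 1: "fst w \<bullet> eu = 0" using rates by (intro power_mult_tendsto_0[of \<sigma>\<^sub>1]) (simp_all add: comp)
    have "(\<lambda>n. snd (snd ((R ^^ n) w)) \<bullet> eu) \<longlonglongrightarrow> snd (snd (0::R5)) \<bullet> eu"
      by (intro tendsto_intros tendsto_snd lim)
    then have "snd (snd w) \<bullet> eu = 0" using rates by (intro power_mult_tendsto_0[of \<sigma>\<^sub>0]) (simp_all add: comp)
    with 1 show "w \<in> T" by (simp add: T_def)
  next
    assume w: "w \<in> T"
    have "(R ^^ n) w = ((\<tau>\<^sub>1 ^ n * (fst w \<bullet> es)) *\<^sub>R es, \<phi>' 0 ^ n * fst (snd w), (\<tau>\<^sub>0 ^ n * (snd (snd w) \<bullet> es)) *\<^sub>R es)" for n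
      using eq_scale_es[of "fst ((R ^^ n) w)"] eq_scale_es[of "snd (snd ((R ^^ n) w))"] w
      by (simp add: comp T_def prod_eq_iff)
    moreover have "(\<lambda>n. ((\<tau>\<^sub>1 ^ n * (fst w \<bullet> es)) *\<^sub>R es, \<phi>' 0 ^ n * fst (snd w), (\<tau>\<^sub>0 ^ n * (snd (snd w) \<bullet> es)) *\<^sub>R es))
       \<longlonglongrightarrow> ((0 * (fst w \<bullet> es)) *\<^sub>R es, 0 * fst (snd w), (0 * (snd (snd w) \<bullet> es)) *\<^sub>R es)"
      by (intro tendsto_Pair tendsto_intros LIMSEQ_power_zero) (use rates \<phi>'_0 in auto)
    ultimately show "(\<lambda>n. (R ^^ n) w) \<longlonglongrightarrow> 0" by (simp add: zero_prod_def)
  qed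
  then have "stable_index f p = dim T" unfolding stable_index_def return_deriv_p by simp
  then show ?thesis by (simp add: dim_T dim_Ecs)
qed

section \<open>Invariant levels and the disjointness of stable and unstable sets\<close>

lemma iterate_fst_snd:
  assumes "\<And>x. g2 x c = c" "fst (snd m) = c"
  shows "fst (snd ((f ^^ n) m)) = c"
proof (induction n)
  case (Suc n)
  obtain x y z where "(f ^^ n) m = (x, y, z)" by (metis surj_pair)
  then show ?case using Suc assms(1) by (simp add: f)
qed (use assms in simp)

text \<open>An orbit in an invariant level keeps at least the distance of that level from
  \<open>circ y0\<close>. It will be applied to the level of the other skeleton point.\<close>

lemma Ws_orb_fst_snd:
  assumes "\<And>x. g2 x c = c" "m \<in> Ws_orb p f" "fst (snd m) = c"
  shows "c = circ y0"
proof -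
  have "dist c (circ y0) \<le> dist ((f ^^ n) m) p" for n
  proof -
    have "dist (fst (snd ((f ^^ n) m))) (fst (snd p)) \<le> dist ((f ^^ n) m) p"
      by (meson dist_fst_le dist_snd_le order_trans)
    then show ?thesis using iterate_fst_snd[OF assms(1,3), of n] by simp
  qed
  then have "dist c (circ y0) \<le> 0"
    using assms(2) unfolding Ws_orb_p by (intro LIMSEQ_le_const[of _ 0]) auto
  then show ?thesis by simp
qed

text \<open>Backward orbits cannot approach the attracting level \<open>y0\<close> without lying on it.\<close>

lemma Wu_orb_fst_snd:
  assumes "m \<in> Wu_orb p f"
  shows "fst (snd m) = circ y0"
proof -
  define b where "b = (\<lambda>n. (inv f ^^ n) m)"
  have fb: "f (b (Suc n)) = b n" for n
    unfolding b_def using surj_f by (simp add: surj_f_inv_f)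
  have "(\<lambda>n. dist (b n) p) \<longlonglongrightarrow> 0"
    using assms unfolding Wu_orb_def orb_p b_def by (simp add: infdist_singleton)
  then have lim: "b \<longlonglongrightarrow> p" by (simp add: tendsto_dist_iff[symmetric])
  define d where "d = (\<lambda>n. dist (fst (snd (b n))) (circ y0))"
  have dlim: "d \<longlonglongrightarrow> 0"
    using tendsto_dist[OF tendsto_fst[OF tendsto_snd[OF lim]] tendsto_const[of "circ y0"]] unfolding d_def by simp
  have "\<forall>\<^sub>F n in sequentially. dist (fst (b n)) q < \<rho>"
    using tendstoD[OF tendsto_fst[OF lim] \<rho>_pos] by simp
  moreover have "\<forall>\<^sub>F n in sequentially. d n < 1/2"
    using order_tendstoD(2)[OF dlim, of "1/2"] by simp
  ultimately have "\<forall>\<^sub>F n in sequentially. dist (fst (b n)) q < \<rho> \<and> d n < 1/2"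
    by eventually_elim auto
  then obtain N where N: "\<And>n. n \<ge> N \<Longrightarrow> dist (fst (b n)) q < \<rho> \<and> d n < 1/2"
    unfolding eventually_sequentially by blast
  \<comment> \<open>\<open>b n\<close> is the image of \<open>b (Suc n)\<close>, and \<phi> does not
    increase the distance to the level, so this distance cannot drop along the backward orbit. Since
    it tends to 0, it is 0 at \<open>N\<close>. The bound 1/2 makes circle distances equal to moduli
    of lifts.\<close>
  have mono: "d n \<le> d (Suc n)" if n: "n \<ge> N" for n
  proof -
    obtain x y z where xyz: "b (Suc n) = (x, y, z)" by (metis surj_pair)
    obtain t where t: "y = circ y0 + circ t" "norm t = dist y (circ y0)" using circ.ex_lift by blast
    have small: "dist x q < \<rho>" "\<bar>t\<bar> < 1/2" using N[of "Suc n"] n t by (auto simp: xyz d_def)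
    have "fst (snd (b n)) = circ y0 + circ (\<phi> t)"
    proof -
      have "b n = f (x, circ (y0 + t), z)" using fb[of n] by (simp add: xyz t(1) circ_add)
      then have "fst (snd (b n)) = circ (y0 + \<phi> t)" by (simp add: f near_g2[OF small(1)])
      then show ?thesis by (simp add: circ_add)
    qed
    moreover have "\<bar>\<phi> t\<bar> \<le> \<bar>t\<bar>" using small by (intro \<phi>_le) auto
    ultimately have "d n \<le> \<bar>t\<bar>" using circ.dist_pr[of "\<phi> t" "circ y0 :: 2 circle"] small by (simp add: d_def)
    then show ?thesis using t by (simp add: d_def xyz)
  qed
  have "d N \<le> d (N + n)" for n
  proof (induction n)
    case (Suc n)
    then show ?case using mono[of "N + n"] by simp
  qed simp
  moreover have "(\<lambda>n. d (N + n)) \<longlonglongrightarrow> 0"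
    using LIMSEQ_ignore_initial_segment[OF dlim, of N] by (simp add: add.commute)
  ultimately have "d N \<le> 0" by (intro LIMSEQ_le_const[of "\<lambda>n. d (N + n)" 0]) auto
  then have "fst (snd (b N)) = circ y0" by (simp add: d_def)
  moreover have "(f ^^ N) (b N) = m"
  proof -
    have "(f ^^ n) (b n) = m" for n
    proof (induction n)
      case (Suc n)
      then show ?case using fb[of n] by (simp add: funpow_swap1)
    qed (simp add: b_def)
    then show ?thesis .
  qed
  ultimately show ?thesis using iterate_fst_snd[OF g2_y0, of "b N" N] by simp
qed

section \<open>The unstable set of the fixed point\<close>

lemma inv_f_leaf:
  "\<exists>d'. inv f (q + tproj (a *\<^sub>R eu), circ y0, q + tproj (d *\<^sub>R eu))
      = (q + tproj ((a / \<sigma>\<^sub>1) *\<^sub>R eu), circ y0, q + tproj (d' *\<^sub>R eu))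
    \<and> (\<bar>a / \<sigma>\<^sub>1\<bar> < \<rho> \<longrightarrow> d' = d / \<sigma>\<^sub>0)"
proof -
  define x where "x = q + tproj ((a / \<sigma>\<^sub>1) *\<^sub>R eu)"
  obtain v where v: "(x, circ y0, q) = proj v" using proj.pr_surj by blast
  obtain u t w where uw: "v = (u, t, w)" by (metis surj_pair)
  \<comment> \<open>Away from \<open>q\<close> the push may displace the last coordinate by an
    unknown amount, but only along \<open>eu\<close>, so the preimage stays in the product of the
    two unstable leaves.\<close>
  obtain s where s: "s + h (proj (v + (0, 0, s *\<^sub>R eu))) = d / \<sigma>\<^sub>0" using surj_eu_line by blast
  have m: "proj (v + (0, 0, s *\<^sub>R eu)) = (x, circ y0, q + tproj (s *\<^sub>R eu))"
    using v by (simp add: uw tproj.pr_add)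
  have "f (x, circ y0, q + tproj (s *\<^sub>R eu)) = (q + tproj (a *\<^sub>R eu), circ y0, q + tproj (d *\<^sub>R eu))"
  proof -
    have E: "q + tproj (s *\<^sub>R eu) + tproj (h (x, circ y0, q + tproj (s *\<^sub>R eu)) *\<^sub>R eu) = q + tproj ((d / \<sigma>\<^sub>0) *\<^sub>R eu)"
      using s by (simp add: m add.assoc flip: tproj.pr_add scaleR_add_left)
    have "fz (q + tproj (s *\<^sub>R eu) + tproj (h (x, circ y0, q + tproj (s *\<^sub>R eu)) *\<^sub>R eu)) = q + tproj (d *\<^sub>R eu)"
      unfolding E using rates by (simp add: fz_q linear_scale[OF Lz(1)] Lz)
    moreover have "fx x = q + tproj (a *\<^sub>R eu)"
      using rates by (simp add: x_def fx_q linear_scale[OF Lx(1)] Lx)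
    ultimately show ?thesis by (simp only: f g2_y0)
  qed
  then have "inv f (q + tproj (a *\<^sub>R eu), circ y0, q + tproj (d *\<^sub>R eu)) = (x, circ y0, q + tproj (s *\<^sub>R eu))"
    using inv_f_f[OF inj_f] by metis
  moreover have "s = d / \<sigma>\<^sub>0" if "\<bar>a / \<sigma>\<^sub>1\<bar> < \<rho>"
  proof -
    have "dist x q < \<rho>" using that tproj.dist_pr_le[of q "(a / \<sigma>\<^sub>1) *\<^sub>R eu" 0] norm_eu by (simp add: x_def)
    then show ?thesis using s by (simp add: m near_h)
  qed
  ultimately show ?thesis unfolding x_def by blast
qed

lemma leaf_subset_Wu: "(q + tproj (a *\<^sub>R eu), circ y0, q + tproj (d *\<^sub>R eu)) \<in> Wu p f"
proof -
  define m where "m = (q + tproj (a *\<^sub>R eu), circ y0 :: 2 circle, q + tproj (d *\<^sub>R eu))"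
  have form: "\<exists>d'. (inv f ^^ n) m = (q + tproj ((a / \<sigma>\<^sub>1 ^ n) *\<^sub>R eu), circ y0, q + tproj (d' *\<^sub>R eu))" for n
  proof (induction n)
    case (Suc n)
    then obtain d' where "(inv f ^^ n) m = (q + tproj ((a / \<sigma>\<^sub>1 ^ n) *\<^sub>R eu), circ y0, q + tproj (d' *\<^sub>R eu))" by blast
    then show ?case using inv_f_leaf[of "a / \<sigma>\<^sub>1 ^ n" d'] by (auto simp: mult.commute)
  qed (auto simp: m_def)
  have alim: "(\<lambda>n. a / \<sigma>\<^sub>1 ^ n) \<longlonglongrightarrow> 0" using rates by (intro LIMSEQ_divide_realpow_zero)
  then have "\<forall>\<^sub>F n in sequentially. \<bar>a / \<sigma>\<^sub>1 ^ n\<bar> < \<rho>" using tendstoD[OF alim \<rho>_pos] by simp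
  then obtain N where N: "\<And>n. n \<ge> N \<Longrightarrow> \<bar>a / \<sigma>\<^sub>1 ^ n\<bar> < \<rho>" unfolding eventually_sequentially by blast
  \<comment> \<open>The parameter \<open>e\<close> reached after \<open>N\<close> backward steps is
    not controlled. From then on \<open>h\<close> vanishes along the backward orbit, and each step
    divides it by \<open>\<sigma>\<^sub>0\<close>.\<close>
  obtain e where e: "(inv f ^^ N) m = (q + tproj ((a / \<sigma>\<^sub>1 ^ N) *\<^sub>R eu), circ y0, q + tproj (e *\<^sub>R eu))"
    using form by blast
  have tail: "(inv f ^^ (n + N)) m
      = (q + tproj ((a / \<sigma>\<^sub>1 ^ (n + N)) *\<^sub>R eu), circ y0, q + tproj ((e / \<sigma>\<^sub>0 ^ n) *\<^sub>R eu))" for n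
  proof (induction n)
    case (Suc n)
    have "\<bar>a / \<sigma>\<^sub>1 ^ (n + N) / \<sigma>\<^sub>1\<bar> < \<rho>" using N[of "Suc (n + N)"] by (simp add: mult.commute)
    then show ?case using Suc inv_f_leaf[of "a / \<sigma>\<^sub>1 ^ (n + N)" "e / \<sigma>\<^sub>0 ^ n"] by (auto simp: mult.commute)
  qed (use e in simp)
  have "(\<lambda>n. a / \<sigma>\<^sub>1 ^ (n + N)) \<longlonglongrightarrow> 0" by (rule LIMSEQ_ignore_initial_segment[OF alim])
  moreover have "(\<lambda>n. e / \<sigma>\<^sub>0 ^ n) \<longlonglongrightarrow> 0" using rates by (intro LIMSEQ_divide_realpow_zero)
  moreover have leaf_lim: "(\<lambda>n. q + tproj (s n *\<^sub>R eu)) \<longlonglongrightarrow> q" if "s \<longlonglongrightarrow> 0" for s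
    using tproj.tendsto_pr[OF tendsto_scaleR[OF that tendsto_const[of eu]], of q] by simp
  ultimately have "(\<lambda>n. (inv f ^^ (n + N)) m) \<longlonglongrightarrow> p"
    unfolding tail by (intro tendsto_Pair tendsto_const leaf_lim)
  then have lim: "(\<lambda>n. (inv f ^^ n) m) \<longlonglongrightarrow> p" by (rule LIMSEQ_offset)
  have "(inv f ^^ n) p = p" for n by (induction n) (auto simp: inv_f_p)
  then show ?thesis
    using tendsto_dist_iff[THEN iffD1, OF lim] unfolding Wu_def Ws_def m_def[symmetric] by simp
qed

lemma closure_Wu: "(x, circ y0, z) \<in> closure (Wu p f)"
  unfolding closure_approachable
proof (intro allI impI)
  fix e :: real assume e: "0 < e"
  obtain a where a: "dist (q + tproj (a *\<^sub>R eu)) x < e / 2" using dense_u[of "e / 2" x] half_gt_zero[OF e] by blast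
  obtain d where d: "dist (q + tproj (d *\<^sub>R eu)) z < e / 2" using dense_u[of "e / 2" z] half_gt_zero[OF e] by blast
  have "dist (q + tproj (a *\<^sub>R eu), circ y0 :: 2 circle, q + tproj (d *\<^sub>R eu)) (x, circ y0, z)
     \<le> dist (q + tproj (a *\<^sub>R eu)) x + dist (q + tproj (d *\<^sub>R eu)) z"
    unfolding dist_Pair_Pair by (simp add: sqrt_sum_squares_le_sum)
  then have "dist (q + tproj (a *\<^sub>R eu), circ y0 :: 2 circle, q + tproj (d *\<^sub>R eu)) (x, circ y0, z) < e"
    using a d by linarith
  then show "\<exists>m\<in>Wu p f. dist m (x, circ y0, z) < e" using leaf_subset_Wu by blast
qed

text \<open>Only the centre of the disk has to avoid the repelling level, because all points are
  found in a neighbourhood of the centre that stays off it. Two stages are needed because the number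
  \<open>N\<close> of iterates depends on the point found in the first.\<close>

lemma meets_transversely:
  assumes disk: "c1_disk V g L" and trans: "disk_transverse V g L Ecs"
    and away: "fst (snd (g 0)) \<noteq> circ (y0 + 1)"
  shows "disk_meets_transversely V g L (Ws_orb p f)"
proof -
  define S where "S = cball 0 1 \<inter> V"
  have V: "subspace V" and der: "\<And>u. u \<in> S \<Longrightarrow> has_mderiv g (L u) u S"
    using disk unfolding c1_disk_def S_def by auto
  have span: "L u ` V + Ecs (g u) = UNIV" if "u \<in> S" for u
    using trans that unfolding disk_transverse_def S_def by auto
  have V0: "0 \<in> V" using V by (rule subspace_0)
  then have S0: "0 \<in> S" by (simp add: S_def)
  obtain w0 where w0: "g 0 = proj w0" using proj.pr_surj by blast
  obtain r0 \<Gamma> where r0: "r0 > 0" "\<Gamma> 0 = w0" "\<And>v. v \<in> S \<Longrightarrow> dist v 0 < r0 \<Longrightarrow> g v = proj (\<Gamma> v)"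
      "\<And>v. v \<in> S \<Longrightarrow> dist v 0 < r0 \<Longrightarrow> (\<Gamma> has_derivative L v) (at v within S)"
    using has_mderiv_lift[OF der S0 w0] by blast
  have \<Gamma>_near: "\<exists>r>0. \<forall>v\<in>S. dist v u < r \<longrightarrow> \<Gamma> v \<in> O'" if "u \<in> S" "dist u 0 < r0" "open O'" "\<Gamma> u \<in> O'" for u O'
  proof -
    have "(\<Gamma> \<longlongrightarrow> \<Gamma> u) (at u within S)"
      using has_derivative_continuous[OF r0(4)[OF that(1,2)]] by (simp add: continuous_within)
    then have "\<forall>\<^sub>F v in at u within S. \<Gamma> v \<in> O'" using that(3,4) by (rule topological_tendstoD)
    then show ?thesis using that(4) unfolding eventually_at by metis
  qed
  define O1 where "O1 = {w::R5. 0 < dist (0 + circ (fst (snd w)) :: 2 circle) (circ (y0 + 1))}"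
  have "continuous_on UNIV (\<lambda>w::R5. 0 + circ (fst (snd w)) :: 2 circle)"
    by (rule continuous_on_compose2[OF circ.continuous_pr[of UNIV 0]])
       (auto intro!: continuous_on_fst continuous_on_snd continuous_on_id)
  then have openO1: "open O1" unfolding O1_def by (intro open_Collect_less continuous_intros)
  have "\<Gamma> 0 \<in> O1"
  proof -
    have "fst (snd (proj w)) = circ (fst (snd w))" for w by (cases w) auto
    then show ?thesis using away by (simp add: O1_def r0(2) w0)
  qed
  then have "\<exists>r>0. \<forall>v\<in>S. dist v 0 < r \<longrightarrow> \<Gamma> v \<in> O1"
    using \<Gamma>_near[OF S0 _ openO1] r0(1) by simp
  then obtain r1 where r1: "r1 > 0" "\<And>v. v \<in> S \<Longrightarrow> dist v 0 < r1 \<Longrightarrow> \<Gamma> v \<in> O1" by blast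
  define r where "r = min 1 (min r0 r1)"
  have r: "0 < r" "\<And>v. v \<in> V \<Longrightarrow> dist v 0 < r \<Longrightarrow> v \<in> S" "\<And>v. dist v 0 < r \<Longrightarrow> dist v 0 < r0"
    "\<And>v. dist v 0 < r \<Longrightarrow> dist v 0 < r1"
    using r0(1) r1(1) by (auto simp: r_def S_def)

  \<comment> \<open>Move the base point of the disk onto a stable leaf of \<open>q\<close>.\<close>
  obtain e1 where e1: "e1 > 0" "\<And>y. dist y (fst (\<Gamma> 0) \<bullet> eu) < e1 \<Longrightarrow> \<exists>v\<in>V. dist v 0 < r \<and> fst (\<Gamma> v) \<bullet> eu = y"
  proof (rule disk_open_map[OF V V0 r(1), of S "\<lambda>v. fst (\<Gamma> v) \<bullet> eu" "\<lambda>v w. fst (L v w) \<bullet> eu"])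
    fix v assume v: "v \<in> V" "dist v 0 < r"
    then show vS: "v \<in> S" using r by blast
    show "((\<lambda>v. fst (\<Gamma> v) \<bullet> eu) has_derivative (\<lambda>w. fst (L v w) \<bullet> eu)) (at v within S)"
      by (intro has_derivative_inner_left has_derivative_fst r0(4) vS r(3) v(2))
  next
    have "\<exists>v\<in>V. fst (L 0 v) \<bullet> eu = s" for s
    proof -
      have "(s *\<^sub>R eu, 0, 0) \<in> L 0 ` V + Ecs (g 0)" using span[OF S0] by simp
      then obtain v e where ve: "v \<in> V" "e \<in> Ecs (g 0)" "(s *\<^sub>R eu, 0, 0) = L 0 v + e"
        by (auto elim!: set_plus_elim)
      have "fst (L 0 v) + fst e = s *\<^sub>R eu" using arg_cong[OF ve(3), of fst] by simp
      then have "fst (L 0 v) \<bullet> eu + fst e \<bullet> eu = s" by (metis eu_eu(1) inner_add_left inner_scaleR_left mult.right_neutral)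
      then show ?thesis using Ecs_eu_x[OF ve(2)] ve(1) by auto
    qed
    then show "(\<lambda>w. fst (L 0 w) \<bullet> eu) ` V = UNIV" by (auto simp: image_iff) metis
  qed blast
  obtain c x0 where c: "\<bar>c - fst (\<Gamma> 0) \<bullet> eu\<bar> < e1"
    "\<And>x. x \<bullet> eu = c \<Longrightarrow> tproj x = q + tproj (((x - x0) \<bullet> es) *\<^sub>R es)"
    using dense_s[OF e1(1)] by blast
  obtain u1 where u1: "u1 \<in> V" "dist u1 0 < r" "fst (\<Gamma> u1) \<bullet> eu = c"
    using e1(2)[of c] c(1) by (auto simp: dist_real_def)
  \<comment> \<open>The signed position along the stable leaf of \<open>q\<close> after
    \<open>N\<close> steps; it is meaningful where the base coordinate is \<open>c\<close>.\<close>
  define \<theta> where "\<theta> = (\<lambda>N (w::R5). \<tau>\<^sub>1 ^ N * ((fst w - x0) \<bullet> es))"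
  have "(\<lambda>N. \<theta> N (\<Gamma> u1)) \<longlonglongrightarrow> 0 * ((fst (\<Gamma> u1) - x0) \<bullet> es)"
    unfolding \<theta>_def by (intro tendsto_mult tendsto_const LIMSEQ_power_zero) (use rates in auto)
  then have "(\<lambda>N. \<theta> N (\<Gamma> u1)) \<longlonglongrightarrow> 0" by simp
  from tendstoD[OF this \<rho>_pos] have "\<forall>\<^sub>F N in sequentially. \<bar>\<theta> N (\<Gamma> u1)\<bar> < \<rho>" by simp
  then obtain N where N: "\<bar>\<theta> N (\<Gamma> u1)\<bar> < \<rho>" by (auto simp: eventually_sequentially)
  have iter_x: "(fx ^^ N) (q + tproj (b *\<^sub>R es)) = q + tproj ((\<tau>\<^sub>1 ^ N * b) *\<^sub>R es)" for b N
    by (induction N) (auto simp: fx_q linear_scale[OF Lx(1)] Lx mult.commute mult.left_commute)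
  have fst_f: "fst ((f ^^ N) m) = (fx ^^ N) (fst m)" for N m
  proof (induction N)
    case (Suc N)
    obtain x y z where "(f ^^ N) m = (x, y, z)" by (metis surj_pair)
    then show ?case using Suc by (simp add: f)
  qed simp
  have fst_proj: "fst (proj w) = tproj (fst w)" "snd (snd (proj w)) = tproj (snd (snd w))"
      "fst (snd (proj w)) = circ (fst (snd w))" for w
    by (cases w; auto)+
  have leaf: "fst ((f ^^ N) (proj w)) = q + tproj (\<theta> N w *\<^sub>R es)" if "fst w \<bullet> eu = c" for w
    using c(2)[OF that] by (simp add: fst_f fst_proj iter_x \<theta>_def)

  \<comment> \<open>Move the last coordinate of its \<open>N\<close>-th image onto a stable leaf of \<open>q\<close> as well.\<close>
  define O2 where "O2 = {w::R5. \<bar>\<theta> N w\<bar> < \<rho>}"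
  have "open O2" unfolding O2_def \<theta>_def by (intro open_Collect_less continuous_intros)
  moreover have "\<Gamma> u1 \<in> O2" using N by (simp add: O2_def)
  ultimately have "\<exists>r>0. \<forall>v\<in>S. dist v u1 < r \<longrightarrow> \<Gamma> v \<in> O2"
    using \<Gamma>_near[of u1 O2] u1 r by blast
  then obtain r2 where r2: "r2 > 0" "\<And>v. v \<in> S \<Longrightarrow> dist v u1 < r2 \<Longrightarrow> \<Gamma> v \<in> O2" by blast
  define r' where "r' = min r2 (r - dist u1 0)"
  have r': "0 < r'" "\<And>v. dist v u1 < r' \<Longrightarrow> dist v 0 < r" "\<And>v. dist v u1 < r' \<Longrightarrow> dist v u1 < r2"
  proof -
    show "0 < r'" using r2 u1 by (simp add: r'_def)
    show "dist v 0 < r" if "dist v u1 < r'" for v using that dist_triangle[of v 0 u1] by (simp add: r'_def)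
  qed (simp add: r'_def)
  define \<Phi> where "\<Phi> = (\<lambda>v. (F ^^ N) (\<Gamma> v))"
  have d\<Phi>: "(\<Phi> has_derivative (\<lambda>w. DF N (\<Gamma> v) (L v w))) (at v within S)" if "v \<in> S" "dist v 0 < r" for v
    unfolding \<Phi>_def
    by (rule has_derivative_compose[OF r0(4)[OF that(1) r(3)[OF that(2)]] C1_with_deriv[OF C1_iterate]])
  \<comment> \<open>After \<open>N\<close> steps the base point lies on the local leaf, where
    \<open>Ecs_near\<close> controls \<open>Ecs\<close> in both tori.\<close>
  have DF_T: "DF N (\<Gamma> u) e \<in> T"
    if "u \<in> S" "dist u 0 < r" "fst (\<Gamma> u) \<bullet> eu = c" "\<Gamma> u \<in> O2" "e \<in> Ecs (g u)" for u e
  proof -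
    have gu: "g u = proj (\<Gamma> u)" by (rule r0(3)[OF that(1) r(3)[OF that(2)]])
    define y z where "y = fst (snd ((f ^^ N) (g u)))" and "z = snd (snd ((f ^^ N) (g u)))"
    have m: "(f ^^ N) (g u) = (q + tproj (\<theta> N (\<Gamma> u) *\<^sub>R es), y, z)"
      using leaf[OF that(3)] by (simp add: prod_eq_iff gu y_def z_def)
    have "DF N (\<Gamma> u) e \<in> Ecs ((f ^^ N) (g u))"
      using DF_Ecs[of e "\<Gamma> u" N] that(5) by (simp add: gu iterate_proj)
    then show ?thesis unfolding m by (rule Ecs_near[rotated]) (use that(4) in \<open>simp add: O2_def\<close>)
  qed
  have u1S: "u1 \<in> S" using u1 r by blast
  \<comment> \<open>Both coordinates are prescribed together, so that the first can be held at
    \<open>c\<close> while the second moves.\<close>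
  obtain e2 where e2: "e2 > 0" "\<And>y. dist y (fst (\<Gamma> u1) \<bullet> eu, snd (snd (\<Phi> u1)) \<bullet> eu) < e2 \<Longrightarrow>
      \<exists>v\<in>V. dist v u1 < r' \<and> (fst (\<Gamma> v) \<bullet> eu, snd (snd (\<Phi> v)) \<bullet> eu) = y"
  proof (rule disk_open_map[OF V u1(1) r'(1), of S "\<lambda>v. (fst (\<Gamma> v) \<bullet> eu, snd (snd (\<Phi> v)) \<bullet> eu)"
        "\<lambda>v w. (fst (L v w) \<bullet> eu, snd (snd (DF N (\<Gamma> v) (L v w))) \<bullet> eu)"])
    fix v assume v: "v \<in> V" "dist v u1 < r'"
    then show vS: "v \<in> S" using r r' by blast
    show "((\<lambda>v. (fst (\<Gamma> v) \<bullet> eu, snd (snd (\<Phi> v)) \<bullet> eu)) has_derivative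
        (\<lambda>w. (fst (L v w) \<bullet> eu, snd (snd (DF N (\<Gamma> v) (L v w))) \<bullet> eu))) (at v within S)"
      by (intro has_derivative_Pair has_derivative_inner_left has_derivative_fst has_derivative_snd
          r0(4) d\<Phi> vS r(3) r'(2) v(2))
  next
    have "\<exists>v\<in>V. fst (L u1 v) \<bullet> eu = s \<and> snd (snd (DF N (\<Gamma> u1) (L u1 v))) \<bullet> eu = t" for s t
    proof -
      \<comment> \<open>The first coordinate is read at time 0 and the second at time
        \<open>N\<close>, hence the factor \<open>\<sigma>\<^sub>1 ^ N\<close> in the
        target.\<close>
      define y where "y = (((\<sigma>\<^sub>1 ^ N * s) *\<^sub>R eu, 0, t *\<^sub>R eu) :: R5)"
      obtain k where k: "DF N (\<Gamma> u1) k = y" using bij_DF by (metis bij_pointE)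
      have "k \<in> L u1 ` V + Ecs (g u1)" using span[OF u1S] by simp
      then obtain v e where ve: "v \<in> V" "e \<in> Ecs (g u1)" "k = L u1 v + e"
        by (auto elim!: set_plus_elim)
      have eT: "DF N (\<Gamma> u1) e \<in> T"
        by (rule DF_T[OF u1S u1(2,3) _ ve(2)]) (use N in \<open>simp add: O2_def\<close>)
      have y: "y = DF N (\<Gamma> u1) (L u1 v) + DF N (\<Gamma> u1) e"
        unfolding k[symmetric] ve(3) by (rule linear_add[OF linear_DF])
      have "snd (snd (DF N (\<Gamma> u1) (L u1 v))) \<bullet> eu = t"
      proof -
        have "t *\<^sub>R eu = snd (snd (DF N (\<Gamma> u1) (L u1 v))) + snd (snd (DF N (\<Gamma> u1) e))"
          using arg_cong[OF y, of "\<lambda>y. snd (snd y)"] by (simp add: y_def)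
        from arg_cong[OF this, of "\<lambda>z. z \<bullet> eu"] show ?thesis using eT by (simp add: T_def inner_add_left)
      qed
      moreover have "fst (L u1 v) \<bullet> eu = s"
      proof -
        have "(\<sigma>\<^sub>1 ^ N * s) *\<^sub>R eu = fst (DF N (\<Gamma> u1) (L u1 v)) + fst (DF N (\<Gamma> u1) e)"
          using arg_cong[OF y, of fst] by (simp add: y_def)
        from arg_cong[OF this, of "\<lambda>z. z \<bullet> eu"] have "\<sigma>\<^sub>1 ^ N * s = \<sigma>\<^sub>1 ^ N * (fst (L u1 v) \<bullet> eu)"
          using eT by (simp add: T_def inner_add_left DF_fst)
        then show ?thesis using rates by simp
      qed
      ultimately show ?thesis using ve(1) by blast
    qed
    then show "(\<lambda>w. (fst (L u1 w) \<bullet> eu, snd (snd (DF N (\<Gamma> u1) (L u1 w))) \<bullet> eu)) ` V = UNIV"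
      by (auto simp: image_iff) metis
  qed blast
  obtain c2 z0 where c2: "\<bar>c2 - snd (snd (\<Phi> u1)) \<bullet> eu\<bar> < e2"
    "\<And>x. x \<bullet> eu = c2 \<Longrightarrow> tproj x = q + tproj (((x - z0) \<bullet> es) *\<^sub>R es)"
    using dense_s[OF e2(1)] by blast
  have "dist (c, c2) (fst (\<Gamma> u1) \<bullet> eu, snd (snd (\<Phi> u1)) \<bullet> eu) < e2"
    using c2(1) u1(3) by (simp add: dist_Pair_Pair dist_real_def)
  from e2(2)[OF this] obtain u2 where u2: "u2 \<in> V" "dist u2 u1 < r'" "fst (\<Gamma> u2) \<bullet> eu = c"
    "snd (snd (\<Phi> u2)) \<bullet> eu = c2" by auto
  have u2r: "dist u2 0 < r" and u2S: "u2 \<in> S" using u2 r r' by blast+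
  have u2O: "\<Gamma> u2 \<in> O1" "\<Gamma> u2 \<in> O2" using r1(2)[OF u2S r(4)[OF u2r]] r2(2)[OF u2S r'(3)[OF u2(2)]] by auto
  have gu2: "g u2 = proj (\<Gamma> u2)" by (rule r0(3)[OF u2S r(3)[OF u2r]])

  define b where "b = \<theta> N (\<Gamma> u2)"
  define e where "e = (snd (snd (\<Phi> u2)) - z0) \<bullet> es"
  define y where "y = fst (snd ((f ^^ N) (g u2)))"
  have bR: "\<bar>b\<bar> < \<rho>" using u2O by (simp add: b_def O2_def)
  have image: "(f ^^ N) (g u2) = (q + tproj (b *\<^sub>R es), y, q + tproj (e *\<^sub>R es))"
  proof -
    have "snd (snd ((f ^^ N) (g u2))) = q + tproj (e *\<^sub>R es)"
      using c2(2)[OF u2(4)] by (simp add: gu2 iterate_proj fst_proj e_def \<Phi>_def)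
    then show ?thesis
      using leaf[OF u2(3)] by (simp add: prod_eq_iff y_def b_def gu2)
  qed
  have y_ne: "y \<noteq> circ (y0 + 1)"
  proof -
    \<comment> \<open>Each \<open>g2 x'\<close> is injective and fixes the repelling level, so an
      orbit cannot enter it later.\<close>
    have "fst (snd ((f ^^ n) (g u2))) \<noteq> circ (y0 + 1)" for n
    proof (induction n)
      case 0
      then show ?case using u2O by (auto simp: gu2 fst_proj O1_def)
    next
      case (Suc n)
      obtain x' y' z' where xyz: "(f ^^ n) (g u2) = (x', y', z')" by (metis surj_pair)
      have "g2 x' y' \<noteq> g2 x' (circ (y0 + 1))"
        using Suc bij_g2[of x'] by (auto simp: xyz bij_def inj_eq)
      then show ?case by (simp add: xyz f g2_y1)
    qed
    then show ?thesis by (simp add: y_def)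
  qed
  \<comment> \<open>The first term keeps the perturbed base point on the local leaf, the second
    keeps its circle coordinate off the repeller.\<close>
  define \<epsilon> where "\<epsilon> = min (\<rho> - \<bar>b\<bar>) (dist y (circ (y0 + 1)))"
  have "\<epsilon> > 0" using bR y_ne by (simp add: \<epsilon>_def)
  have W: "proj v \<in> Ws_orb p f" if t: "t \<in> T" "norm t < \<epsilon>" "(F ^^ N) v = (F ^^ N) (\<Gamma> u2) + t" for v t
  proof -
    obtain tx ty tz where txyz: "t = (tx, ty, tz)" by (metis surj_pair)
    have tx: "tx = (tx \<bullet> es) *\<^sub>R es" and tz: "tz = (tz \<bullet> es) *\<^sub>R es"
      using t(1) by (auto simp: T_def txyz intro: eq_scale_es)
    have "norm tx \<le> norm t" unfolding txyz by (rule norm_fst_le)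
    then have "\<bar>tx \<bullet> es\<bar> < \<rho> - \<bar>b\<bar>"
      using t(2) Cauchy_Schwarz_ineq2[of tx es] norm_es by (simp add: \<epsilon>_def)
    then have b': "\<bar>b + tx \<bullet> es\<bar> < \<rho>" by linarith
    have "norm ty \<le> norm t" unfolding txyz by (rule order_trans[OF norm_fst_le norm_snd_le])
    then have "dist (y + circ ty) y < dist y (circ (y0 + 1))"
      using circ.dist_pr_le[of y ty 0] t(2) by (simp add: \<epsilon>_def)
    then have y': "y + circ ty \<noteq> circ (y0 + 1)" by (auto simp: dist_commute)
    have "(f ^^ N) (proj v) = (f ^^ N) (g u2) + proj t"
      by (simp add: iterate_proj gu2 t(3) proj.pr_add)
    also have "\<dots> = (q + tproj (b *\<^sub>R es), y, q + tproj (e *\<^sub>R es)) + (tproj ((tx \<bullet> es) *\<^sub>R es), circ ty, tproj ((tz \<bullet> es) *\<^sub>R es))"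
      using tx tz by (simp add: image txyz)
    also have "\<dots> = (q + tproj ((b + tx \<bullet> es) *\<^sub>R es), y + circ ty, q + tproj ((e + tz \<bullet> es) *\<^sub>R es))"
      by (simp add: scaleR_add_left tproj.pr_add add.assoc)
    finally have image': "(f ^^ N) (proj v)
        = (q + tproj ((b + tx \<bullet> es) *\<^sub>R es), y + circ ty, q + tproj ((e + tz \<bullet> es) *\<^sub>R es))" .
    have "(f ^^ N) (proj v) \<in> Ws_orb p f" unfolding image' by (rule local_stable[OF b' y'])
    then show ?thesis by (rule Ws_orb_iterate)
  qed
  obtain g' L' where g': "c1_disk T g' L'" "g' 0 = proj (\<Gamma> u2)" "g' ` (cball 0 1 \<inter> T) \<subseteq> Ws_orb p f"
    "\<And>w. DF N (\<Gamma> u2) w \<in> T \<Longrightarrow> w \<in> L' 0 ` T"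
  proof (rule inverse_disk[OF C1_iterate[of N] bij_DF subspace_T \<open>\<epsilon> > 0\<close>, of "\<Gamma> u2" "Ws_orb p f"])
    fix v t assume "t \<in> T" "norm t < \<epsilon>" "(F ^^ N) v = (F ^^ N) (\<Gamma> u2) + t"
    then show "proj v \<in> Ws_orb p f" by (rule W)
  qed blast
  \<comment> \<open>The disk is a preimage of an affine piece parallel to \<open>T\<close> under the
    \<open>N\<close>-th iterate, so its tangent space contains everything that \<open>DF N\<close>
    sends into \<open>T\<close>, in particular \<open>Ecs\<close>. Transversality to
    \<open>Ecs\<close> is thus inherited by the disk.\<close>
  have "Ecs (g u2) \<subseteq> L' 0 ` T" using DF_T[OF u2S u2r u2(3) u2O(2)] g'(4) by blast
  then have "L u2 ` V + L' 0 ` T = UNIV"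
    using span[OF u2S] set_plus_mono2[OF order_refl, of "Ecs (g u2)" "L' 0 ` T" "L u2 ` V"] by blast
  then show ?thesis
    unfolding disk_meets_transversely_def using g' gu2 u2S[unfolded S_def] by metis
qed

end

section \<open>The ingredients of the construction\<close>

lemma smooth_DERIV: "smooth g \<Longrightarrow> (g has_real_derivative deriv g x) (at x)"
  unfolding smooth_def
  by (drule spec[of _ 0]) (simp add: differentiable_on_def DERIV_deriv_iff_real_differentiable)

lemma smooth_continuous_deriv: "smooth g \<Longrightarrow> continuous_on S (deriv g)"
  unfolding smooth_def
  by (drule spec[of _ 1]) (auto intro: differentiable_imp_continuous_on continuous_on_subset)

lemma C1_smooth: "smooth g \<Longrightarrow> C1 g"
  by (rule C1_real[OF smooth_DERIV smooth_continuous_deriv])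

lemma C1_norm_sq: "C1 (\<lambda>v::'a::euclidean_space. v \<bullet> v)"
  unfolding C1_def
proof (intro exI C1_withI)
  show "((\<lambda>v. v \<bullet> v) has_derivative (\<lambda>w. v \<bullet> w + w \<bullet> v)) (at v)" for v :: 'a
    by (rule has_derivative_inner[OF has_derivative_ident has_derivative_ident])
  show "continuous_on UNIV (\<lambda>p :: 'a \<times> 'a. fst p \<bullet> snd p + snd p \<bullet> fst p)"
    by (intro continuous_intros)
qed

lemma C1_compact_support_bounded:
  fixes K :: "'a::euclidean_space \<Rightarrow> real"
  assumes "C1 K" "\<And>v. norm v \<ge> r \<Longrightarrow> K v = 0"
  obtains M where "\<And>v. \<bar>K v\<bar> \<le> M"
proof -
  have "compact (K ` cball 0 r)"
    by (rule compact_continuous_image[OF C1_continuous[OF assms(1)]]) simp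
  from compact_imp_bounded[OF this] obtain M where M: "\<And>v. v \<in> cball 0 r \<Longrightarrow> norm (K v) \<le> M"
    unfolding bounded_iff by blast
  have "\<bar>K v\<bar> \<le> max M 0" for v
  proof (cases "norm v \<le> r")
    case True
    then show ?thesis using M[of v] by simp
  qed (simp add: assms(2))
  then show ?thesis using that by blast
qed

lemma delta_pos: "0 < \<delta>"
  by (simp add: \<delta>_def)

section \<open>Cutoffs of norms and distances\<close>

locale cutoff =
  fixes \<psi> :: "real \<Rightarrow> real"
  assumes psi: "smooth \<psi>" "\<forall>x. \<psi> (- x) = \<psi> x" "\<forall>x\<in>{0..\<delta>/2}. \<psi> x = 1" "\<forall>x\<ge>\<delta>. \<psi> x = 0"
begin

lemma psi_eq_0: "\<bar>x\<bar> \<ge> \<delta> \<Longrightarrow> \<psi> x = 0"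
proof (cases "x \<ge> 0")
  case False
  assume "\<bar>x\<bar> \<ge> \<delta>"
  then have "\<psi> (- x) = 0" using False psi(4) by simp
  then show ?thesis using psi(2) by simp
qed (use psi(4) in simp)

lemma psi_eq_1: "0 \<le> x \<Longrightarrow> x \<le> \<delta>/2 \<Longrightarrow> \<psi> x = 1"
  using psi(3) by auto

lemma psi_bounded: obtains M where "\<And>x. \<bar>\<psi> x\<bar> \<le> M"
  using C1_compact_support_bounded[OF C1_smooth[OF psi(1)], of \<delta>] psi_eq_0 by auto

text \<open>\<open>\<theta> (s\<^sup>2) = \<psi> s\<close> for \<open>s \<ge> 0\<close>; this function avoids the singularity of the square root.\<close>

definition \<theta> :: "real \<Rightarrow> real" where
  "\<theta> s = (if s > 0 then \<psi> (sqrt s) else 1)"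

lemma theta_eq: "0 \<le> s \<Longrightarrow> \<theta> s = \<psi> (sqrt s)"
  using psi_eq_1[of 0] delta_pos by (simp add: \<theta>_def)

text \<open>The square root is singular only at 0, where \<theta> is locally constant; positive
  arguments and arguments below the square of \<open>\<delta>/2\<close> cover the line.\<close>

lemma C1_theta: "C1 \<theta>"
proof -
  define \<theta>' where "\<theta>' = (\<lambda>s. if s > 0 then deriv \<psi> (sqrt s) * (inverse (sqrt s) / 2) else 0)"
  have one: "\<theta> s = 1" if "s < (\<delta>/2)\<^sup>2" for s
  proof (cases "s > 0")
    case True
    have "sqrt s \<le> \<delta>/2" using that delta_pos real_sqrt_le_mono[of s "(\<delta>/2)\<^sup>2"] by simp
    then show ?thesis using True by (simp add: \<theta>_def psi_eq_1)
  qed (simp add: \<theta>_def)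
  have D0: "(\<theta> has_real_derivative 0) (at s)" if "s < (\<delta>/2)\<^sup>2" for s
    by (rule has_field_derivative_transform_within_open[OF DERIV_const[of 1] open_lessThan[of "(\<delta>/2)\<^sup>2"]])
       (use that one in auto)
  have D1: "(\<theta> has_real_derivative \<theta>' s) (at s)" if "s > 0" for s
  proof (rule has_field_derivative_transform_within_open[OF _ open_greaterThan[of 0]])
    show "((\<lambda>s. \<psi> (sqrt s)) has_real_derivative \<theta>' s) (at s)"
      using DERIV_chain2[OF smooth_DERIV[OF psi(1)] DERIV_real_sqrt[OF that]] that by (simp add: \<theta>'_def)
  qed (use that in \<open>auto simp: \<theta>_def\<close>)
  have z: "\<theta>' s = 0" if "s < (\<delta>/2)\<^sup>2" for s
  proof (cases "s > 0")
    case True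
    then show ?thesis by (rule DERIV_unique[OF D1 D0[OF that]])
  qed (simp add: \<theta>'_def)
  have D: "(\<theta> has_real_derivative \<theta>' s) (at s)" for s
  proof (cases "s > 0")
    case False
    moreover have "0 < (\<delta>/2)\<^sup>2" using delta_pos by simp
    ultimately have "s < (\<delta>/2)\<^sup>2" by linarith
    then show ?thesis using D0 z by metis
  qed (rule D1)
  have "continuous_on ({0<..} \<union> {..<(\<delta>/2)\<^sup>2}) \<theta>'"
  proof (rule continuous_on_open_Un)
    have "continuous_on {0<..} (\<lambda>s. deriv \<psi> (sqrt s) * (inverse (sqrt s) / 2))"
      by (intro continuous_intros continuous_on_compose2[OF smooth_continuous_deriv[OF psi(1), of UNIV]]) auto
    then show "continuous_on {0<..} \<theta>'"
      by (rule continuous_on_eq) (simp add: \<theta>'_def)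
    show "continuous_on {..<(\<delta>/2)\<^sup>2} \<theta>'"
      by (rule continuous_on_eq[OF continuous_on_const[of _ 0]]) (simp add: z)
  qed auto
  moreover have "{0<..} \<union> {..<(\<delta>/2)\<^sup>2} = UNIV"
    using delta_pos by (auto simp: not_less intro: le_less_trans)
  ultimately show ?thesis using D by (intro C1_real[of _ \<theta>']) auto
qed

lemma C1_psi_norm: "C1 (\<lambda>v::'a::euclidean_space. \<psi> (norm v))"
proof -
  have "(\<lambda>v::'a. \<psi> (norm v)) = (\<lambda>v. \<theta> (v \<bullet> v))" by (intro ext) (simp add: theta_eq norm_eq_sqrt_inner)
  then show ?thesis using C1_compose[OF C1_theta C1_norm_sq] by metis
qed

text \<open>The distance is the norm of any shortest lift, so this function is a bump of \<psi>
  composed with the norm, with support of radius \<delta> below 1/2.\<close>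

lemma C1_psi_dist: "C1 (\<lambda>v. \<psi> (dist (tproj v) p))"
proof -
  have "tproj.bump p (\<lambda>v. \<psi> (norm v)) m = \<psi> (dist m p)" for m
  proof -
    let ?P = "\<lambda>w. m = p + tproj w \<and> norm w = dist m p"
    have "?P (SOME w. ?P w)" by (rule someI_ex) (rule tproj.ex_lift)
    then show ?thesis unfolding tproj.bump_def by simp
  qed
  then show ?thesis
    using tproj.C1_bump[OF C1_psi_norm, of \<delta> p] by (simp add: psi_eq_0 \<delta>_def)
qed

end

section \<open>The circle diffeomorphism and its cutoffs\<close>

locale circle_map = cutoff \<psi>
  for \<psi> :: "real \<Rightarrow> real" +
  fixes \<phi> :: "real \<Rightarrow> real"
  assumes phi: "smooth \<phi>" "\<forall>x. \<phi> (x + 2) = \<phi> x + 2" "{x\<in>{0..2}. \<phi> x = x} = {0, 1, 2}"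
      "deriv \<phi> 0 = 1/2" "1 + (INF (x, y). (deriv \<phi> x - 1) * \<psi> y) > 0"
begin

text \<open>With this displacement \<open>Q\<close> reads \<open>c + \<psi> * \<gamma> c\<close>.
  Since it is 2-periodic, the formula descends to the circle without a choice of
  representative.\<close>

definition \<gamma> :: "real \<Rightarrow> real" where
  "\<gamma> t = \<phi> t - t"

lemma gamma_DERIV: "(\<gamma> has_real_derivative deriv \<phi> t - 1) (at t)"
  unfolding \<gamma>_def using smooth_DERIV[OF phi(1)] by (intro DERIV_diff DERIV_ident)

lemma C1_gamma: "C1 \<gamma>"
  by (rule C1_real[OF gamma_DERIV]) (intro continuous_intros smooth_continuous_deriv phi)

lemma gamma_periodic: "\<gamma> (t + 2) = \<gamma> t"
  using phi(2) by (simp add: \<gamma>_def)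

lemma gamma_periodic_int: "\<gamma> (t + of_int n * 2) = \<gamma> t"
  using shift_by_periods[of \<gamma> 0 t n] by (simp add: gamma_periodic)

lemma gamma_zeros: "\<gamma> 0 = 0" "\<gamma> 1 = 0" "\<gamma> (- 1) = 0"
  and gamma_nonzero: "0 < t \<Longrightarrow> t < 1 \<Longrightarrow> \<gamma> t \<noteq> 0" "- 1 < t \<Longrightarrow> t < 0 \<Longrightarrow> \<gamma> t \<noteq> 0"
proof -
  have fix_iff: "\<gamma> t = 0 \<longleftrightarrow> t \<in> {0, 1, 2}" if "0 \<le> t" "t \<le> 2" for t
    using that phi(3) unfolding \<gamma>_def by (auto simp: set_eq_iff)
  show "\<gamma> 0 = 0" "\<gamma> 1 = 0" using fix_iff[of 0] fix_iff[of 1] by auto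
  then show "\<gamma> (- 1) = 0" using gamma_periodic[of "- 1"] by simp
  show "0 < t \<Longrightarrow> t < 1 \<Longrightarrow> \<gamma> t \<noteq> 0" using fix_iff[of t] by auto
  show "- 1 < t \<Longrightarrow> t < 0 \<Longrightarrow> \<gamma> t \<noteq> 0" using fix_iff[of "t + 2"] gamma_periodic[of t] by auto
qed

text \<open>A real infimum bounds its family only if the family is bounded below. This follows from
  the periodicity of \<open>deriv \<phi>\<close> and the boundedness of \<psi>.\<close>

lemma slope_pos: "0 < 1 + \<psi> y * (deriv \<phi> x - 1)"
proof -
  have per: "deriv \<phi> (x + 2) = deriv \<phi> x" for x
  proof -
    have "((\<lambda>x. \<phi> (x + 2)) has_real_derivative deriv \<phi> (x + 2)) (at x)"
      using DERIV_shift[of \<phi> "deriv \<phi> (x + 2)" x 2] smooth_DERIV[OF phi(1)] by simp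
    moreover have "((\<lambda>x. \<phi> x + 2) has_real_derivative deriv \<phi> x + 0) (at x)"
      by (intro DERIV_add DERIV_const smooth_DERIV phi)
    ultimately show ?thesis using phi(2) DERIV_unique by fastforce
  qed
  have per_int: "deriv \<phi> (x + of_int n * 2) = deriv \<phi> x" for x n
    using shift_by_periods[of "deriv \<phi>" 0 x n] by (simp add: per)
  have "compact ((\<lambda>x. deriv \<phi> x - 1) ` {0..2})"
    by (intro compact_continuous_image continuous_intros smooth_continuous_deriv phi) simp
  then obtain B where B: "\<And>x. x \<in> {0..2} \<Longrightarrow> \<bar>deriv \<phi> x - 1\<bar> \<le> B"
    using compact_imp_bounded bounded_iff by (metis imageI real_norm_def)
  have bound: "\<bar>deriv \<phi> x - 1\<bar> \<le> B" for x
  proof -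
    define n where "n = \<lfloor>x / 2\<rfloor>"
    have "of_int n \<le> x / 2" "x / 2 < of_int n + 1" unfolding n_def by linarith+
    then have "\<bar>deriv \<phi> (x + of_int (- n) * 2) - 1\<bar> \<le> B" by (intro B) auto
    then show ?thesis by (simp only: per_int)
  qed
  obtain C where C: "\<And>x. \<bar>\<psi> x\<bar> \<le> C" using psi_bounded by blast
  have "\<bar>(deriv \<phi> x - 1) * \<psi> y\<bar> \<le> B * C" for x y
    unfolding abs_mult using bound[of x] C[of y] by (intro mult_mono) auto
  then have "bdd_below (range (\<lambda>(x, y). (deriv \<phi> x - 1) * \<psi> y))"
    by (intro bdd_belowI[of _ "- (B * C)"]) (auto simp: abs_le_iff minus_le_iff)
  then have "(INF (x, y). (deriv \<phi> x - 1) * \<psi> y) \<le> (case (x, y) of (x, y) \<Rightarrow> (deriv \<phi> x - 1) * \<psi> y)"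
    by (rule cINF_lower) simp
  then show ?thesis using phi(5) by (simp add: mult.commute)
qed

lemma phi_strict_mono: "strict_mono \<phi>"
proof (rule strict_monoI)
  fix s t :: real assume "s < t"
  then show "\<phi> s < \<phi> t"
  proof (rule DERIV_pos_imp_increasing)
    fix x
    have "\<psi> 0 = 1" using psi_eq_1[of 0] delta_pos by simp
    then show "\<exists>y. (\<phi> has_real_derivative y) (at x) \<and> 0 < y"
      using smooth_DERIV[OF phi(1), of x] slope_pos[of 0 x] by (intro exI[of _ "deriv \<phi> x"]) auto
  qed
qed

lemma phi_0: "\<phi> 0 = 0"
  using gamma_zeros by (simp add: \<gamma>_def)

text \<open>The slope -1/2 of \<gamma> at 0 determines its sign on either side of 0; with no zero
  before the next fixed point, the sign persists by the intermediate value theorem.\<close>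

lemma phi_attracts:
  "0 < t \<Longrightarrow> t < 1 \<Longrightarrow> 0 < \<phi> t \<and> \<phi> t < t"
  "- 1 < t \<Longrightarrow> t < 0 \<Longrightarrow> t < \<phi> t \<and> \<phi> t < 0"
proof -
  have cont: "continuous_on S \<gamma>" for S using C1_gamma by (rule C1_continuous)
  have "(\<gamma> has_real_derivative - (1/2)) (at 0)" using gamma_DERIV[of 0] phi(4) by simp
  from DERIV_neg_dec_right[OF this] DERIV_neg_dec_left[OF this]
  obtain d d' where d: "d > 0" "\<And>h. 0 < h \<Longrightarrow> h < d \<Longrightarrow> \<gamma> h < 0"
    and d': "d' > 0" "\<And>h. 0 < h \<Longrightarrow> h < d' \<Longrightarrow> 0 < \<gamma> (- h)"
    by (auto simp: gamma_zeros)
  show "0 < t \<Longrightarrow> t < 1 \<Longrightarrow> 0 < \<phi> t \<and> \<phi> t < t"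
  proof -
    assume t: "0 < t" "t < 1"
    have "\<gamma> t < 0"
    proof (rule ccontr)
      assume n: "\<not> \<gamma> t < 0"
      define s where "s = min t d / 2"
      have s: "0 < s" "s < d" "s < t" using t d by (auto simp: s_def min_def)
      have "\<exists>x. s \<le> x \<and> x \<le> t \<and> \<gamma> x = 0"
        by (rule IVT') (use s d n cont in \<open>auto intro: less_imp_le\<close>)
      then show False using gamma_nonzero(1) s t by (metis le_less_trans less_le_trans)
    qed
    then show ?thesis using strict_monoD[OF phi_strict_mono, of 0 t] t by (simp add: \<gamma>_def phi_0)
  qed
  show "- 1 < t \<Longrightarrow> t < 0 \<Longrightarrow> t < \<phi> t \<and> \<phi> t < 0"
  proof -
    assume t: "- 1 < t" "t < 0"
    have "\<gamma> t > 0"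
    proof (rule ccontr)
      assume n: "\<not> \<gamma> t > 0"
      define s where "s = min (- t) d' / 2"
      have s: "0 < s" "s < d'" "t < - s" using t d' by (auto simp: s_def min_def)
      have "\<exists>x. t \<le> x \<and> x \<le> - s \<and> \<gamma> x = 0"
        by (rule IVT') (use s d' n cont in \<open>auto intro: less_imp_le\<close>)
      then obtain x where "t \<le> x" "x \<le> - s" "\<gamma> x = 0" by blast
      then show False using gamma_nonzero(2)[of x] s t by auto
    qed
    then show ?thesis using strict_monoD[OF phi_strict_mono, of t 0] t by (simp add: \<gamma>_def phi_0)
  qed
qed

lemma cutoff_strict_mono: "strict_mono (\<lambda>t. t + \<psi> r * \<gamma> (t - s))"
proof (rule strict_monoI)
  fix a b :: real assume "a < b"
  then show "a + \<psi> r * \<gamma> (a - s) < b + \<psi> r * \<gamma> (b - s)"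
  proof (rule DERIV_pos_imp_increasing)
    fix x
    have "((\<lambda>t. \<gamma> (t - s)) has_real_derivative (deriv \<phi> (x - s) - 1) * (1 - 0)) (at x)"
      by (rule DERIV_chain2[OF gamma_DERIV]) (intro DERIV_diff DERIV_ident DERIV_const)
    then have "((\<lambda>t. t + \<psi> r * \<gamma> (t - s)) has_real_derivative 1 + \<psi> r * ((deriv \<phi> (x - s) - 1) * (1 - 0))) (at x)"
      by (intro DERIV_add DERIV_ident DERIV_cmult)
    then show "\<exists>y. ((\<lambda>t. t + \<psi> r * \<gamma> (t - s)) has_real_derivative y) (at x) \<and> 0 < y"
      using slope_pos[of r "x - s"] by (intro exI[of _ "1 + \<psi> r * (deriv \<phi> (x - s) - 1)"]) simp
  qed
qed

end

section \<open>The cat map: eigenvalues and dense leaves\<close>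

lemma Alin_linear: "linear Alin"
  by (rule linearI) (auto simp: Alin_def algebra_simps)

lemma Alin_iterate_linear: "linear (Alin ^^ n)"
proof (induction n)
  case 0
  show ?case using linear_id by (simp add: id_def)
next
  case (Suc n)
  then show ?case using linear_compose[OF Suc Alin_linear] by (simp only: funpow.simps)
qed

text \<open>The characteristic equation, arranged so that the positivity of both eigenvalues can be
  read off.\<close>

lemma Alin_eigenvalue: "v \<noteq> 0 \<Longrightarrow> Alin v = \<mu> *\<^sub>R v \<Longrightarrow> \<mu> * (3 - \<mu>) = 1"
proof -
  assume v: "v \<noteq> 0" "Alin v = \<mu> *\<^sub>R v"
  obtain a b where ab: "v = (a, b)" by (cases v)
  have e: "2 * a + b = \<mu> * a" "a + b = \<mu> * b" using v(2) by (auto simp: ab Alin_def)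
  have "(\<mu> * (3 - \<mu>) - 1) * a = 0" "(\<mu> * (3 - \<mu>) - 1) * b = 0" using e by algebra+
  then show ?thesis using v(1) by (auto simp: ab zero_prod_def)
qed

lemma A_tproj: "A (tproj v) = tproj (Alin v)"
  by (cases v) (simp add: A_def tproj_def Alin_def circ_add[symmetric])

lemma A_iterate_tproj: "(A ^^ n) (tproj v) = tproj ((Alin ^^ n) v)"
  by (induction n) (auto simp: A_tproj)

lemma A_add: "A (u + v) = A u + A v"
  by (cases u; cases v) (simp add: A_def algebra_simps)

lemma A_iterate_add: "(A ^^ n) (u + v) = (A ^^ n) u + (A ^^ n) v"
  by (induction n) (auto simp: A_add)

lemma A_bij: "bij A"
proof (rule o_bij)
  show "(\<lambda>(x, y). (x - y, y + y - x)) \<circ> A = id" "A \<circ> (\<lambda>(x, y). (x - y, y + y - x)) = id"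
    by (auto simp: A_def fun_eq_iff algebra_simps)
qed

lemma A_iterate_bij: "bij (A ^^ n)"
proof (induction n)
  case 0
  show ?case using bij_id by (simp add: id_def)
next
  case (Suc n)
  then show ?case using bij_comp[OF Suc A_bij] by (simp only: funpow.simps)
qed

lemma tproj_eq_0_iff: "tproj m = 0 \<longleftrightarrow> fst m \<in> \<int> \<and> snd m \<in> \<int>"
proof -
  have "(circ a :: 1 circle) = 0 \<longleftrightarrow> a \<in> \<int>" for a
    using circ_eq_iff[of a 0, where 'n = 1] by (auto simp: periods_def Ints_def)
  then show ?thesis by (cases m) (simp add: tproj_def zero_prod_def)
qed

text \<open>Integer matrices contract the pairing of lattice vectors with the vector \<open>e\<close>, so
  these pairings accumulate at zero.\<close>

lemma lattice_dense:
  fixes B :: "real \<times> real \<Rightarrow> real \<times> real"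
  assumes lattice: "\<And>m. tproj m = 0 \<Longrightarrow> tproj (B m) = 0" and e: "e \<noteq> 0"
    and contr: "\<And>m. B m \<bullet> e = \<mu> * (m \<bullet> e)" "0 < \<mu>" "\<mu> < 1" and \<epsilon>: "0 < \<epsilon>"
  shows "\<exists>m. tproj m = 0 \<and> \<bar>m \<bullet> e - \<alpha>\<bar> < \<epsilon>"
proof -
  obtain m0 where m0: "tproj m0 = 0" "m0 \<bullet> e \<noteq> 0"
  proof (cases "fst e = 0")
    case True
    have "tproj (0, 1) = 0" by (simp add: tproj_eq_0_iff)
    moreover have "snd e \<noteq> 0" using e True by (cases e) (auto simp: zero_prod_def)
    ultimately show ?thesis using that[of "(0, 1)"] by (cases e) simp
  next
    case False
    then show ?thesis using that[of "(1, 0)"] by (cases e) (auto simp: tproj_eq_0_iff)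
  qed
  have iter: "(B ^^ n) m0 \<bullet> e = \<mu> ^ n * (m0 \<bullet> e) \<and> tproj ((B ^^ n) m0) = 0" for n
    by (induction n) (auto simp: m0 contr lattice)
  have "(\<lambda>n. \<mu> ^ n * (m0 \<bullet> e)) \<longlonglongrightarrow> 0 * (m0 \<bullet> e)"
    using contr by (intro tendsto_mult tendsto_const LIMSEQ_power_zero) auto
  then have "(\<lambda>n. \<mu> ^ n * (m0 \<bullet> e)) \<longlonglongrightarrow> 0" by simp
  from tendstoD[OF this \<epsilon>] obtain n where n: "\<bar>\<mu> ^ n * (m0 \<bullet> e)\<bar> < \<epsilon>"
    by (auto simp: eventually_sequentially)
  define \<eta> where "\<eta> = \<mu> ^ n * (m0 \<bullet> e)"
  \<comment> \<open>The pairing of the iterated lattice vector is the small number \<eta>, so its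
    integer multiples come within \<epsilon> of any \<alpha>.\<close>
  define m where "m = of_int \<lfloor>\<alpha> / \<eta>\<rfloor> *\<^sub>R (B ^^ n) m0"
  have \<eta>: "\<eta> \<noteq> 0" "\<bar>\<eta>\<bar> < \<epsilon>" using m0 contr n by (auto simp: \<eta>_def)
  have "tproj m = 0" using iter[of n] by (simp add: m_def tproj_eq_0_iff)
  moreover have "\<bar>m \<bullet> e - \<alpha>\<bar> < \<epsilon>"
  proof -
    have "m \<bullet> e - \<alpha> = (of_int \<lfloor>\<alpha> / \<eta>\<rfloor> - \<alpha> / \<eta>) * \<eta>"
      using iter[of n] \<eta> by (simp add: m_def \<eta>_def[symmetric] left_diff_distrib)
    moreover have "\<bar>of_int \<lfloor>\<alpha> / \<eta>\<rfloor> - \<alpha> / \<eta>\<bar> \<le> 1" by linarith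
    ultimately have "\<bar>m \<bullet> e - \<alpha>\<bar> \<le> 1 * \<bar>\<eta>\<bar>" by (simp only: abs_mult) (intro mult_right_mono, auto)
    then show ?thesis using \<eta> by simp
  qed
  ultimately show ?thesis by blast
qed

locale cat_map = orthonormal_plane eu es
  for eu es :: "real \<times> real" +
  fixes \<mu>u \<mu>s :: real
  assumes eigen: "Alin eu = \<mu>u *\<^sub>R eu" "\<bar>\<mu>u\<bar> > 1" "Alin es = \<mu>s *\<^sub>R es" "\<bar>\<mu>s\<bar> < 1"
begin

lemma mu: "1 < \<mu>u" "0 < \<mu>s" "\<mu>s < 1"
proof -
  have "eu \<noteq> 0" "es \<noteq> 0" using norm_eu norm_es by auto
  then have e: "\<mu>u * (3 - \<mu>u) = 1" "\<mu>s * (3 - \<mu>s) = 1"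
    using Alin_eigenvalue eigen(1,3) by blast+
  have pos: "0 < \<mu>" if "\<mu> * (3 - \<mu>) = 1" for \<mu> :: real
  proof (rule ccontr)
    assume "\<not> 0 < \<mu>"
    then have "\<mu> * (3 - \<mu>) \<le> 0" by (intro mult_nonpos_nonneg) auto
    then show False using that by simp
  qed
  show "1 < \<mu>u" "0 < \<mu>s" "\<mu>s < 1" using pos[OF e(1)] pos[OF e(2)] eigen by auto
qed

lemma iterate_eigen: "(Alin ^^ n) eu = \<mu>u ^ n *\<^sub>R eu" "(Alin ^^ n) es = \<mu>s ^ n *\<^sub>R es"
  by (induction n) (simp_all add: linear_scale[OF Alin_linear] eigen mult.commute)

lemma max_eigenvalue_iterate: "max_eigenvalue (Alin ^^ n) = \<mu>u ^ n"
proof -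
  have "{\<mu>. \<exists>v. v \<noteq> 0 \<and> (Alin ^^ n) v = \<mu> *\<^sub>R v} = {\<mu>u ^ n, \<mu>s ^ n}" (is "?S = _")
  proof
    show "{\<mu>u ^ n, \<mu>s ^ n} \<subseteq> ?S"
    proof -
      have "eu \<noteq> 0" "es \<noteq> 0" using norm_eu norm_es by auto
      then show ?thesis using iterate_eigen[of n] by blast
    qed
    show "?S \<subseteq> {\<mu>u ^ n, \<mu>s ^ n}"
    proof
      fix \<mu> assume "\<mu> \<in> ?S"
      then obtain v where v: "v \<noteq> 0" "(Alin ^^ n) v = \<mu> *\<^sub>R v" by blast
      have "(Alin ^^ n) v = (Alin ^^ n) ((v \<bullet> eu) *\<^sub>R eu + (v \<bullet> es) *\<^sub>R es)" using expand[of v] by simp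
      also have "\<dots> = (v \<bullet> eu) *\<^sub>R \<mu>u ^ n *\<^sub>R eu + (v \<bullet> es) *\<^sub>R \<mu>s ^ n *\<^sub>R es"
        by (simp only: linear_add[OF Alin_iterate_linear] linear_scale[OF Alin_iterate_linear] iterate_eigen)
      finally have eq: "\<mu> *\<^sub>R v = (v \<bullet> eu) *\<^sub>R \<mu>u ^ n *\<^sub>R eu + (v \<bullet> es) *\<^sub>R \<mu>s ^ n *\<^sub>R es" using v by simp
      have "\<mu> * (v \<bullet> eu) = \<mu>u ^ n * (v \<bullet> eu)" "\<mu> * (v \<bullet> es) = \<mu>s ^ n * (v \<bullet> es)"
        using arg_cong[OF eq, of "\<lambda>w. w \<bullet> eu"] arg_cong[OF eq, of "\<lambda>w. w \<bullet> es"]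
        by (simp_all add: inner_add_left)
      moreover have "v \<bullet> eu \<noteq> 0 \<or> v \<bullet> es \<noteq> 0" using v(1) plane_eqI[of v 0] by auto
      ultimately show "\<mu> \<in> {\<mu>u ^ n, \<mu>s ^ n}" by auto
    qed
  qed
  moreover have "\<mu>s ^ n \<le> \<mu>u ^ n" using mu by (intro power_mono) auto
  ultimately show ?thesis unfolding max_eigenvalue_def by simp
qed

text \<open>The matrix is symmetric, so its eigenvectors also diagonalise the pairing.\<close>

lemma Alin_inner: "Alin m \<bullet> es = \<mu>s * (m \<bullet> es)" "Alin m \<bullet> eu = \<mu>u * (m \<bullet> eu)"
proof -
  have "Alin m \<bullet> w = m \<bullet> Alin w" for w
    by (cases m; cases w) (simp add: Alin_def algebra_simps)
  then show "Alin m \<bullet> es = \<mu>s * (m \<bullet> es)" "Alin m \<bullet> eu = \<mu>u * (m \<bullet> eu)"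
    by (simp_all add: eigen)
qed

lemma lattice_dense_es: "0 < \<epsilon> \<Longrightarrow> \<exists>m. tproj m = 0 \<and> \<bar>m \<bullet> es - \<alpha>\<bar> < \<epsilon>"
proof (rule lattice_dense[of Alin es \<mu>s])
  show "tproj m = 0 \<Longrightarrow> tproj (Alin m) = 0" for m
    by (cases m) (auto simp: tproj_eq_0_iff Alin_def intro!: Ints_add Ints_mult)
qed (use mu norm_es Alin_inner in auto)

text \<open>\<open>Alin\<close> expands the pairing with \<open>eu\<close>. Its inverse contracts it
  and is again an integer matrix, as the determinant is 1.\<close>

lemma lattice_dense_eu: "0 < \<epsilon> \<Longrightarrow> \<exists>m. tproj m = 0 \<and> \<bar>m \<bullet> eu - \<alpha>\<bar> < \<epsilon>"
proof (rule lattice_dense[of "\<lambda>(a, b). (a - b, 2 * b - a)" eu "1 / \<mu>u"])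
  show "tproj m = 0 \<Longrightarrow> tproj (case m of (a, b) \<Rightarrow> (a - b, 2 * b - a)) = 0" for m
    by (cases m) (auto simp: tproj_eq_0_iff intro!: Ints_diff Ints_mult)
  show "(case m of (a, b) \<Rightarrow> (a - b, 2 * b - a)) \<bullet> eu = 1 / \<mu>u * (m \<bullet> eu)" for m
  proof -
    have "Alin (case m of (a, b) \<Rightarrow> (a - b, 2 * b - a)) = m" by (cases m) (simp add: Alin_def)
    then show ?thesis using Alin_inner(2)[of "case m of (a, b) \<Rightarrow> (a - b, 2 * b - a)"] mu by simp
  qed
qed (use mu norm_eu in auto)

text \<open>The lifts of \<open>w - q\<close> differ by lattice vectors, so one of them has an
  \<open>es\<close> component smaller than \<epsilon>. Its \<open>eu\<close> component is the
  parameter \<open>a\<close>.\<close>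

lemma leaf_u_dense: "0 < \<epsilon> \<Longrightarrow> \<exists>a. dist (q + tproj (a *\<^sub>R eu)) w < \<epsilon>"
proof -
  assume \<epsilon>: "0 < \<epsilon>"
  obtain D where D: "w - q = tproj D" using tproj.pr_surj by blast
  obtain m where m: "tproj m = 0" "\<bar>m \<bullet> es - (- (D \<bullet> es))\<bar> < \<epsilon>" using lattice_dense_es[OF \<epsilon>] by blast
  define a where "a = (D + m) \<bullet> eu"
  have w: "w = q + tproj (D + m)" using D m by (simp add: tproj.pr_add algebra_simps)
  have "a *\<^sub>R eu - (D + m) = - ((D + m) \<bullet> es) *\<^sub>R es"
    using expand[of "D + m"] by (simp add: a_def algebra_simps)
  then have "norm (a *\<^sub>R eu - (D + m)) < \<epsilon>" using m(2) norm_es by (simp add: inner_add_left)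
  then show ?thesis unfolding w using tproj.dist_pr_le[of q "a *\<^sub>R eu" "D + m"] by (intro exI[of _ a]) simp
qed

text \<open>The witness \<open>x0\<close> is a lift \<open>v + m\<close> of \<open>q\<close>, and
  \<open>c\<close> is its \<open>eu\<close> coordinate; lattice translates make these coordinates
  dense.\<close>

lemma leaf_s_dense: "0 < \<epsilon> \<Longrightarrow> \<exists>c x0. \<bar>c - \<alpha>\<bar> < \<epsilon> \<and>
    (\<forall>x. x \<bullet> eu = c \<longrightarrow> tproj x = q + tproj (((x - x0) \<bullet> es) *\<^sub>R es))"
proof -
  assume \<epsilon>: "0 < \<epsilon>"
  obtain v where v: "q = tproj v" using tproj.pr_surj by blast
  obtain m where m: "tproj m = 0" "\<bar>m \<bullet> eu - (\<alpha> - v \<bullet> eu)\<bar> < \<epsilon>" using lattice_dense_eu[OF \<epsilon>] by blast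
  have "tproj x = q + tproj (((x - (v + m)) \<bullet> es) *\<^sub>R es)" if "x \<bullet> eu = (v + m) \<bullet> eu" for x
  proof -
    have "x - (v + m) = ((x - (v + m)) \<bullet> es) *\<^sub>R es" using that by (intro eq_scale_es) (simp add: inner_diff_left)
    then have "x = (v + m) + ((x - (v + m)) \<bullet> es) *\<^sub>R es" by (simp add: algebra_simps)
    then have "tproj x = tproj (v + m) + tproj (((x - (v + m)) \<bullet> es) *\<^sub>R es)" by (metis tproj.pr_add)
    then show ?thesis using m(1) by (simp add: tproj.pr_add v)
  qed
  moreover have "\<bar>(v + m) \<bullet> eu - \<alpha>\<bar> < \<epsilon>" using m(2) by (simp add: inner_add_left)
  ultimately show ?thesis by blast
qed

end

section \<open>The example\<close>

context orthonormal_plane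
begin

lemma norm_combination: "norm (a *\<^sub>R eu + b *\<^sub>R es) = sqrt (a\<^sup>2 + b\<^sup>2)"
  by (simp add: norm_eq_sqrt_inner inner_add_left inner_add_right power2_eq_square)

lemma inner_combination [simp]:
  "(a *\<^sub>R eu + b *\<^sub>R es) \<bullet> eu = a" "(a *\<^sub>R eu + b *\<^sub>R es) \<bullet> es = b"
  by (simp_all add: inner_add_left)

lemma inner_self: "x \<bullet> x = (x \<bullet> eu)\<^sup>2 + (x \<bullet> es)\<^sup>2"
proof -
  have "x \<bullet> x = ((x \<bullet> eu) *\<^sub>R eu + (x \<bullet> es) *\<^sub>R es) \<bullet> x" by (subst (1) expand[of x]) (rule refl)
  also have "\<dots> = (x \<bullet> eu) * (eu \<bullet> x) + (x \<bullet> es) * (es \<bullet> x)"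
    by (simp only: inner_add_left inner_scaleR_left)
  finally show ?thesis by (simp add: inner_commute power2_eq_square)
qed

text \<open>The factor 8 rounds up 5 times the square root of 2.\<close>

lemma norm_square: "(a, b) \<in> square \<Longrightarrow> norm (a *\<^sub>R eu + b *\<^sub>R es) < 8 * \<delta>"
proof -
  assume "(a, b) \<in> square"
  then have ab: "\<bar>a\<bar> < 5 * \<delta>" "\<bar>b\<bar> < 5 * \<delta>" by (auto simp: square_def)
  have "a\<^sup>2 < (5 * \<delta>)\<^sup>2" "b\<^sup>2 < (5 * \<delta>)\<^sup>2"     using power_strict_mono[of "\<bar>a\<bar>" "5 * \<delta>" 2] power_strict_mono[of "\<bar>b\<bar>" "5 * \<delta>" 2] ab by simp_all
  moreover have "(5 * \<delta>)\<^sup>2 + (5 * \<delta>)\<^sup>2 \<le> (8 * \<delta>)\<^sup>2" by (simp add: power_mult_distrib)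
  ultimately have "a\<^sup>2 + b\<^sup>2 < (8 * \<delta>)\<^sup>2" by linarith
  then have "sqrt (a\<^sup>2 + b\<^sup>2) < sqrt ((8 * \<delta>)\<^sup>2)" by (rule real_sqrt_less_mono)
  also have "sqrt ((8 * \<delta>)\<^sup>2) = 8 * \<delta>" using delta_pos by (subst real_sqrt_abs) simp
  finally show ?thesis by (simp add: norm_combination)
qed

lemma coords_eq:
  assumes "(a, b) \<in> square"
  shows "coords eu es p (p + tproj (a *\<^sub>R eu + b *\<^sub>R es)) = (a, b)"
proof -
  have "inj_on (eu_es_point eu es p) square"
  proof (rule inj_onI)
    fix u v assume uv: "u \<in> square" "v \<in> square" "eu_es_point eu es p u = eu_es_point eu es p v"
    obtain a b c d where ab: "u = (a, b)" "v = (c, d)" by (metis surj_pair)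
    have "norm ((a *\<^sub>R eu + b *\<^sub>R es) - (c *\<^sub>R eu + d *\<^sub>R es)) \<le> norm (a *\<^sub>R eu + b *\<^sub>R es) + norm (c *\<^sub>R eu + d *\<^sub>R es)"
      by (rule norm_triangle_ineq4)
    also have "\<dots> < 8 * \<delta> + 8 * \<delta>" using uv norm_square unfolding ab by (intro add_strict_mono) auto
    also have "\<dots> < 1" by (simp add: \<delta>_def)
    finally have "a *\<^sub>R eu + b *\<^sub>R es = c *\<^sub>R eu + d *\<^sub>R es"
      using uv(3) by (intro tproj.pr_inj) (auto simp: ab eu_es_point_def)
    then show "u = v" unfolding ab by (metis inner_combination)
  qed
  from the_inv_into_f_f[OF this assms] show ?thesis
    by (simp add: coords_def eu_es_point_def)
qed

lemma boxE:
  assumes "x \<in> box eu es p"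
  obtains a b where "(a, b) \<in> square" "x = p + tproj (a *\<^sub>R eu + b *\<^sub>R es)" "coords eu es p x = (a, b)"
    "dist x p = sqrt (a\<^sup>2 + b\<^sup>2)" "dist x p < 8 * \<delta>"
proof -
  obtain a b where ab: "(a, b) \<in> square" "x = p + tproj (a *\<^sub>R eu + b *\<^sub>R es)"
    using assms unfolding box_def eu_es_point_def by auto
  have "norm (a *\<^sub>R eu + b *\<^sub>R es) < 1/2" using norm_square[OF ab(1)] by (simp add: \<delta>_def)
  then have "dist x p = norm (a *\<^sub>R eu + b *\<^sub>R es)" using ab(2) tproj.dist_pr by blast
  then show ?thesis
    using that[OF ab] coords_eq[OF ab(1)] norm_square[OF ab(1)] ab(2) norm_combination by simp
qed

lemma not_box_dist: "x \<notin> box eu es p \<Longrightarrow> 5 * \<delta> \<le> dist x p"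
proof (rule ccontr)
  assume x: "x \<notin> box eu es p" "\<not> 5 * \<delta> \<le> dist x p"
  obtain v where v: "x = p + tproj v" "norm v = dist x p" using tproj.ex_lift by blast
  have "\<bar>v \<bullet> eu\<bar> \<le> norm v" "\<bar>v \<bullet> es\<bar> \<le> norm v"
    using Cauchy_Schwarz_ineq2[of v eu] Cauchy_Schwarz_ineq2[of v es] norm_eu norm_es by auto
  then have "(v \<bullet> eu, v \<bullet> es) \<in> square" using x(2) v(2) by (auto simp: square_def)
  moreover have "x = eu_es_point eu es p (v \<bullet> eu, v \<bullet> es)"
    using v(1) expand[of v] by (simp add: eu_es_point_def)
  ultimately show False using x(1) by (auto simp: box_def)
qed

end

lemma circ2_eq: "(circ a :: 2 circle) = circ b \<longleftrightarrow> (\<exists>n::int. a = b + of_int n * 2)"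
  unfolding circ_eq_iff periods_def by (auto simp: image_iff algebra_simps)

lemma rep2: "-1 \<le> rep2 y" "rep2 y < 1" "circ (rep2 y) = y"
proof -
  have "\<exists>!r. -1 \<le> r \<and> r < 1 \<and> circ r = y"
  proof (rule ex_ex1I)
    show "\<exists>r. -1 \<le> r \<and> r < 1 \<and> circ r = y" using circ_rep[of y 0] by auto
    fix r s assume rs: "-1 \<le> r \<and> r < 1 \<and> circ r = y" "-1 \<le> s \<and> s < 1 \<and> circ s = y"
    then obtain n :: int where n: "r = s + of_int n * 2" using circ2_eq by metis
    then have "\<bar>real_of_int n\<bar> < 1" using rs by auto
    then show "r = s" using n by simp
  qed
  from theI'[OF this] show "-1 \<le> rep2 y" "rep2 y < 1" "circ (rep2 y) = y"
    unfolding rep2_def by auto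
qed

text \<open>A lift shorter than 1/4 would differ from the representative in [-1, 1) by less than 2,
  hence not at all.\<close>

lemma dist_circ_rep2: "1/4 \<le> \<bar>rep2 (y - circ s)\<bar> \<Longrightarrow> 1/4 \<le> dist y (circ s)"
proof (rule ccontr)
  define c where "c = rep2 (y - circ s)"
  assume c: "1/4 \<le> \<bar>rep2 (y - circ s)\<bar>" "\<not> 1/4 \<le> dist y (circ s)"
  obtain w where w: "y = circ s + circ w" "norm w = dist y (circ s)" using circ.ex_lift by blast
  have "(circ c :: 2 circle) = y - circ s" unfolding c_def by (rule rep2(3))
  then have "(circ c :: 2 circle) = circ w" using w(1) by simp
  then obtain n :: int where n: "c = w + of_int n * 2" using circ2_eq by metis
  have "-1 \<le> c" "c < 1" unfolding c_def using rep2 by auto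
  then have "\<bar>real_of_int n\<bar> < 1" using n w(2) c(2) by auto
  then have "c = w" using n by simp
  then show False using c w(2) by (simp add: c_def)
qed

section \<open>Global formulas for the constructed map\<close>

locale example = cat_map eu es \<mu>u \<mu>s + circle_map \<psi> \<phi>
  for eu es \<mu>u \<mu>s \<psi> \<phi> +
  fixes k :: real and n\<^sub>0 n\<^sub>1 :: nat and p1 p2 q1 q2 :: torus
  assumes far: "dist p1 p2 > 10 * \<delta>" "dist p1 q1 > 10 * \<delta>" "dist p1 q2 > 10 * \<delta>"
      "dist p2 q1 > 10 * \<delta>" "dist p2 q2 > 10 * \<delta>" "dist q1 q2 > 10 * \<delta>"
    and expanding: "1 < \<mu>u ^ n\<^sub>0" "1 < \<mu>u ^ n\<^sub>1"
    and k: "2 < k"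
    and P_slope: "\<And>v. \<bar>partial (\<lambda>w. \<mu>u ^ n\<^sub>0 * P \<psi> (\<mu>u ^ n\<^sub>0) k w) (0, 0, 0, 1, 0) v\<bar> < \<mu>u ^ n\<^sub>1"
begin

definition f :: "mfd \<Rightarrow> mfd" where
  "f = f_map \<psi> \<phi> n\<^sub>0 n\<^sub>1 k eu es p1 p2 q1 q2"

definition g2 :: "torus \<Rightarrow> 2 circle \<Rightarrow> 2 circle" where
  "g2 = I2 \<psi> \<phi> eu es p1 p2 q1 q2"

text \<open>The four boxes in one formula without cases. The centres are more than
  \<open>10 * \<delta>\<close> apart, so at any point at most one of the cutoffs is nonzero.\<close>

definition G :: "real \<times> real \<Rightarrow> real \<Rightarrow> real" where
  "G x t = t + (\<psi> (dist (tproj x) p1) + \<psi> (dist (tproj x) q1)) * \<gamma> t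
             + (\<psi> (dist (tproj x) p2) + \<psi> (dist (tproj x) q2)) * \<gamma> (t - 1)"

text \<open>\<open>P (a, b, c, d, e) - d\<close> in orthonormal coordinates.\<close>

definition K :: "R5 \<Rightarrow> real" where
  "K = (\<lambda>(x, y, z). \<psi> (k * (z \<bullet> eu)) * \<theta> (k\<^sup>2 * (x \<bullet> x + y\<^sup>2 + (z \<bullet> es)\<^sup>2))
      * ((3 / (4 * \<mu>u ^ n\<^sub>0) - 1) * (z \<bullet> eu)))"

definition h :: "mfd \<Rightarrow> real" where
  "h m = proj.bump (p1, circ 0, p1) K m + proj.bump (p2, circ 1, p2) K m"

lemma k_small: "2 * \<delta> / k < \<delta>"
  using k delta_pos by (simp add: field_simps)

lemma K_eq_P: "P \<psi> (\<mu>u ^ n\<^sub>0) k (x \<bullet> eu, x \<bullet> es, y, z \<bullet> eu, z \<bullet> es) = z \<bullet> eu + K (x, y, z)"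
proof -
  have "\<theta> (k\<^sup>2 * (x \<bullet> x + y\<^sup>2 + (z \<bullet> es)\<^sup>2)) = \<psi> (k * sqrt ((x \<bullet> eu)\<^sup>2 + (x \<bullet> es)\<^sup>2 + y\<^sup>2 + (z \<bullet> es)\<^sup>2))"
    using k by (simp add: theta_eq real_sqrt_mult inner_self)
  then show ?thesis by (simp add: P_def K_def algebra_simps)
qed

text \<open>Two squares add up to at least \<open>4 * \<delta>\<^sup>2\<close>, so one of them is at
  least \<open>\<delta>\<^sup>2\<close> and the corresponding cutoff vanishes.\<close>

lemma K_eq_0: "2 * \<delta> / k \<le> norm v \<Longrightarrow> K v = 0"
proof -
  assume v: "2 * \<delta> / k \<le> norm v"
  obtain x y z where xyz: "v = (x, y, z)" by (metis surj_pair)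
  have "2 * \<delta> \<le> k * norm v" using v k by (simp add: field_simps)
  then have "(2 * \<delta>)\<^sup>2 \<le> (k * norm v)\<^sup>2" using delta_pos by (intro power_mono) auto
  also have "\<dots> = k\<^sup>2 * (x \<bullet> x + y\<^sup>2 + (z \<bullet> es)\<^sup>2) + (k * (z \<bullet> eu))\<^sup>2"
  proof -
    have "(norm v)\<^sup>2 = x \<bullet> x + y\<^sup>2 + ((z \<bullet> eu)\<^sup>2 + (z \<bullet> es)\<^sup>2)"
      unfolding power2_norm_eq_inner xyz inner_self[of z, symmetric] by (simp add: power2_eq_square)
    then show ?thesis by (simp add: power_mult_distrib algebra_simps)
  qed
  finally have sum: "(2 * \<delta>)\<^sup>2 \<le> k\<^sup>2 * (x \<bullet> x + y\<^sup>2 + (z \<bullet> es)\<^sup>2) + (k * (z \<bullet> eu))\<^sup>2" .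
  show "K v = 0"
  proof (cases "\<delta> \<le> \<bar>k * (z \<bullet> eu)\<bar>")
    case True
    then show ?thesis by (simp add: K_def xyz psi_eq_0)
  next
    case False
    then have "(k * (z \<bullet> eu))\<^sup>2 \<le> \<delta>\<^sup>2" using abs_le_square_iff[of "k * (z \<bullet> eu)" \<delta>] delta_pos by simp
    then have le: "\<delta>\<^sup>2 \<le> k\<^sup>2 * (x \<bullet> x + y\<^sup>2 + (z \<bullet> es)\<^sup>2)"
      using sum zero_le_power2[of \<delta>] unfolding power_mult_distrib[of 2 \<delta> 2] power2_eq_square[of "2::real"]
      by linarith
    then have "\<delta> \<le> sqrt (k\<^sup>2 * (x \<bullet> x + y\<^sup>2 + (z \<bullet> es)\<^sup>2))" by (rule real_le_rsqrt)
    moreover have "0 \<le> k\<^sup>2 * (x \<bullet> x + y\<^sup>2 + (z \<bullet> es)\<^sup>2)" using le by (rule order_trans[rotated]) simp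
    ultimately have "\<theta> (k\<^sup>2 * (x \<bullet> x + y\<^sup>2 + (z \<bullet> es)\<^sup>2)) = 0" by (simp add: theta_eq psi_eq_0)
    then show ?thesis by (simp add: K_def xyz)
  qed
qed

lemma C1_K: "C1 K"
proof -
  have 1: "C1 (\<lambda>v::R5. fst v)" "C1 (\<lambda>v::R5. fst (snd v))" "C1 (\<lambda>v::R5. snd (snd v) \<bullet> eu)" "C1 (\<lambda>v::R5. snd (snd v) \<bullet> es)"
    by (intro C1_bounded_linear bounded_linear_fst bounded_linear_snd bounded_linear_compose[OF bounded_linear_fst]
        bounded_linear_compose[OF bounded_linear_snd] bounded_linear_compose[OF bounded_linear_inner_left])+
  have "K = (\<lambda>v. \<psi> (k * (snd (snd v) \<bullet> eu)) * \<theta> (k\<^sup>2 * (fst v \<bullet> fst v + fst (snd v) * fst (snd v)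
        + (snd (snd v) \<bullet> es) * (snd (snd v) \<bullet> es))) * ((3 / (4 * \<mu>u ^ n\<^sub>0) - 1) * (snd (snd v) \<bullet> eu)))"
    by (auto simp: K_def power2_eq_square)
  moreover have "C1 \<dots>"
    by (intro C1_mult C1_compose[OF C1_smooth[OF psi(1)]] C1_compose[OF C1_theta] C1_add C1_const
        C1_compose[OF C1_norm_sq] 1)
  ultimately show ?thesis by simp
qed

lemma bump_eq_0_far: "\<delta> \<le> dist m p \<Longrightarrow> proj.bump p K m = 0"
  by (rule proj.bump_eq_0[OF K_eq_0]) (use k_small in auto)

lemma dist_fst: "dist x p \<le> dist (x, y, z) (p, c, p' :: torus)"
  using dist_fst_le[of "(x, y, z)" "(p, c, p')"] by simp

lemma bump_bounded: obtains M where "\<And>m p. \<bar>proj.bump p K m\<bar> \<le> M"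
proof -
  obtain M where "\<And>v. \<bar>K v\<bar> \<le> M" using C1_compact_support_bounded[OF C1_K K_eq_0] by blast
  then show ?thesis using that[of M] unfolding proj.bump_def by blast
qed

lemma Qc_circ: "Qc \<psi> \<phi> (a, b) (circ t) = circ (t + \<psi> (sqrt (a\<^sup>2 + b\<^sup>2)) * \<gamma> t)"
proof -
  obtain n :: int where n: "rep2 (circ t) = t + of_int n * 2" using rep2(3)[of "circ t"] unfolding circ2_eq by blast
  have "Q \<psi> \<phi> (a, b, rep2 (circ t)) = rep2 (circ t) + \<psi> (sqrt (a\<^sup>2 + b\<^sup>2)) * \<gamma> (rep2 (circ t))"
    by (simp add: Q_def \<gamma>_def algebra_simps)
  also have "\<dots> = t + \<psi> (sqrt (a\<^sup>2 + b\<^sup>2)) * \<gamma> t + of_int n * 2" by (simp add: n gamma_periodic_int)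
  finally have "(circ (Q \<psi> \<phi> (a, b, rep2 (circ t))) :: 2 circle) = circ (t + \<psi> (sqrt (a\<^sup>2 + b\<^sup>2)) * \<gamma> t)"
    unfolding circ2_eq by blast
  then show ?thesis by (simp add: Qc_def)
qed

lemma Qc_circ_1: "circ 1 + Qc \<psi> \<phi> (a, b) (circ t - circ 1) = circ (t + \<psi> (sqrt (a\<^sup>2 + b\<^sup>2)) * \<gamma> (t - 1))"
  using Qc_circ[of a b "t - 1"] by (simp add: circ.pr_diff flip: circ_add)

lemma psi_dist_eq_0: "dist x p < 9 * \<delta> \<Longrightarrow> dist p p' > 10 * \<delta> \<or> dist p' p > 10 * \<delta> \<Longrightarrow> \<psi> (dist x p') = 0"
proof (rule psi_eq_0)
  assume x: "dist x p < 9 * \<delta>" and "dist p p' > 10 * \<delta> \<or> dist p' p > 10 * \<delta>"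
  then have "10 * \<delta> < dist p p'" unfolding dist_commute[of p' p] by blast
  then show "\<delta> \<le> \<bar>dist x p'\<bar>" using x dist_triangle3[of p p' x] by linarith
qed

text \<open>Inside a box the cutoffs at the other centres vanish, which also settles overlaps.
  Outside a box the distance to its centre is at least \<open>5 * \<delta>\<close>, beyond the
  support of its cutoff.\<close>

lemma g2_circ: "g2 (tproj x) (circ t) = circ (G x t)"
proof -
  have out: "\<psi> (dist y p) = 0" if "y \<notin> box eu es p" for y p
    using not_box_dist[OF that] delta_pos by (intro psi_eq_0) auto
  have inside: "\<exists>a b. coords eu es p (tproj x) = (a, b) \<and> dist (tproj x) p = sqrt (a\<^sup>2 + b\<^sup>2) \<and>
      (\<forall>p'. dist p p' > 10 * \<delta> \<or> dist p' p > 10 * \<delta> \<longrightarrow> \<psi> (dist (tproj x) p') = 0)"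
    if x: "tproj x \<in> box eu es p" for p
  proof -
    obtain a b where "coords eu es p (tproj x) = (a, b)" "dist (tproj x) p = sqrt (a\<^sup>2 + b\<^sup>2)"
      "dist (tproj x) p < 8 * \<delta>" using x by (rule boxE)
    moreover from this have "dist (tproj x) p < 9 * \<delta>" using delta_pos by linarith
    ultimately show ?thesis using psi_dist_eq_0 by blast
  qed
  consider "tproj x \<in> box eu es p1" | "tproj x \<notin> box eu es p1" "tproj x \<in> box eu es p2"
    | "tproj x \<notin> box eu es p1" "tproj x \<notin> box eu es p2" "tproj x \<in> box eu es q1"
    | "tproj x \<notin> box eu es p1" "tproj x \<notin> box eu es p2" "tproj x \<notin> box eu es q1" "tproj x \<in> box eu es q2"
    | "tproj x \<notin> box eu es p1" "tproj x \<notin> box eu es p2" "tproj x \<notin> box eu es q1" "tproj x \<notin> box eu es q2"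
    by blast
  then show ?thesis
  proof cases
    case 1
    then show ?thesis using inside[of p1] far by (auto simp: g2_def I2_def G_def Qc_circ simp del: split_paired_All)
  next
    case 2
    then show ?thesis using inside[of p2] far by (auto simp: g2_def I2_def G_def Qc_circ_1 simp del: split_paired_All)
  next
    case 3
    then show ?thesis using inside[of q1] far by (auto simp: g2_def I2_def G_def Qc_circ simp del: split_paired_All)
  next
    case 4
    then show ?thesis using inside[of q2] far by (auto simp: g2_def I2_def G_def Qc_circ_1 simp del: split_paired_All)
  next
    case 5
    then show ?thesis by (simp add: g2_def I2_def G_def out)
  qed
qed

lemma G_cases: "\<exists>r s. \<forall>t. G x t = t + \<psi> r * \<gamma> (t - s)"
proof -
  define D where "D = dist (tproj x)"
  have zero: "\<psi> (D p') = 0" if "\<psi> (D p) \<noteq> 0" "dist p p' > 10 * \<delta> \<or> dist p' p > 10 * \<delta>" for p p'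
  proof -
    have "\<not> \<delta> \<le> \<bar>D p\<bar>" using that(1) psi_eq_0 by blast
    then have "D p < \<delta>" by (simp add: D_def)
    then show ?thesis using psi_dist_eq_0[OF _ that(2)] delta_pos by (simp add: D_def)
  qed
  have eq: "G x t = t + (\<psi> (D p1) + \<psi> (D q1)) * \<gamma> t + (\<psi> (D p2) + \<psi> (D q2)) * \<gamma> (t - 1)" for t
    by (simp add: G_def D_def)
  consider "\<psi> (D p1) \<noteq> 0" | "\<psi> (D q1) \<noteq> 0" | "\<psi> (D p2) \<noteq> 0" | "\<psi> (D q2) \<noteq> 0"
    | "\<psi> (D p1) = 0" "\<psi> (D q1) = 0" "\<psi> (D p2) = 0" "\<psi> (D q2) = 0" by blast
  then show ?thesis
  proof cases
    case 1
    then have "G x t = t + \<psi> (D p1) * \<gamma> (t - 0)" for t using zero[OF 1] far by (simp add: eq)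
    then show ?thesis by blast
  next
    case 2
    then have "G x t = t + \<psi> (D q1) * \<gamma> (t - 0)" for t using zero[OF 2] far by (simp add: eq)
    then show ?thesis by blast
  next
    case 3
    then have "G x t = t + \<psi> (D p2) * \<gamma> (t - 1)" for t using zero[OF 3] far by (simp add: eq)
    then show ?thesis by blast
  next
    case 4
    then have "G x t = t + \<psi> (D q2) * \<gamma> (t - 1)" for t using zero[OF 4] far by (simp add: eq)
    then show ?thesis by blast
  next
    case 5
    \<comment> \<open>Since \<open>\<psi> \<delta> = 0\<close>, the identity also takes the common
      form.\<close>
    then have "G x t = t + \<psi> \<delta> * \<gamma> (t - 0)" for t by (simp add: eq psi_eq_0)
    then show ?thesis by blast
  qed
qed

text \<open>If the circle displacement is below 1/4, the coordinates form a lift of norm below 1/2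
  and \<open>bump_eq\<close> applies. Otherwise \<open>rep2\<close> may jump, but both sides lie
  outside the support of \<open>K\<close>.\<close>

lemma Pc_eq:
  assumes "x \<in> box eu es p" "z \<in> box eu es p"
  shows "Pc \<psi> (\<mu>u ^ n\<^sub>0) k eu es p x (y - circ s) z
    = z + tproj (proj.bump (p, circ s, p) K (x, y, z) *\<^sub>R eu)"
proof -
  obtain a b where ab: "(a, b) \<in> square" "x = p + tproj (a *\<^sub>R eu + b *\<^sub>R es)" "coords eu es p x = (a, b)"
    using assms(1) by (rule boxE)
  obtain d e where de: "(d, e) \<in> square" "z = p + tproj (d *\<^sub>R eu + e *\<^sub>R es)" "coords eu es p z = (d, e)"
    using assms(2) by (rule boxE)
  define c where "c = rep2 (y - circ s)"
  define v where "v = (a *\<^sub>R eu + b *\<^sub>R es, c, d *\<^sub>R eu + e *\<^sub>R es)"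
  have "P \<psi> (\<mu>u ^ n\<^sub>0) k (a, b, c, d, e) = d + K v"
    using K_eq_P[of "a *\<^sub>R eu + b *\<^sub>R es" c "d *\<^sub>R eu + e *\<^sub>R es"] by (simp add: v_def)
  then have "Pc \<psi> (\<mu>u ^ n\<^sub>0) k eu es p x (y - circ s) z = p + tproj ((d + K v) *\<^sub>R eu + e *\<^sub>R es)"
    by (simp add: Pc_def ab(3) de(3) c_def[symmetric] eu_es_point_def)
  also have "\<dots> = p + tproj ((d *\<^sub>R eu + e *\<^sub>R es) + K v *\<^sub>R eu)"
    by (simp add: scaleR_add_left add_ac)
  also have "\<dots> = z + tproj (K v *\<^sub>R eu)" by (simp only: tproj.pr_add de(2) add.assoc)
  also have "K v = proj.bump (p, circ s, p) K (x, y, z)"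
  proof (cases "\<bar>c\<bar> < 1/4")
    case True
    have "norm v \<le> norm (a *\<^sub>R eu + b *\<^sub>R es) + (norm c + norm (d *\<^sub>R eu + e *\<^sub>R es))"
      unfolding v_def by (rule order_trans[OF norm_Pair_le add_left_mono[OF norm_Pair_le]])
    then have "norm v < 1/2" using True norm_square[OF ab(1)] norm_square[OF de(1)] by (simp add: \<delta>_def)
    moreover have "(x, y, z) = (p, circ s, p) + proj v"
      unfolding v_def using rep2(3)[of "y - circ s"] by (simp add: ab(2) de(2) c_def)
    ultimately show ?thesis using proj.bump_eq by metis
  next
    case False
    have "norm c \<le> norm (c, d *\<^sub>R eu + e *\<^sub>R es)" by (rule norm_fst_le)
    also have "\<dots> \<le> norm v" unfolding v_def by (rule norm_snd_le)
    finally have "\<bar>c\<bar> \<le> norm v" by simp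
    then have "K v = 0" using False k_small by (intro K_eq_0) (simp add: \<delta>_def)
    moreover have "dist y (circ s) \<le> dist (x, y, z) (p, circ s, p)"
      using dist_snd_le[of "(x, y, z)" "(p, circ s, p)"] dist_fst_le[of "(y, z)" "(circ s, p)"] by simp
    then have "proj.bump (p, circ s, p) K (x, y, z) = 0"
      using dist_circ_rep2[of y s] False by (intro bump_eq_0_far) (simp add: c_def \<delta>_def)
    ultimately show ?thesis by simp
  qed
  finally show ?thesis .
qed

lemma I3_eq: "I3 \<psi> (\<mu>u ^ n\<^sub>0) k eu es p1 p2 x y z = z + tproj (h (x, y, z) *\<^sub>R eu)"
proof -
  have far_zero: "proj.bump (p', c, p') K (x, y, z) = 0"
    if "x \<in> box eu es p" "dist p p' > 10 * \<delta>" for p p' c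
  proof (rule bump_eq_0_far)
    have "dist x p < 8 * \<delta>" using that(1) by (rule boxE)
    then have "\<delta> \<le> dist x p'" using that(2) dist_triangle3[of p p' x] delta_pos by (simp add: dist_commute)
    then show "\<delta> \<le> dist (x, y, z) (p', c, p')" using dist_fst[of x p' y z c p'] by simp
  qed
  have out: "proj.bump (p, c, p) K (x, y, z) = 0" if "\<not> (x \<in> box eu es p \<and> z \<in> box eu es p)" for p c
  proof (rule bump_eq_0_far)
    have "5 * \<delta> \<le> dist x p \<or> 5 * \<delta> \<le> dist z p" using that not_box_dist by blast
    moreover have "dist z p \<le> dist (x, y, z) (p, c, p)"
      using dist_snd_le[of "(x, y, z)" "(p, c, p)"] dist_snd_le[of "(y, z)" "(c, p)"] by simp
    ultimately show "\<delta> \<le> dist (x, y, z) (p, c, p)"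
      using dist_fst[of x p y z c p] delta_pos by linarith
  qed
  have far': "dist p2 p1 > 10 * \<delta>" using far(1) by (simp add: dist_commute)
  consider "x \<in> box eu es p1 \<and> z \<in> box eu es p1"
    | "\<not> (x \<in> box eu es p1 \<and> z \<in> box eu es p1)" "x \<in> box eu es p2 \<and> z \<in> box eu es p2"
    | "\<not> (x \<in> box eu es p1 \<and> z \<in> box eu es p1)" "\<not> (x \<in> box eu es p2 \<and> z \<in> box eu es p2)"
    by blast
  then show ?thesis
  proof cases
    case 1
    then have "h (x, y, z) = proj.bump (p1, circ 0, p1) K (x, y, z)"
      using far_zero[of p1 p2] far(1) by (simp add: h_def)
    then show ?thesis using 1 Pc_eq[of x p1 z y 0] by (simp add: I3_def)
  next
    case 2
    then have "h (x, y, z) = proj.bump (p2, circ 1, p2) K (x, y, z)"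
      using far_zero[of p2 p1] far' by (simp add: h_def)
    then show ?thesis
      unfolding I3_def if_not_P[OF 2(1)] if_P[OF 2(2)] using 2 Pc_eq[of x p2 z y 1] by simp
  next
    case 3
    then have "h (x, y, z) = 0" using out by (simp add: h_def)
    then show ?thesis unfolding I3_def if_not_P[OF 3(1)] if_not_P[OF 3(2)] by simp
  qed
qed

text \<open>Near one of the two perturbed points the line is a coordinate line of \<open>P\<close>
  up to a constant, so \<open>P_slope\<close> applies. The radius \<open>4 * \<delta>\<close> leaves
  room for a displacement of length \<delta>.\<close>

lemma h_line_slope:
  assumes D: "((\<lambda>t. t + h (proj (v + (0, 0, t *\<^sub>R eu)))) has_real_derivative D) (at 0)"
  shows "\<bar>\<mu>u ^ n\<^sub>0 * D\<bar> \<le> \<mu>u ^ n\<^sub>1"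
proof -
  let ?P = "P \<psi> (\<mu>u ^ n\<^sub>0) k" and ?i = "(0, 0, 0, 1, 0) :: real \<times> real \<times> real \<times> real \<times> real"
  have dist_line: "dist (proj (v + (0, 0, t *\<^sub>R eu))) (proj v) \<le> \<bar>t\<bar>" for t
    using proj.dist_pr_le[of 0 "v + (0, 0, t *\<^sub>R eu)" v] norm_eu by (simp add: norm_Pair)
  have main: "\<bar>\<mu>u ^ n\<^sub>0 * D\<bar> \<le> \<mu>u ^ n\<^sub>1"
    if eq: "\<And>t. \<bar>t\<bar> < \<delta> \<Longrightarrow> t + h (proj (v + (0, 0, t *\<^sub>R eu))) = ?P (w + t *\<^sub>R ?i) + c" for w c
  proof -
    have "((\<lambda>t. ?P (w + t *\<^sub>R ?i) + c) has_real_derivative D) (at 0)"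
    proof (rule has_field_derivative_transform_within_open[OF D open_greaterThanLessThan[of "- \<delta>" \<delta>]])
      fix t assume "t \<in> {- \<delta><..<\<delta>}"
      then show "t + h (proj (v + (0, 0, t *\<^sub>R eu))) = ?P (w + t *\<^sub>R ?i) + c" by (intro eq) auto
    qed (use delta_pos in auto)
    from DERIV_cmult[OF DERIV_diff[OF this DERIV_const[of c]], of "\<mu>u ^ n\<^sub>0"]
    have "((\<lambda>t. \<mu>u ^ n\<^sub>0 * ?P (w + t *\<^sub>R ?i)) has_real_derivative \<mu>u ^ n\<^sub>0 * D) (at 0)" by simp
    then have "partial (\<lambda>w. \<mu>u ^ n\<^sub>0 * ?P w) ?i w = \<mu>u ^ n\<^sub>0 * D"
      unfolding partial_def by (rule DERIV_imp_deriv)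
    then show ?thesis using P_slope[of w] by simp
  qed
  have near: "\<bar>\<mu>u ^ n\<^sub>0 * D\<bar> \<le> \<mu>u ^ n\<^sub>1"
    if m: "dist (proj v) (p, c, p) < 4 * \<delta>" and pp: "dist p p' > 10 * \<delta>"
      and h: "\<And>m. h m = proj.bump (p, c, p) K m + proj.bump (p', c', p') K m" for p c p' c'
  proof -
    obtain u where u: "proj v = (p, c, p) + proj u" "norm u = dist (proj v) (p, c, p)"
      using proj.ex_lift by blast
    obtain x y z where xyz: "u = (x, y, z)" by (metis surj_pair)
    show ?thesis
    proof (rule main)
      fix t assume t: "\<bar>t\<bar> < \<delta>"
      have line: "proj (v + (0, 0, t *\<^sub>R eu)) = (p, c, p) + proj (x, y, z + t *\<^sub>R eu)"
      proof -
        have "proj u + proj (0, 0, t *\<^sub>R eu) = proj (x, y, z + t *\<^sub>R eu)"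
          unfolding proj.pr_add[symmetric] xyz by (simp only: add_Pair add_0_right)
        then show ?thesis by (simp only: proj.pr_add u(1) add.assoc)
      qed
      have "norm (x, y, z + t *\<^sub>R eu) \<le> norm u + norm ((0, 0, t *\<^sub>R eu) :: R5)"
        using norm_triangle_ineq[of u "(0, 0, t *\<^sub>R eu)"] by (simp add: xyz)
      also have "norm ((0, 0, t *\<^sub>R eu) :: R5) = \<bar>t\<bar>" using norm_eu by (simp add: norm_Pair)
      finally have small: "norm (x, y, z + t *\<^sub>R eu) < 5 * \<delta>" using u(2) m t by linarith
      then have "norm (x, y, z + t *\<^sub>R eu) < 1/2" by (simp add: \<delta>_def)
      then have 1: "proj.bump (p, c, p) K (proj (v + (0, 0, t *\<^sub>R eu))) = K (x, y, z + t *\<^sub>R eu)"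
        unfolding line by (rule proj.bump_eq)
      have "dist p p' \<le> dist (p, c, p) (p', c', p')" by (rule dist_fst)
      moreover have "dist (proj (v + (0, 0, t *\<^sub>R eu))) (p, c, p) \<le> norm (x, y, z + t *\<^sub>R eu)"
        unfolding line using proj.dist_pr_le[of "(p, c, p)" "(x, y, z + t *\<^sub>R eu)" 0] by simp
      ultimately have "\<delta> \<le> dist (proj (v + (0, 0, t *\<^sub>R eu))) (p', c', p')"
        using pp small delta_pos dist_triangle3[of "(p, c, p)" "(p', c', p')" "proj (v + (0, 0, t *\<^sub>R eu))"]
        by linarith
      then have 2: "proj.bump (p', c', p') K (proj (v + (0, 0, t *\<^sub>R eu))) = 0" by (rule bump_eq_0_far)
      have "?P ((x \<bullet> eu, x \<bullet> es, y, z \<bullet> eu, z \<bullet> es) + t *\<^sub>R ?i) = (z \<bullet> eu + t) + K (x, y, z + t *\<^sub>R eu)"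
        using K_eq_P[of x y "z + t *\<^sub>R eu"] by (simp add: inner_add_left)
      then show "t + h (proj (v + (0, 0, t *\<^sub>R eu)))
          = ?P ((x \<bullet> eu, x \<bullet> es, y, z \<bullet> eu, z \<bullet> es) + t *\<^sub>R ?i) + (- (z \<bullet> eu))"
        unfolding h 1 2 by simp
    qed
  qed
  consider "dist (proj v) (p1, circ 0, p1) < 4 * \<delta>" | "dist (proj v) (p2, circ 1, p2) < 4 * \<delta>"
    | "4 * \<delta> \<le> dist (proj v) (p1, circ 0, p1)" "4 * \<delta> \<le> dist (proj v) (p2, circ 1, p2)" by linarith
  then show ?thesis
  proof cases
    case 1
    then show ?thesis by (rule near[OF _ far(1)]) (simp add: h_def)
  next
    case 2
    have "dist p2 p1 > 10 * \<delta>" using far(1) by (simp add: dist_commute)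
    then show ?thesis by (rule near[OF 2]) (simp add: h_def)
  next
    case 3
    show ?thesis
    \<comment> \<open>Where \<open>h\<close> vanishes the slope is \<open>\<sigma>\<^sub>0\<close>
      itself. It too is a partial derivative of \<open>\<sigma>\<^sub>0 * P\<close>, taken at a
      point with \<open>a = 1\<close>, outside the support of the perturbation.\<close>
    proof (rule main[of "(1, 0, 0, 0, 0)" 0])
      fix t assume t: "\<bar>t\<bar> < \<delta>"
      have "\<delta> \<le> dist (proj (v + (0, 0, t *\<^sub>R eu))) m" if "4 * \<delta> \<le> dist (proj v) m" for m
        using that dist_line[of t] t dist_triangle3[of "proj v" m "proj (v + (0, 0, t *\<^sub>R eu))"]
        by linarith
      then have "h (proj (v + (0, 0, t *\<^sub>R eu))) = 0" using 3 by (simp add: h_def bump_eq_0_far)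
      moreover have "K (eu, 0, t *\<^sub>R eu) = 0"
      proof (rule K_eq_0)
        have "1 \<le> norm (eu, 0 :: real, t *\<^sub>R eu)" using norm_fst_le[of eu "(0 :: real, t *\<^sub>R eu)"] norm_eu by simp
        then show "2 * \<delta> / k \<le> norm (eu, 0 :: real, t *\<^sub>R eu)" using k_small by (simp add: \<delta>_def)
      qed
      then have "?P ((1, 0, 0, 0, 0) + t *\<^sub>R ?i) = t"
        using K_eq_P[of eu 0 "t *\<^sub>R eu"] by simp
      ultimately show "t + h (proj (v + (0, 0, t *\<^sub>R eu))) = ?P ((1, 0, 0, 0, 0) + t *\<^sub>R ?i) + 0" by simp
    qed
  qed
qed

sublocale skew_map eu es "\<mu>u ^ n\<^sub>1" "\<mu>s ^ n\<^sub>1" "\<mu>u ^ n\<^sub>0" "\<mu>s ^ n\<^sub>0" "Alin ^^ n\<^sub>1" "Alin ^^ n\<^sub>0"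
  "A ^^ n\<^sub>1" "A ^^ n\<^sub>0" G g2 h f
proof (rule skew_map.intro[OF orthonormal_plane_axioms], rule skew_map_axioms.intro)
  have n: "n\<^sub>0 > 0" "n\<^sub>1 > 0" using expanding by (auto intro: gr0I)
  show "1 < \<mu>u ^ n\<^sub>1" "1 < \<mu>u ^ n\<^sub>0" by (fact expanding)+
  show "0 < \<mu>s ^ n\<^sub>1" "0 < \<mu>s ^ n\<^sub>0" "\<mu>s ^ n\<^sub>1 < 1" "\<mu>s ^ n\<^sub>0 < 1"
    using mu n by (auto intro: power_less_one_iff[THEN iffD2] simp: power_less_one_iff)
  show "linear (Alin ^^ n\<^sub>1)" "linear (Alin ^^ n\<^sub>0)" by (fact Alin_iterate_linear)+
  show "(Alin ^^ n\<^sub>1) eu = \<mu>u ^ n\<^sub>1 *\<^sub>R eu" "(Alin ^^ n\<^sub>1) es = \<mu>s ^ n\<^sub>1 *\<^sub>R es"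
    "(Alin ^^ n\<^sub>0) eu = \<mu>u ^ n\<^sub>0 *\<^sub>R eu" "(Alin ^^ n\<^sub>0) es = \<mu>s ^ n\<^sub>0 *\<^sub>R es"
    by (fact iterate_eigen)+
  show "bij (A ^^ n\<^sub>1)" "bij (A ^^ n\<^sub>0)" by (fact A_iterate_bij)+
  show "(A ^^ n\<^sub>1) (u + v) = (A ^^ n\<^sub>1) u + (A ^^ n\<^sub>1) v" "(A ^^ n\<^sub>0) (u + v) = (A ^^ n\<^sub>0) u + (A ^^ n\<^sub>0) v"
    for u v by (fact A_iterate_add)+
  show "(A ^^ n\<^sub>1) (tproj v) = tproj ((Alin ^^ n\<^sub>1) v)" "(A ^^ n\<^sub>0) (tproj v) = tproj ((Alin ^^ n\<^sub>0) v)"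
    for v by (fact A_iterate_tproj)+
  show "g2 (tproj x) (circ t) = circ (G x t)" for x t by (rule g2_circ)
  show "C1 (\<lambda>p. G (fst p) (snd p))"
  proof -
    have 1: "C1 (\<lambda>p::(real \<times> real) \<times> real. fst p)" "C1 (\<lambda>p::(real \<times> real) \<times> real. snd p)"
      "C1 (\<lambda>p::(real \<times> real) \<times> real. snd p - 1)"
      using C1_add[OF C1_bounded_linear[OF bounded_linear_snd] C1_const[of "- 1"]]
      by (auto intro: C1_bounded_linear bounded_linear_fst bounded_linear_snd)
    have B: "C1 (\<lambda>p::(real \<times> real) \<times> real. \<psi> (dist (tproj (fst p)) c))" for c
      using C1_compose[OF C1_psi_dist 1(1)] .
    show ?thesis unfolding G_def
      by (intro C1_add C1_mult B 1 C1_compose[OF C1_gamma])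
  qed
  show "C1 (\<lambda>v. h (proj v))" unfolding h_def
    using k_small by (intro C1_add proj.C1_bump[OF C1_K K_eq_0]) (auto simp: \<delta>_def)
  show "strict_mono (G x)" for x
  proof -
    obtain r s where "\<And>t. G x t = t + \<psi> r * \<gamma> (t - s)" using G_cases by blast
    then have "G x = (\<lambda>t. t + \<psi> r * \<gamma> (t - s))" by blast
    then show ?thesis using cutoff_strict_mono[of r s] by simp
  qed
  show "G x (t + 2) = G x t + 2" for x t
    using gamma_periodic[of t] gamma_periodic[of "t - 1"] by (simp add: G_def algebra_simps)
  show "\<exists>M. \<forall>m. \<bar>h m\<bar> \<le> M"
  proof -
    obtain M where M: "\<And>m p. \<bar>proj.bump p K m\<bar> \<le> M" using bump_bounded by blast
    have "\<bar>h m\<bar> \<le> M + M" for m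
      unfolding h_def using M[of "(p1, circ 0, p1)" m] M[of "(p2, circ 1, p2)" m] by linarith
    then show ?thesis by blast
  qed
  show "f (x, y, z) = ((A ^^ n\<^sub>1) x, g2 x y, (A ^^ n\<^sub>0) (z + tproj (h (x, y, z) *\<^sub>R eu)))" for x y z
    by (simp add: f_def f_map_def I_map_def g2_def max_eigenvalue_iterate I3_eq)
  show "\<bar>\<mu>u ^ n\<^sub>0 * D\<bar> \<le> \<mu>u ^ n\<^sub>1"
    if "((\<lambda>t. t + h (proj (v + (0, 0, t *\<^sub>R eu)))) has_real_derivative D) (at 0)" for v D
    using that by (rule h_line_slope)
qed

end

section \<open>From the dominated splitting to the two sinks\<close>

lemma dim_set_plus_le:
  fixes S T :: "'a::euclidean_space set"
  assumes "subspace S" "subspace T"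
  shows "subspace (S + T)" "dim (S + T) \<le> dim S + dim T"
proof -
  have eq: "S + T = {x + y |x y. x \<in> S \<and> y \<in> T}" by (auto simp: set_plus_def)
  show "subspace (S + T)" unfolding eq using assms by (rule subspace_sums)
  show "dim (S + T) \<le> dim S + dim T" using dim_sums_Int[OF assms] unfolding eq by linarith
qed

context example
begin

lemma skew_system_of_splitting:
  assumes split: "dominated_splitting f [Euu, Eu eu, TS, Es, Ess]"
    and dims: "\<forall>E\<in>{Euu, TS, Es, Ess}. \<forall>x. dim (E x) = 1"
    and Ecs: "Ecs = (\<lambda>x. TS x + Es x + Ess x)"
  shows "skew_system eu es (\<mu>u ^ n\<^sub>1) (\<mu>s ^ n\<^sub>1) (\<mu>u ^ n\<^sub>0) (\<mu>s ^ n\<^sub>0) (Alin ^^ n\<^sub>1) (Alin ^^ n\<^sub>0)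
    (A ^^ n\<^sub>1) (A ^^ n\<^sub>0) G g2 h f Ecs"
proof (rule skew_system.intro[OF skew_map_axioms], rule skew_system_axioms.intro)
  have split': "\<forall>E\<in>set [Euu, Eu eu, TS, Es, Ess]. invariant_subbundle f E"
      "\<forall>x. (\<Sum>E\<leftarrow>[Euu, Eu eu, TS, Es, Ess]. E x) = UNIV"
      "\<forall>i\<in>{1..<length [Euu, Eu eu, TS, Es, Ess]}. dominates f (\<lambda>x. \<Sum>E\<leftarrow>take i [Euu, Eu eu, TS, Es, Ess]. E x)
       (\<lambda>x. \<Sum>E\<leftarrow>drop i [Euu, Eu eu, TS, Es, Ess]. E x)"
    using split unfolding dominated_splitting_def by blast+
  have inv: "\<And>E. E \<in> {Euu, Eu eu, TS, Es, Ess} \<Longrightarrow> invariant_subbundle f E"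
    and total: "\<And>x. Euu x + (Eu eu x + (TS x + (Es x + Ess x))) = UNIV"
    using split'(1) split'(2)[rule_format] by (auto simp del: split_paired_All)
  have image: "tderiv f x ` E x = E (f x)" and sub: "subspace (E x)"
    if "E \<in> {Euu, Eu eu, TS, Es, Ess}" for E x
    using inv[OF that] unfolding invariant_subbundle_def by blast+
  have lin: "linear (tderiv f m)" for m
    using linear_F' tderiv_f proj.pr_surj by metis
  have Ecs': "Ecs x = TS x + (Es x + Ess x)" for x by (simp add: Ecs add.assoc)
  \<comment> \<open>The cut after the second bundle compares \<open>Euu + Eu\<close> with
    \<open>Ecs\<close>.\<close>
  have d2: "dominates f (\<lambda>x. Euu x + Eu eu x) Ecs"
    using split'(3)[rule_format, of 2] by (simp add: Ecs' fun_eq_iff[symmetric] Ecs add.assoc)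
  have Ecs_sub: "subspace (Ecs x)" for x
    using d2 unfolding dominates_def invariant_subbundle_def by blast
  \<comment> \<open>The bundles at \<open>f x\<close> are images of those at \<open>x\<close> and
    together span the tangent space.\<close>
  show "surj (tderiv f x)" for x
  proof -
    have "w \<in> range (tderiv f x)" for w
    proof -
      have "w \<in> Euu (f x) + (Eu eu (f x) + (TS (f x) + (Es (f x) + Ess (f x))))" using total by simp
      then obtain a b c d e where w: "w = a + (b + (c + (d + e)))" "a \<in> Euu (f x)" "b \<in> Eu eu (f x)"
        "c \<in> TS (f x)" "d \<in> Es (f x)" "e \<in> Ess (f x)" by (auto elim!: set_plus_elim)
      have "subspace (range (tderiv f x))" using lin by (rule linear_subspace_image) simp
      moreover have "a \<in> range (tderiv f x)" "b \<in> range (tderiv f x)" "c \<in> range (tderiv f x)"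
        "d \<in> range (tderiv f x)" "e \<in> range (tderiv f x)"
        using w image[of Euu x] image[of "Eu eu" x] image[of TS x] image[of Es x] image[of Ess x] by blast+
      ultimately show ?thesis unfolding w(1) by (intro subspace_add)
    qed
    then show ?thesis by blast
  qed
  show "subspace (Ecs x)" for x by (rule Ecs_sub)
  \<comment> \<open>Three line fields give at most 3; the total dimension 5, with at most 1 from
    each of the other two bundles, gives at least 3.\<close>
  show dim: "dim (Ecs x) = 3" for x
  proof -
    have "dim (Ecs x) \<le> dim (TS x) + dim (Es x + Ess x)"
      unfolding Ecs' by (intro dim_set_plus_le sub) auto
    also have "dim (Es x + Ess x) \<le> dim (Es x) + dim (Ess x)" by (intro dim_set_plus_le sub) auto
    finally have le: "dim (Ecs x) \<le> 3" using dims by simp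
    have "dim (Euu x + (Eu eu x + Ecs x)) \<le> dim (Euu x) + dim (Eu eu x + Ecs x)"
      by (intro dim_set_plus_le sub Ecs_sub) auto
    also have "dim (Eu eu x + Ecs x) \<le> dim (Eu eu x) + dim (Ecs x)"
      by (intro dim_set_plus_le sub Ecs_sub) auto
    also have "dim (Eu eu x) \<le> 1"
      unfolding Eu_def dim_span using dim_le_card'[of "{((0, 0), 0, eu)}"] by simp
    finally have "dim (UNIV :: R5 set) \<le> 2 + dim (Ecs x)" using dims total[of x] by (simp add: Ecs')
    then show ?thesis using le by simp
  qed
  show "tderiv f x w \<in> Ecs (f x)" if "w \<in> Ecs x" for x w
  proof -
    have "tderiv f x ` Ecs x = Ecs (f x)"
      using d2 unfolding dominates_def invariant_subbundle_def by blast
    then show ?thesis using that by blast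
  qed
  obtain c \<sigma> where c: "c > 0" "\<sigma> < 1" "\<And>x v w n. v \<in> Euu x + Eu eu x \<Longrightarrow> v \<noteq> 0 \<Longrightarrow> w \<in> Ecs x \<Longrightarrow> w \<noteq> 0 \<Longrightarrow> n \<ge> 1 \<Longrightarrow>
      norm (tderiv (f ^^ n) x w) / norm (tderiv (f ^^ n) x v) \<le> c * \<sigma> ^ n * (norm w / norm v)"
    using d2 unfolding dominates_def by blast
  have ratio: "norm (tderiv (f ^^ n) x w) / norm (tderiv (f ^^ n) x (0, 0, eu)) \<le> c * \<sigma> ^ n * norm w"
    if "w \<in> Ecs x" "w \<noteq> 0" "n \<ge> 1" for x w n
  proof -
    have "0 \<in> Euu x" by (rule subspace_0[OF sub]) simp
    moreover have "(0, 0, eu) \<in> Eu eu x" by (simp add: Eu_def zero_prod_def span_base)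
    ultimately have "0 + (0, 0, eu) \<in> Euu x + Eu eu x" by (rule set_plus_intro)
    moreover have "(0, 0, eu) \<noteq> (0 :: R5)" using norm_eu by (auto simp: zero_prod_def)
    moreover have "norm ((0, 0, eu) :: R5) = 1" using norm_eu by (simp add: norm_Pair)
    ultimately show ?thesis using c(3)[of "(0, 0, eu)" x w n] that by simp
  qed
  \<comment> \<open>Domination bounds \<sigma> only from above. A negative value contradicts the
    estimate for \<open>n = 1\<close> at a nonzero vector of \<open>Ecs\<close>.\<close>
  have "\<sigma> \<ge> 0"
  proof (rule ccontr)
    assume \<sigma>: "\<not> \<sigma> \<ge> 0"
    have "\<not> Ecs 0 \<subseteq> {0}"
    proof
      assume "Ecs 0 \<subseteq> {0}"
      then have "dim (Ecs 0) = 0" by (simp add: dim_eq_0)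
      then show False using dim[of 0] by simp
    qed
    then obtain w where w: "w \<in> Ecs 0" "w \<noteq> 0" by blast
    have "0 \<le> norm (tderiv (f ^^ 1) 0 w) / norm (tderiv (f ^^ 1) 0 (0, 0, eu))" by simp
    also have "\<dots> \<le> c * \<sigma> ^ 1 * norm w" by (rule ratio[OF w]) simp
    also have "\<dots> < 0" using c(1) \<sigma> w by (simp add: mult_neg_pos mult_pos_neg)
    finally show False by simp
  qed
  then show "\<exists>c>0. \<exists>\<sigma>\<ge>0. \<sigma> < 1 \<and> (\<forall>m w n. w \<in> Ecs m \<longrightarrow> w \<noteq> 0 \<longrightarrow> n \<ge> 1 \<longrightarrow>
        norm (tderiv (f ^^ n) m w) / norm (tderiv (f ^^ n) m (0, 0, eu)) \<le> c * \<sigma> ^ n * norm w)"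
    using c(1,2) ratio by blast
qed

text \<open>All integers are covered because the repelling level of the second sink is represented
  by 2.\<close>

lemma g2_integer: "g2 x (circ (of_int n)) = circ (of_int n)"
proof -
  obtain v where v: "x = tproj v" using tproj.pr_surj by blast
  have "\<gamma> (of_int n) = 0" for n :: int
  proof -
    have "\<gamma> (of_int n) = \<gamma> (of_int (n mod 2) + of_int (n div 2) * 2)"
      by (metis (no_types, opaque_lifting) mod_mult_div_eq mult.commute of_int_add of_int_mult of_int_numeral)
    also have "\<dots> = \<gamma> (of_int (n mod 2))" by (rule gamma_periodic_int)
    also have "n mod 2 = 0 \<or> n mod 2 = 1" by presburger
    then have "\<gamma> (of_int (n mod 2)) = 0" using gamma_zeros by auto
    finally show ?thesis .
  qed
  from this[of n] this[of "n - 1"] show ?thesis unfolding v g2_circ by (simp add: G_def)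
qed

lemma sink_of_splitting:
  assumes "dominated_splitting f [Euu, Eu eu, TS, Es, Ess]"
    "\<forall>E\<in>{Euu, TS, Es, Ess}. \<forall>x. dim (E x) = 1" "Ecs = (\<lambda>x. TS x + Es x + Ess x)"
    and q: "(q = q1 \<and> y0 = 0) \<or> (q = q2 \<and> y0 = 1)" and fixed: "(A ^^ n\<^sub>1) q = q" "(A ^^ n\<^sub>0) q = q"
  shows "sink eu es (\<mu>u ^ n\<^sub>1) (\<mu>s ^ n\<^sub>1) (\<mu>u ^ n\<^sub>0) (\<mu>s ^ n\<^sub>0) (Alin ^^ n\<^sub>1) (Alin ^^ n\<^sub>0)
    (A ^^ n\<^sub>1) (A ^^ n\<^sub>0) G g2 h f Ecs q y0 (\<delta>/2) \<phi> (deriv \<phi>)"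
proof (rule sink.intro[OF skew_system_of_splitting[OF assms(1-3)]], rule sink_axioms.intro)
  have q_far: "dist q p1 > 10 * \<delta>" "dist q p2 > 10 * \<delta>" using q far by (auto simp: dist_commute)
  show "(A ^^ n\<^sub>1) q = q" "(A ^^ n\<^sub>0) q = q" by (fact fixed)+
  show "0 < \<delta> / 2" using delta_pos by simp
  \<comment> \<open>Up to distance \<open>\<delta>/2\<close> the cutoff at \<open>q\<close> is
    identically 1 and the other three are 0; this explains the radius of the sink.\<close>
  show "G x (y0 + t) = y0 + \<phi> t" if near: "dist (tproj x) q < \<delta>/2" for x t
  proof -
    have one: "\<psi> (dist (tproj x) q) = 1" using near by (intro psi_eq_1) auto
    have zero: "\<psi> (dist (tproj x) p') = 0" if "dist q p' > 10 * \<delta> \<or> dist p' q > 10 * \<delta>" for p'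
      using near that delta_pos by (intro psi_dist_eq_0[of "tproj x" q]) auto
    show ?thesis using q
    proof
      assume q1: "q = q1 \<and> y0 = 0"
      then have "\<psi> (dist (tproj x) q2) = 0" using far by (intro zero) auto
      then show ?thesis using q1 one zero[of p1] zero[of p2] q_far by (simp add: G_def \<gamma>_def)
    next
      assume q2: "q = q2 \<and> y0 = 1"
      then have "\<psi> (dist (tproj x) q1) = 0" using far by (intro zero) auto
      then show ?thesis using q2 one zero[of p1] zero[of p2] q_far by (simp add: G_def \<gamma>_def)
    qed
  qed
  show "h (x, y, z) = 0" if near: "dist x q < \<delta>/2" for x y z
  proof -
    have "\<delta> \<le> dist (x, y, z) (p', c, p')" if "dist q p' > 10 * \<delta>" for p' c
      using that near dist_triangle3[of q p' x] dist_fst[of x p' y z c p'] delta_pos by linarith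
    then show ?thesis using q_far by (simp add: h_def bump_eq_0_far)
  qed
  show "g2 x (circ y0) = circ y0" "g2 x (circ (y0 + 1)) = circ (y0 + 1)" for x
    using q g2_integer[of x 0] g2_integer[of x 1] g2_integer[of x 2] by auto
  show "\<phi> 0 = 0" by (rule phi_0)
  show "(\<phi> has_real_derivative deriv \<phi> t) (at t)" for t by (rule smooth_DERIV[OF phi(1)])
  show "0 < deriv \<phi> 0" "deriv \<phi> 0 < 1" using phi(4) by auto
  show "0 < \<phi> t \<and> \<phi> t < t" if "0 < t" "t < 1" for t using phi_attracts(1)[OF that] .
  show "t < \<phi> t \<and> \<phi> t < 0" if "- 1 < t" "t < 0" for t using phi_attracts(2)[OF that] .
  show "\<exists>a. dist (q + tproj (a *\<^sub>R eu)) w < \<epsilon>" if "0 < \<epsilon>" for w \<epsilon> using leaf_u_dense[OF that] .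
  show "\<exists>c x0. \<bar>c - \<alpha>\<bar> < \<epsilon> \<and> (\<forall>x. x \<bullet> eu = c \<longrightarrow> tproj x = q + tproj (((x - x0) \<bullet> es) *\<^sub>R es))"
    if "0 < \<epsilon>" for \<alpha> \<epsilon> using leaf_s_dense[OF that] .
qed

end

theorem theorem5p3:
  fixes \<psi> \<phi> :: "real \<Rightarrow> real" and eu es :: "real \<times> real" and \<beta> k \<sigma>\<^sub>0 \<sigma>\<^sub>1 \<mu>u \<mu>s :: real
    and n\<^sub>0 n\<^sub>1 :: nat and p1 p2 q1 q2 :: torus and f :: "mfd \<Rightarrow> mfd"
    and Euu TS Es Ess :: subbundle and Ecs :: subbundle
  assumes eigenvectors: "norm eu = 1" "norm es = 1" "eu \<bullet> es = 0"
      "Alin eu = \<mu>u *\<^sub>R eu" "\<bar>\<mu>u\<bar> > 1" "Alin es = \<mu>s *\<^sub>R es" "\<bar>\<mu>s\<bar> < 1"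
    and psi: "smooth \<psi>" "\<forall>x. \<psi> (- x) = \<psi> x" "\<forall>x\<in>{0..\<delta>/2}. \<psi> x = 1" "\<forall>x\<ge>\<delta>. \<psi> x = 0"
      "strict_mono_on {\<delta>/2<..<\<delta>} \<psi> \<or> strict_antimono_on {\<delta>/2<..<\<delta>} \<psi>"
    and phi: "smooth \<phi>" "bij \<phi>" "smooth (inv \<phi>)" "\<forall>x. \<phi> (x + 2) = \<phi> x + 2"
      "{x\<in>{0..2}. \<phi> x = x} = {0, 1, 2}" "deriv \<phi> 0 = 1/2" "deriv \<phi> 1 = 3/2"
      "1 + (INF (x, y). (deriv \<phi> x - 1) * \<psi> y) > 0"
    and points: "(A ^^ n\<^sub>0) p1 = p1" "(A ^^ n\<^sub>0) p2 = p2" "(A ^^ n\<^sub>0) q1 = q1" "(A ^^ n\<^sub>0) q2 = q2"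
      "dist p1 p2 > 10 * \<delta>" "dist p1 q1 > 10 * \<delta>" "dist p1 q2 > 10 * \<delta>"
      "dist p2 q1 > 10 * \<delta>" "dist p2 q2 > 10 * \<delta>" "dist q1 q2 > 10 * \<delta>"
    and sigma0: "\<sigma>\<^sub>0 = max_eigenvalue (Alin ^^ n\<^sub>0)"
      "\<sigma>\<^sub>0 \<ge> 10000 * max (SUP v. partial (Q \<psi> \<phi>) (0, 0, 1) v)
                        (inverse (INF v. partial (Q \<psi> \<phi>) (0, 0, 1) v))"
    and beta: "\<beta> > 0" "\<beta> \<le> \<delta>/2 * (1/10000)" "2 * \<beta>\<^sup>2 * ln (3/4) + (1 - 2 * \<beta>\<^sup>2) * ln \<sigma>\<^sub>0 > 0"
      "\<forall>x\<in>{-\<beta>..\<beta>}. \<bar>deriv \<phi> x - 1/2\<bar> < 1/10000"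
    and k: "k > 0" "(3 * \<delta>/2) / k \<le> \<beta> / 10000"
    and sigma1: "\<sigma>\<^sub>1 = max_eigenvalue (Alin ^^ n\<^sub>1)"
      "\<forall>i\<in>Basis. \<forall>v. \<sigma>\<^sub>1 > \<bar>partial (\<lambda>w. \<sigma>\<^sub>0 * P \<psi> \<sigma>\<^sub>0 k w) i v\<bar>"
      "\<forall>i\<in>Basis. \<forall>v. \<sigma>\<^sub>1 > \<bar>partial (Q \<psi> \<phi>) i v\<bar>"
      "(A ^^ n\<^sub>1) p1 = p1" "(A ^^ n\<^sub>1) p2 = p2" "(A ^^ n\<^sub>1) q1 = q1" "(A ^^ n\<^sub>1) q2 = q2"
    and f: "f = f_map \<psi> \<phi> n\<^sub>0 n\<^sub>1 k eu es p1 p2 q1 q2"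
    and splitting: "dominated_splitting f [Euu, Eu eu, TS, Es, Ess]"
      "\<forall>E\<in>{Euu, TS, Es, Ess}. \<forall>x. dim (E x) = 1"
      "uniformly_expanding f Euu"
      "Ecs = (\<lambda>x. TS x + Es x + Ess x)"
  shows "skeleton f Ecs {(q1, circ 0, q1), (q2, circ 1, q2)}
    \<and> {(p1, circ 0, p1), (q2, circ 0, q2)} \<subseteq> closure (Wu (q1, circ 0, q1) f)
    \<and> {(p2, circ 1, p2), (q1, circ 1, q1)} \<subseteq> closure (Wu (q2, circ 1, q2) f)"
proof -
  interpret orthonormal_plane eu es by unfold_locales (fact eigenvectors)+
  interpret cat_map eu es \<mu>u \<mu>s by unfold_locales (fact eigenvectors)+
  interpret circle_map \<psi> \<phi>
    by unfold_locales (fact psi(1-4) phi(1,4,5,6,8))+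
  have \<sigma>\<^sub>0: "\<sigma>\<^sub>0 = \<mu>u ^ n\<^sub>0" and \<sigma>\<^sub>1: "\<sigma>\<^sub>1 = \<mu>u ^ n\<^sub>1"
    using sigma0(1) sigma1(1) by (simp_all add: max_eigenvalue_iterate)
  \<comment> \<open>In the logarithmic condition on \<beta> the first term is nonpositive and the
    coefficient of \<open>ln \<sigma>\<^sub>0\<close> is positive.\<close>
  have "1 < \<sigma>\<^sub>0"
  proof -
    have "\<beta> \<le> 1/2" using beta(2) by (simp add: \<delta>_def)
    then have "\<beta>\<^sup>2 \<le> (1/2)\<^sup>2" using beta(1) by (intro power_mono) auto
    then have b: "0 < 1 - 2 * \<beta>\<^sup>2" by (simp add: power2_eq_square)
    have "ln (3/4) \<le> (0::real)" by simp
    then have "2 * \<beta>\<^sup>2 * ln (3/4) \<le> 0" by (intro mult_nonneg_nonpos) auto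
    then have "0 < (1 - 2 * \<beta>\<^sup>2) * ln \<sigma>\<^sub>0" using beta(3) by linarith
    then have "0 < ln \<sigma>\<^sub>0" using b zero_less_mult_pos by blast
    moreover have "0 < \<sigma>\<^sub>0" using mu by (simp add: \<sigma>\<^sub>0)
    ultimately show ?thesis by simp
  qed
  \<comment> \<open>At \<open>(1, 0, 0)\<close> the cutoff vanishes, so \<open>Q\<close> is the
    projection to \<open>c\<close> along the third axis, with partial derivative 1.\<close>
  have "1 < \<sigma>\<^sub>1"
  proof -
    have "Q \<psi> \<phi> ((1, 0, 0) + t *\<^sub>R (0, 0, 1)) = t" for t
      using psi_eq_0[of 1] by (simp add: Q_def \<delta>_def)
    then have "partial (Q \<psi> \<phi>) (0, 0, 1) (1, 0, 0) = 1" by (simp add: partial_def)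
    moreover have "(0, 0, 1) \<in> (Basis :: (real \<times> real \<times> real) set)" by (simp add: Basis_prod_def)
    ultimately show ?thesis using sigma1(3) by (metis abs_one)
  qed
  have "2 < k"
  proof -
    have "(3 * \<delta>/2) / k \<le> \<delta> / 2" using k(2) beta(1,2) delta_pos by (simp add: \<delta>_def)
    then have "3 * \<delta> \<le> \<delta> * k" using k(1) by (simp add: field_simps)
    then show ?thesis using delta_pos by simp
  qed
  interpret example eu es \<mu>u \<mu>s \<psi> \<phi> k n\<^sub>0 n\<^sub>1 p1 p2 q1 q2
  proof
    show "1 < \<mu>u ^ n\<^sub>0" "1 < \<mu>u ^ n\<^sub>1" using \<open>1 < \<sigma>\<^sub>0\<close> \<open>1 < \<sigma>\<^sub>1\<close> \<sigma>\<^sub>0 \<sigma>\<^sub>1 by simp_all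
    show "\<bar>partial (\<lambda>w. \<mu>u ^ n\<^sub>0 * P \<psi> (\<mu>u ^ n\<^sub>0) k w) (0, 0, 0, 1, 0) v\<bar> < \<mu>u ^ n\<^sub>1" for v
    proof -
      have "(0, 0, 0, 1, 0) \<in> (Basis :: (real \<times> real \<times> real \<times> real \<times> real) set)" by (simp add: Basis_prod_def)
      then show ?thesis using sigma1(2) unfolding \<sigma>\<^sub>0 \<sigma>\<^sub>1 by blast
    qed
  qed (fact points(5-10) \<open>2 < k\<close>)+
  let ?f = "example.f eu es \<psi> \<phi> k n\<^sub>0 n\<^sub>1 p1 p2 q1 q2"
  have f_eq: "f = ?f" by (simp add: assms f_def)
  note split = splitting(1,2,4)[unfolded f_eq]
  interpret s1: sink eu es "\<mu>u ^ n\<^sub>1" "\<mu>s ^ n\<^sub>1" "\<mu>u ^ n\<^sub>0" "\<mu>s ^ n\<^sub>0" "Alin ^^ n\<^sub>1" "Alin ^^ n\<^sub>0"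
    "A ^^ n\<^sub>1" "A ^^ n\<^sub>0" G g2 h ?f Ecs q1 0 "\<delta>/2" \<phi> "deriv \<phi>"
    by (rule sink_of_splitting[OF split]) (use sigma1(6) points(3) in auto)
  interpret s2: sink eu es "\<mu>u ^ n\<^sub>1" "\<mu>s ^ n\<^sub>1" "\<mu>u ^ n\<^sub>0" "\<mu>s ^ n\<^sub>0" "Alin ^^ n\<^sub>1" "Alin ^^ n\<^sub>0"
    "A ^^ n\<^sub>1" "A ^^ n\<^sub>0" G g2 h ?f Ecs q2 1 "\<delta>/2" \<phi> "deriv \<phi>"
    by (rule sink_of_splitting[OF split]) (use sigma1(7) points(4) in auto)
  have circ_ne: "(circ 0 :: 2 circle) \<noteq> circ 1"
  proof
    assume "(circ 0 :: 2 circle) = circ 1"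
    then obtain n :: int where "0 = 1 + real_of_int n * 2" unfolding circ2_eq by blast
    then have "real_of_int (1 + n * 2) = 0" by simp
    then have "1 + n * 2 = 0" by (simp only: of_int_eq_0_iff)
    then show False by presburger
  qed
  \<comment> \<open>The repeller \<open>y0 + 1\<close> of the second sink is the attracting level of
    the first, so the centre of a disk avoids at least one of the two repellers.\<close>
  have circ_2: "(circ (1 + 1) :: 2 circle) = circ 0" unfolding circ2_eq by (rule exI[of _ 1]) simp
  have "skeleton f Ecs {(q1, circ 0, q1), (q2, circ 1, q2)}"
    unfolding skeleton_def f_eq
  proof (intro conjI ballI allI impI)
    fix V g L assume D: "c1_disk V g L \<and> disk_transverse V g L Ecs"
    show "\<exists>p\<in>{(q1, circ 0, q1), (q2, circ 1, q2)}. disk_meets_transversely V g L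
        (Ws_orb p ?f)"
    proof (cases "fst (snd (g 0)) = circ 1")
      case False
      then show ?thesis using s1.meets_transversely[of V g L] D by auto
    next
      case True
      then have "fst (snd (g 0)) \<noteq> circ (1 + 1)" using circ_ne unfolding circ_2 by simp
      then show ?thesis using s2.meets_transversely[of V g L] D by auto
    qed
  next
    fix p q :: mfd assume pq: "p \<in> {(q1, circ 0, q1), (q2, circ 1, q2)}" "q \<in> {(q1, circ 0, q1), (q2, circ 1, q2)}" "p \<noteq> q"
    show "Ws_orb p ?f \<inter> Wu_orb q ?f = {}"
    proof -
      have False if "m \<in> Ws_orb (q1, circ 0, q1) ?f" "m \<in> Wu_orb (q2, circ 1, q2) ?f" for m
        using s1.Ws_orb_fst_snd[OF s2.g2_y0 that(1) s2.Wu_orb_fst_snd[OF that(2)]] circ_ne by simp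
      moreover have False if "m \<in> Ws_orb (q2, circ 1, q2) ?f" "m \<in> Wu_orb (q1, circ 0, q1) ?f" for m
        using s2.Ws_orb_fst_snd[OF s1.g2_y0 that(1) s1.Wu_orb_fst_snd[OF that(2)]] circ_ne by simp
      ultimately show ?thesis using pq by (elim insertE emptyE) (simp_all only:, blast+)
    qed
  next
    fix p :: mfd assume "p \<in> {(q1, circ 0, q1), (q2, circ 1, q2)}"
    then show "hyperbolic_periodic ?f p"
      "stable_index ?f p = dim (Ecs p)"
      using s1.hyperbolic_p s2.hyperbolic_p s1.stable_index_p s2.stable_index_p by auto
  qed simp
  then show ?thesis
    using s1.closure_Wu s2.closure_Wu unfolding f_eq by auto
qed

end
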